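(* Let $\mathbf{k}$ be a field, let $A$ be a finitely generated $\mathbf{k}$-algebra which is a domain, let $\mathcal{B}=\{b_1,\dots,b_n\}$ be a set of algebra generators of $A$ and let $I$ be the kernel of $\pi:\mathbf{k}[x_1,\dots,x_n]\to A$, $x_i\mapsto b_i$. Let $\mathfrak{v}=\mathfrak{v}_M:A\setminus\{0\}\to\mathbb{Q}^r$ be a weight valuation with weighting matrix $M\in\mathbb{Q}^{r\times n}$ corresponding to this presentation. Then there is a prime cone $C_{\mathfrak{v}}\subset\mathcal{T}(I)$ such that $$\mathbf{k}[x_1,\dots,x_n]/\mathrm{in}_{C_{\mathfrak{v}}}(I)\cong\mathrm{gr}_{\mathfrak{v}}(A).$$ In particular, there exists such a prime cone $C_{\mathfrak{v}}$ for any valuation $\mathfrak{v}$ on $A$ that is subductive with respect to $\mathcal{B}$. Furthermore, if $A$ is positively graded (graded by $\mathbb{Z}_{\ge0}$) and $\mathcal{B}$ consists of homogeneous elements, then there is such a prime cone $C_{\mathfrak{v}}$ associated to any valuation $\mathfrak{v}$ on $A$ with Khovanskii basis $\mathcal{B}$.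
   Context: Valuations: $\mathbb{Q}^r$ is equipped with a total ordering $\succ$ compatible with addition. A valuation over $\mathbf{k}$ is a map $\mathfrak{v}:A\setminus\{0\}\to\mathbb{Q}^r$ (with discrete image) with $\mathfrak{v}(f+g)\succeq\min\{\mathfrak{v}(f),\mathfrak{v}(g)\}$ (if $f+g\ne0$), $\mathfrak{v}(fg)=\mathfrak{v}(f)+\mathfrak{v}(g)$, and $\mathfrak{v}(cf)=\mathfrak{v}(f)$ for $0\neq c\in\mathbf{k}$. Put $F_{\mathfrak{v}\succeq a}=\{f\ne0\mid\mathfrak{v}(f)\succeq a\}\cup\{0\}$, similarly $F_{\mathfrak{v}\succ a}$, and $\mathrm{gr}_{\mathfrak{v}}(A)=\bigoplus_aF_{\mathfrak{v}\succeq a}/F_{\mathfrak{v}\succ a}$; $\bar f$ denotes the class of $f\ne0$ in $F_{\mathfrak{v}\succeq a}/F_{\mathfrak{v}\succ a}$, $a=\mathfrak{v}(f)$. $\mathcal{B}$ is a Khovanskii basis for $(A,\mathfrak{v})$ if the $\bar b$, $b\in\mathcal{B}$, generate $\mathrm{gr}_{\mathfrak{v}}(A)$ as an algebra. Weight valuation: for $M\in\mathbb{Q}^{r\times n}$ and $0\ne p=\sum c_\alpha x^\alpha$ put $\tilde{\mathfrak{v}}_M(p)=\min\{M\alpha\mid c_\alpha\ne0\}$; for $0\ne f\in A$ put $\mathfrak{v}_M(f)=\max\{\tilde{\mathfrak{v}}_M(\tilde f)\mid\pi(\tilde f)=f\}$. It is assumed that this maximum exists in $\mathbb{Q}^r$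 (i.e. $\mathfrak{v}_M(f)\ne\infty$) for all $0\ne f\in A$; $\mathfrak{v}_M$ is called a weight valuation when it is a valuation. Subduction algorithm for $0\ne f\in A$ with respect to a Khovanskii basis $\mathcal{B}$: (i) find a polynomial $p$ (all of whose monomials $b^\alpha$ have value $\mathfrak{v}(f)$) with $\bar f=p(\bar b_1,\dots,\bar b_n)$, so that $f=p(b_1,\dots,b_n)$ or $\mathfrak{v}(f-p(b_1,\dots,b_n))\succ\mathfrak{v}(f)$; (ii) if $f=p(b_1,\dots,b_n)$ stop; otherwise replace $f$ by $f-p(b_1,\dots,b_n)$ and go to (i). $\mathfrak{v}$ is subductive with respect to $\mathcal{B}$ if $\mathcal{B}$ is a Khovanskii basis and this algorithm terminates for every $f\in A$. Initial ideals (min convention): for $u\in\mathbb{Q}^n$, $\mathrm{in}_u(p)$ is the sum of the terms $c_\alpha x^\alpha$ ($c_\alpha\ne0$) of $p$ with $u\cdot\alpha$ minimal; $\mathrm{in}_u(I)$ is generated by all $\mathrm{in}_u(p)$, $p\in I$. $\mathcal{T}(I)$ is the set of $u\in\mathbb{Q}^n$ such that $\mathrm{in}_u(I)$ contains no monomial. An open cone $C\subset\mathcal{T}(I)$ is a polyhedral cone equal to its relative interior, contained in $\mathcal{T}(I)$, such that $\mathrm{in}_u(I)$ is the same ideal $\mathrm{in}_C(I)$ for all $u\in C$. $C$ is a prime cone if $\mathrm{in}_C(I)$ is prime.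
   Formalization: All b_i are assumed nonzero. The last claim, false as stated (A=k[x,y], v(f)=ord_t f(t,e^t-1)), is proved with A_0 finite-dimensional over k and with the valuation of f equal to the minimum of the valuations of its nonzero homogeneous components. *)

theory Defs
  imports
    "HOL-Analysis.Analysis"
    "HOL-Algebra.Algebraic_Closure_Type"
    "HOL-Algebra.Generated_Rings"
    "HOL-Library.Poly_Mapping"
begin

subsection \<open>Algebras and polynomials\<close>

text \<open>
  A commutative algebra over the field \<open>'k\<close> is a commutative ring \<open>'a\<close> together with its
  structure map \<open>\<iota>\<close>; scalar multiplication is \<open>\<iota> c * f\<close>. The polynomial ring in variables
  indexed by \<open>'n\<close> is the convolution ring \<open>('n \<Rightarrow>\<^sub>0 nat) \<Rightarrow>\<^sub>0 'k\<close>.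
\<close>

type_synonym ('n, 'k) mpoly = "('n \<Rightarrow>\<^sub>0 nat) \<Rightarrow>\<^sub>0 'k"

definition algebra_map :: "('k::field \<Rightarrow> 'a::comm_ring_1) \<Rightarrow> bool" where
  "algebra_map \<iota> \<longleftrightarrow> \<iota> 1 = 1 \<and> (\<forall>c d. \<iota> (c + d) = \<iota> c + \<iota> d) \<and> (\<forall>c d. \<iota> (c * d) = \<iota> c * \<iota> d)"

definition poly_eval :: "('k::field \<Rightarrow> 'a::comm_ring_1) \<Rightarrow> ('n::finite \<Rightarrow> 'a) \<Rightarrow> ('n, 'k) mpoly \<Rightarrow> 'a" where
  "poly_eval \<iota> b p =
     (\<Sum>\<alpha>\<in>Poly_Mapping.keys p. \<iota> (Poly_Mapping.lookup p \<alpha>) * (\<Prod>i\<in>UNIV. b i ^ Poly_Mapping.lookup \<alpha> i))"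

definition relation_ideal :: "('k::field \<Rightarrow> 'a::comm_ring_1) \<Rightarrow> ('n::finite \<Rightarrow> 'a) \<Rightarrow> ('n, 'k) mpoly set" where
  "relation_ideal \<iota> b = {p. poly_eval \<iota> b p = 0}"

text \<open>
  For algebras given as ring records, \<open>\<kappa>\<close> is again the structure map; the subalgebra generated
  by a set is the subring generated by that set together with the constants.
\<close>

definition generates_algebra :: "('r, 'm) ring_scheme \<Rightarrow> ('k \<Rightarrow> 'r) \<Rightarrow> 'r set \<Rightarrow> bool" where
  "generates_algebra R \<kappa> S \<longleftrightarrow> generate_ring R (range \<kappa> \<union> S) = carrier R"

definition algebra_isomorphic ::
  "('r, 'm) ring_scheme \<Rightarrow> ('k \<Rightarrow> 'r) \<Rightarrow> ('s, 'l) ring_scheme \<Rightarrow> ('k \<Rightarrow> 's) \<Rightarrow> bool" where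
  "algebra_isomorphic R \<kappa> S \<mu> \<longleftrightarrow> (\<exists>\<phi>\<in>ring_iso R S. \<forall>c. \<phi> (\<kappa> c) = \<mu> c)"

definition quotient_const :: "('n, 'k::field) mpoly set \<Rightarrow> 'k \<Rightarrow> ('n, 'k) mpoly set" where
  "quotient_const J c = J +>\<^bsub>ring_of_type_algebra\<^esub> Poly_Mapping.single 0 c"


subsection \<open>Valuations with values in an ordered \<open>\<rat>\<^sup>r\<close>\<close>

text \<open>
  The ordering is an arbitrary relation \<open>preceq\<close>, since the order instance of \<open>rat ^ 'r\<close> is the
  componentwise partial order.
\<close>

definition additive_total_order :: "('g::ab_group_add \<Rightarrow> 'g \<Rightarrow> bool) \<Rightarrow> bool" where
  "additive_total_order preceq \<longleftrightarrow>
     class.linorder preceq (\<lambda>a b. preceq a b \<and> a \<noteq> b) \<and> (\<forall>a b c. preceq a b \<longrightarrow> preceq (a + c) (b + c))"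

definition is_least :: "('g \<Rightarrow> 'g \<Rightarrow> bool) \<Rightarrow> 'g set \<Rightarrow> 'g \<Rightarrow> bool" where
  "is_least preceq S a \<longleftrightarrow> a \<in> S \<and> (\<forall>b\<in>S. preceq a b)"

definition is_greatest :: "('g \<Rightarrow> 'g \<Rightarrow> bool) \<Rightarrow> 'g set \<Rightarrow> 'g \<Rightarrow> bool" where
  "is_greatest preceq S a \<longleftrightarrow> a \<in> S \<and> (\<forall>b\<in>S. preceq b a)"

definition discrete_values :: "(rat ^ 'r::finite) set \<Rightarrow> bool" where
  "discrete_values S \<longleftrightarrow> discrete ((\<lambda>a. \<chi> i. real_of_rat (a $ i)) ` S :: (real ^ 'r) set)"

text \<open>The value at \<open>0\<close> is junk: every use of a valuation is guarded by \<open>f \<noteq> 0\<close>.\<close>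

definition is_valuation ::
  "(rat ^ 'r::finite \<Rightarrow> rat ^ 'r \<Rightarrow> bool) \<Rightarrow> ('k::field \<Rightarrow> 'a::comm_ring_1) \<Rightarrow> ('a \<Rightarrow> rat ^ 'r) \<Rightarrow> bool" where
  "is_valuation preceq \<iota> v \<longleftrightarrow>
     (\<forall>f g. f \<noteq> 0 \<longrightarrow> g \<noteq> 0 \<longrightarrow> f + g \<noteq> 0 \<longrightarrow> preceq (v f) (v (f + g)) \<or> preceq (v g) (v (f + g))) \<and>
     (\<forall>f g. f \<noteq> 0 \<longrightarrow> g \<noteq> 0 \<longrightarrow> v (f * g) = v f + v g) \<and>
     (\<forall>c f. c \<noteq> 0 \<longrightarrow> f \<noteq> 0 \<longrightarrow> v (\<iota> c * f) = v f) \<and>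
     discrete_values (v ` {f. f \<noteq> 0})"

definition F_ge :: "('g \<Rightarrow> 'g \<Rightarrow> bool) \<Rightarrow> ('a::comm_ring_1 \<Rightarrow> 'g) \<Rightarrow> 'g \<Rightarrow> 'a set" where
  "F_ge preceq v a = {f. f \<noteq> 0 \<and> preceq a (v f)} \<union> {0}"

definition F_gt :: "('g \<Rightarrow> 'g \<Rightarrow> bool) \<Rightarrow> ('a::comm_ring_1 \<Rightarrow> 'g) \<Rightarrow> 'g \<Rightarrow> 'a set" where
  "F_gt preceq v a = {f. f \<noteq> 0 \<and> preceq a (v f) \<and> v f \<noteq> a} \<union> {0}"

definition gr_coset :: "('g \<Rightarrow> 'g \<Rightarrow> bool) \<Rightarrow> ('a::comm_ring_1 \<Rightarrow> 'g) \<Rightarrow> 'g \<Rightarrow> 'a \<Rightarrow> 'a set" where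
  "gr_coset preceq v a f = F_gt preceq v a +>\<^bsub>ring_of_type_algebra\<^esub> f"

text \<open>
  The associated graded ring. An element is a family \<open>h\<close> of cosets \<open>h a \<in> F_ge a / F_gt a\<close>, all
  but finitely many of them zero. The component of a product in degree \<open>c\<close> is the sum over
  \<open>a + b = c\<close> of the products \<open>F_ge a / F_gt a \<times> F_ge b / F_gt b \<rightarrow> F_ge c / F_gt c\<close>, which are
  computed on representatives; it is written as a union over all choices \<open>\<phi>\<close>, \<open>\<psi>\<close> of
  representatives, which all give the same coset.
\<close>

definition gr_supp :: "('g \<Rightarrow> 'g \<Rightarrow> bool) \<Rightarrow> ('a::comm_ring_1 \<Rightarrow> 'g) \<Rightarrow> ('g \<Rightarrow> 'a set) \<Rightarrow> 'g set" where
  "gr_supp preceq v h = {a. h a \<noteq> F_gt preceq v a}"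

definition gr_ring ::
  "('g::ab_group_add \<Rightarrow> 'g \<Rightarrow> bool) \<Rightarrow> ('a::comm_ring_1 \<Rightarrow> 'g) \<Rightarrow> ('g \<Rightarrow> 'a set) ring" where
  "gr_ring preceq v = \<lparr>
     carrier = {h. (\<forall>a. h a \<in> gr_coset preceq v a ` F_ge preceq v a) \<and> finite (gr_supp preceq v h)},
     monoid.mult = (\<lambda>h k c.
       \<Union>{gr_coset preceq v c (\<Sum>a\<in>{a \<in> gr_supp preceq v h. c - a \<in> gr_supp preceq v k}. \<phi> a * \<psi> (c - a)) |
          \<phi> \<psi>. (\<forall>a. \<phi> a \<in> h a) \<and> (\<forall>a. \<psi> a \<in> k a)}),
     one = (\<lambda>a. if a = 0 then gr_coset preceq v 0 1 else F_gt preceq v a),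
     ring.zero = (\<lambda>a. F_gt preceq v a),
     add = (\<lambda>h k a. h a <+>\<^bsub>ring_of_type_algebra\<^esub> k a) \<rparr>"

definition gr_homog ::
  "('g \<Rightarrow> 'g \<Rightarrow> bool) \<Rightarrow> ('a::comm_ring_1 \<Rightarrow> 'g) \<Rightarrow> 'g \<Rightarrow> 'a \<Rightarrow> ('g \<Rightarrow> 'a set)" where
  "gr_homog preceq v a f = (\<lambda>c. if c = a then gr_coset preceq v a f else F_gt preceq v c)"

definition gr_class :: "('g \<Rightarrow> 'g \<Rightarrow> bool) \<Rightarrow> ('a::comm_ring_1 \<Rightarrow> 'g) \<Rightarrow> 'a \<Rightarrow> ('g \<Rightarrow> 'a set)" where
  "gr_class preceq v f = gr_homog preceq v (v f) f"

definition gr_const ::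
  "('g::ab_group_add \<Rightarrow> 'g \<Rightarrow> bool) \<Rightarrow> ('k::field \<Rightarrow> 'a::comm_ring_1) \<Rightarrow> ('a \<Rightarrow> 'g) \<Rightarrow> 'k \<Rightarrow> ('g \<Rightarrow> 'a set)" where
  "gr_const preceq \<iota> v c = gr_homog preceq v 0 (\<iota> c)"

definition gr_eval ::
  "('g::ab_group_add \<Rightarrow> 'g \<Rightarrow> bool) \<Rightarrow> ('k::field \<Rightarrow> 'a::comm_ring_1) \<Rightarrow> ('a \<Rightarrow> 'g) \<Rightarrow>
   ('n::finite \<Rightarrow> 'a) \<Rightarrow> ('n, 'k) mpoly \<Rightarrow> ('g \<Rightarrow> 'a set)" where
  "gr_eval preceq \<iota> v b p =
     (\<Oplus>\<^bsub>gr_ring preceq v\<^esub>\<alpha>\<in>Poly_Mapping.keys p.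
        gr_const preceq \<iota> v (Poly_Mapping.lookup p \<alpha>) \<otimes>\<^bsub>gr_ring preceq v\<^esub>
        (\<Otimes>\<^bsub>gr_ring preceq v\<^esub>i\<in>UNIV. gr_class preceq v (b i) [^]\<^bsub>gr_ring preceq v\<^esub> Poly_Mapping.lookup \<alpha> i))"

definition khovanskii_basis ::
  "(rat ^ 'r::finite \<Rightarrow> rat ^ 'r \<Rightarrow> bool) \<Rightarrow> ('k::field \<Rightarrow> 'a::comm_ring_1) \<Rightarrow> ('a \<Rightarrow> rat ^ 'r) \<Rightarrow>
   ('n::finite \<Rightarrow> 'a) \<Rightarrow> bool" where
  "khovanskii_basis preceq \<iota> v b \<longleftrightarrow>
     is_valuation preceq \<iota> v \<and>
     generates_algebra (gr_ring preceq v) (gr_const preceq \<iota> v) (range (\<lambda>i. gr_class preceq v (b i)))"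


subsection \<open>Weight valuations\<close>

definition exponent_vector :: "('n::finite \<Rightarrow>\<^sub>0 nat) \<Rightarrow> rat ^ 'n" where
  "exponent_vector \<alpha> = (\<chi> i. of_nat (Poly_Mapping.lookup \<alpha> i))"

definition poly_weight ::
  "(rat ^ 'r::finite \<Rightarrow> rat ^ 'r \<Rightarrow> bool) \<Rightarrow> rat ^ 'n::finite ^ 'r \<Rightarrow> ('n, 'k::field) mpoly \<Rightarrow> rat ^ 'r" where
  "poly_weight preceq M p = (THE a. is_least preceq ((\<lambda>\<alpha>. M *v exponent_vector \<alpha>) ` Poly_Mapping.keys p) a)"

definition lift_weights ::
  "(rat ^ 'r::finite \<Rightarrow> rat ^ 'r \<Rightarrow> bool) \<Rightarrow> ('k::field \<Rightarrow> 'a::comm_ring_1) \<Rightarrow> ('n::finite \<Rightarrow> 'a) \<Rightarrow>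
   rat ^ 'n ^ 'r \<Rightarrow> 'a \<Rightarrow> (rat ^ 'r) set" where
  "lift_weights preceq \<iota> b M f = {poly_weight preceq M p | p. poly_eval \<iota> b p = f}"

definition weight_map ::
  "(rat ^ 'r::finite \<Rightarrow> rat ^ 'r \<Rightarrow> bool) \<Rightarrow> ('k::field \<Rightarrow> 'a::comm_ring_1) \<Rightarrow> ('n::finite \<Rightarrow> 'a) \<Rightarrow>
   rat ^ 'n ^ 'r \<Rightarrow> 'a \<Rightarrow> rat ^ 'r" where
  "weight_map preceq \<iota> b M f = (THE a. is_greatest preceq (lift_weights preceq \<iota> b M f) a)"

definition is_weight_valuation ::
  "(rat ^ 'r::finite \<Rightarrow> rat ^ 'r \<Rightarrow> bool) \<Rightarrow> ('k::field \<Rightarrow> 'a::comm_ring_1) \<Rightarrow> ('n::finite \<Rightarrow> 'a) \<Rightarrow>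
   rat ^ 'n ^ 'r \<Rightarrow> bool" where
  "is_weight_valuation preceq \<iota> b M \<longleftrightarrow>
     (\<forall>f. f \<noteq> 0 \<longrightarrow> (\<exists>a. is_greatest preceq (lift_weights preceq \<iota> b M f) a)) \<and>
     is_valuation preceq \<iota> (weight_map preceq \<iota> b M)"


subsection \<open>Subduction\<close>

definition subduction_poly ::
  "('g::ab_group_add \<Rightarrow> 'g \<Rightarrow> bool) \<Rightarrow> ('k::field \<Rightarrow> 'a::comm_ring_1) \<Rightarrow> ('a \<Rightarrow> 'g) \<Rightarrow>
   ('n::finite \<Rightarrow> 'a) \<Rightarrow> 'a \<Rightarrow> ('n, 'k) mpoly \<Rightarrow> bool" where
  "subduction_poly preceq \<iota> v b f p \<longleftrightarrow>
     (\<forall>\<alpha>\<in>Poly_Mapping.keys p. v (\<Prod>i\<in>UNIV. b i ^ Poly_Mapping.lookup \<alpha> i) = v f) \<and>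
     gr_class preceq v f = gr_eval preceq \<iota> v b p"

text \<open>
  The subduction algorithm is nondeterministic, as the polynomial \<open>p\<close> of each round is not
  unique. The predicate says that a suitable choice of these polynomials makes the algorithm
  stop after finitely many rounds; this is implied by termination for all choices, since over a
  Khovanskii basis a suitable \<open>p\<close> always exists.
\<close>

inductive subduction_terminates ::
  "('g::ab_group_add \<Rightarrow> 'g \<Rightarrow> bool) \<Rightarrow> ('k::field \<Rightarrow> 'a::comm_ring_1) \<Rightarrow> ('a \<Rightarrow> 'g) \<Rightarrow>
   ('n::finite \<Rightarrow> 'a) \<Rightarrow> 'a \<Rightarrow> bool"
  for preceq \<iota> v b where
  stop: "f \<noteq> 0 \<Longrightarrow> subduction_poly preceq \<iota> v b f p \<Longrightarrow> f = poly_eval \<iota> b p \<Longrightarrow>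
           subduction_terminates preceq \<iota> v b f"
| continue: "f \<noteq> 0 \<Longrightarrow> subduction_poly preceq \<iota> v b f p \<Longrightarrow> f \<noteq> poly_eval \<iota> b p \<Longrightarrow>
           subduction_terminates preceq \<iota> v b (f - poly_eval \<iota> b p) \<Longrightarrow>
           subduction_terminates preceq \<iota> v b f"

definition subductive ::
  "(rat ^ 'r::finite \<Rightarrow> rat ^ 'r \<Rightarrow> bool) \<Rightarrow> ('k::field \<Rightarrow> 'a::comm_ring_1) \<Rightarrow> ('a \<Rightarrow> rat ^ 'r) \<Rightarrow>
   ('n::finite \<Rightarrow> 'a) \<Rightarrow> bool" where
  "subductive preceq \<iota> v b \<longleftrightarrow>
     khovanskii_basis preceq \<iota> v b \<and> (\<forall>f. f \<noteq> 0 \<longrightarrow> subduction_terminates preceq \<iota> v b f)"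


subsection \<open>Initial ideals and prime cones\<close>

definition dot :: "rat ^ 'n::finite \<Rightarrow> rat ^ 'n \<Rightarrow> rat" where
  "dot u w = (\<Sum>i\<in>UNIV. u $ i * w $ i)"

definition initial_form :: "rat ^ 'n::finite \<Rightarrow> ('n, 'k::field) mpoly \<Rightarrow> ('n, 'k) mpoly" where
  "initial_form u p =
     (\<Sum>\<alpha>\<in>{\<alpha> \<in> Poly_Mapping.keys p.
          \<forall>\<beta>\<in>Poly_Mapping.keys p. dot u (exponent_vector \<alpha>) \<le> dot u (exponent_vector \<beta>)}.
        Poly_Mapping.single \<alpha> (Poly_Mapping.lookup p \<alpha>))"

definition initial_ideal :: "rat ^ 'n::finite \<Rightarrow> ('n, 'k::field) mpoly set \<Rightarrow> ('n, 'k) mpoly set" where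
  "initial_ideal u I = Idl\<^bsub>ring_of_type_algebra\<^esub> (initial_form u ` I)"

definition tropical_variety :: "('n::finite, 'k::field) mpoly set \<Rightarrow> (rat ^ 'n) set" where
  "tropical_variety I = {u. \<forall>\<alpha>. Poly_Mapping.single \<alpha> 1 \<notin> initial_ideal u I}"

definition polyhedral_cone :: "(rat ^ 'n::finite) set \<Rightarrow> bool" where
  "polyhedral_cone \<sigma> \<longleftrightarrow> (\<exists>L. finite L \<and> \<sigma> = {u. \<forall>l\<in>L. 0 \<le> dot l u})"

text \<open>
  Relative interior in \<open>\<rat>\<^sup>n\<close>, for sets containing \<open>0\<close>: the affine hull is then the linear span.
\<close>

definition cone_rel_interior :: "(rat ^ 'n::finite) set \<Rightarrow> (rat ^ 'n) set" where
  "cone_rel_interior \<sigma> =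
     {u \<in> \<sigma>. \<exists>e>0. \<forall>w\<in>vec.span \<sigma>. (\<forall>i. \<bar>w $ i - u $ i\<bar> < e) \<longrightarrow> w \<in> \<sigma>}"

definition open_cone :: "('n::finite, 'k::field) mpoly set \<Rightarrow> (rat ^ 'n) set \<Rightarrow> bool" where
  "open_cone I C \<longleftrightarrow>
     C \<noteq> {} \<and>
     (\<exists>\<sigma>. polyhedral_cone \<sigma> \<and> C = cone_rel_interior \<sigma>) \<and>
     C \<subseteq> tropical_variety I \<and>
     (\<forall>u\<in>C. \<forall>w\<in>C. initial_ideal u I = initial_ideal w I)"

definition cone_initial_ideal :: "(rat ^ 'n::finite) set \<Rightarrow> ('n, 'k::field) mpoly set \<Rightarrow> ('n, 'k) mpoly set" where
  "cone_initial_ideal C I = (THE J. \<forall>u\<in>C. initial_ideal u I = J)"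

definition prime_cone :: "('n::finite, 'k::field) mpoly set \<Rightarrow> (rat ^ 'n) set \<Rightarrow> bool" where
  "prime_cone I C \<longleftrightarrow> open_cone I C \<and> primeideal (cone_initial_ideal C I) ring_of_type_algebra"


subsection \<open>Positive gradings\<close>

abbreviation alg_scale :: "('k::field \<Rightarrow> 'a::comm_ring_1) \<Rightarrow> 'k \<Rightarrow> 'a \<Rightarrow> 'a" where
  "alg_scale \<iota> c f \<equiv> \<iota> c * f"

definition is_decomposition :: "(nat \<Rightarrow> 'a::comm_ring_1 set) \<Rightarrow> 'a \<Rightarrow> (nat \<Rightarrow> 'a) \<Rightarrow> bool" where
  "is_decomposition G f g \<longleftrightarrow>
     (\<forall>d. g d \<in> G d) \<and> finite {d. g d \<noteq> 0} \<and> f = (\<Sum>d\<in>{d. g d \<noteq> 0}. g d)"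

definition component :: "(nat \<Rightarrow> 'a::comm_ring_1 set) \<Rightarrow> 'a \<Rightarrow> nat \<Rightarrow> 'a" where
  "component G f = (THE g. is_decomposition G f g)"

text \<open>
  A grading \<open>A = (\<Oplus>d. G d)\<close> by the natural numbers is called positive if \<open>G 0\<close> is
  finite-dimensional (it contains the ground field, and usually equals it). Together with finite
  generation this makes all \<open>G d\<close> finite-dimensional.
\<close>

definition positive_grading :: "('k::field \<Rightarrow> 'a::comm_ring_1) \<Rightarrow> (nat \<Rightarrow> 'a set) \<Rightarrow> bool" where
  "positive_grading \<iota> G \<longleftrightarrow>
     (\<forall>d. Modules.module.subspace (alg_scale \<iota>) (G d)) \<and>
     1 \<in> G 0 \<and>
     (\<forall>d e. \<forall>f\<in>G d. \<forall>g\<in>G e. f * g \<in> G (d + e)) \<and>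
     (\<forall>f. \<exists>!g. is_decomposition G f g) \<and>
     (\<exists>S. finite S \<and> G 0 \<subseteq> Modules.module.span (alg_scale \<iota>) S)"

text \<open>
  A valuation on a graded algebra has to respect the grading. For \<open>k[x,y]\<close> with its standard
  grading and \<open>char k = 0\<close>, the valuation \<open>f \<mapsto> ord\<^sub>t f(t, e\<^sup>t - 1)\<close> does not: \<open>x\<close>, \<open>y\<close> form a
  Khovanskii basis for it, but subduction of \<open>y - x\<close> does not stop, and its associated graded
  ring \<open>k[t]\<close> is not of the form \<open>k[x,y]/in\<^sub>C(0) = k[x,y]\<close>.
\<close>

definition homogeneous_valuation ::
  "('g \<Rightarrow> 'g \<Rightarrow> bool) \<Rightarrow> (nat \<Rightarrow> 'a::comm_ring_1 set) \<Rightarrow> ('a \<Rightarrow> 'g) \<Rightarrow> bool" where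
  "homogeneous_valuation preceq G v \<longleftrightarrow>
     (\<forall>f. f \<noteq> 0 \<longrightarrow> is_least preceq (v ` {component G f d | d. component G f d \<noteq> 0}) (v f))"

end

theory Submission
  imports Defs
begin

text \<open>
  All three classes of valuations share one property, called \<open>adapted\<close> below: every \<open>f \<noteq> 0\<close> in \<open>A\<close>
  has a lift \<open>p\<close> all of whose monomials have value at least \<open>v f\<close>, where \<open>x^\<alpha>\<close> is given the value
  \<open>v (b^\<alpha>)\<close>. For a weight valuation with matrix \<open>M\<close> such a lift realises the maximum that defines
  \<open>v f\<close>; the columns of \<open>M\<close> may be smaller than the values \<open>v (b i)\<close>, and passing to the latter only
  raises the values of monomials. For a subductive valuation the lift is the sum of the polynomials
  produced by subduction. On a positively graded algebra, subduction of a homogeneous element can be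
  performed inside one graded piece; this is a finite-dimensional space, on which \<open>v\<close> takes finitely
  many values, and so it stops.

  For an adapted \<open>v\<close> the graded ring is presented by an initial ideal with vector-valued weights
  (\<open>initial_ideal_eq_gr_kernel\<close>, \<open>gr_poly_surj\<close>). The map from polynomials to the graded ring that sends
  the variable \<open>x i\<close> to the class of \<open>b i\<close> is onto, because the lowest part of an adapted lift of \<open>f\<close>
  is sent to the class of \<open>f\<close>. A homogeneous \<open>r\<close> of weight \<open>a\<close> lies in the kernel iff \<open>r(b)\<close> vanishes or
  has value beyond \<open>a\<close>; then \<open>r(b) = q(b)\<close> for some \<open>q\<close> all of whose monomials have value beyond \<open>a\<close>,
  and \<open>r\<close> is the initial form of the relation \<open>r - q\<close>. As \<open>v\<close> is additive on products, the graded ring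
  is a domain in which the classes of the \<open>b i\<close> are nonzero, so this initial ideal is prime and
  contains no monomial.

  It remains to replace the vectors \<open>v (b i)\<close> by rational numbers \<open>u i\<close> without changing the initial
  ideal. The initial ideal of any ideal depends only on how the weights compare finitely many pairs
  of monomials (\<open>initial_ideal_finitely_determined\<close>), and Fourier-Motzkin elimination yields a
  rational linear functional that is positive on any given finite set of positive vectors
  (\<open>positive_functional\<close>); applied to the \<open>v (b i)\<close> it gives \<open>u\<close> (\<open>scalar_weight_exists\<close>). The open ray
  through \<open>u\<close> is the required cone.

  Finite determinacy is a Groebner basis argument. As weights may be negative and the ideal need not
  be homogeneous, division need not terminate; the classical remedy is to homogenise the ideal with
  an extra variable of weight zero. Here the extra variable is implicit: polynomials are paired with
  an upper bound for their degree, and the exponent of the extra variable is the slack in this bound.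
\<close>

abbreviation coef :: "('a \<Rightarrow>\<^sub>0 'b::zero) \<Rightarrow> 'a \<Rightarrow> 'b" where "coef \<equiv> Poly_Mapping.lookup"
abbreviation keys :: "('a \<Rightarrow>\<^sub>0 'b::zero) \<Rightarrow> 'a set" where "keys \<equiv> Poly_Mapping.keys"
abbreviation monomial :: "'a \<Rightarrow> 'b::zero \<Rightarrow> ('a \<Rightarrow>\<^sub>0 'b)" where "monomial \<equiv> Poly_Mapping.single"

section \<open>Ideals of a commutative ring\<close>

text \<open>
  For a ring that occupies a whole type, ideals are described by three closure properties; this
  avoids carriers and record operations in all computations with polynomials.
\<close>

definition ideal_set :: "'a::comm_ring_1 set \<Rightarrow> bool" where
  "ideal_set I \<longleftrightarrow> 0 \<in> I \<and> (\<forall>x\<in>I. \<forall>y\<in>I. x + y \<in> I) \<and> (\<forall>r. \<forall>x\<in>I. r * x \<in> I)"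

lemma type_ring_simps [simp]:
  "carrier ring_of_type_algebra = UNIV"
  "monoid.mult ring_of_type_algebra = (\<lambda>x y. x * y)"
  "one ring_of_type_algebra = 1"
  "ring.zero ring_of_type_algebra = 0"
  "ring.add ring_of_type_algebra = (\<lambda>x y. x + y)"
  by (simp_all add: ring_of_type_algebra_def)

lemma ideal_set_uminus: "ideal_set I \<Longrightarrow> x \<in> I \<Longrightarrow> - x \<in> I"
  unfolding ideal_set_def by (metis mult_minus1)

lemma ideal_set_diff: "ideal_set I \<Longrightarrow> x \<in> I \<Longrightarrow> y \<in> I \<Longrightarrow> x - y \<in> I"
  using ideal_set_uminus[of I y] unfolding ideal_set_def by (metis add_uminus_conv_diff)

lemma ideal_set_sum: "ideal_set I \<Longrightarrow> (\<And>i. i \<in> S \<Longrightarrow> f i \<in> I) \<Longrightarrow> sum f S \<in> I"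
  by (induction S rule: infinite_finite_induct) (auto simp: ideal_set_def)

lemma ideal_iff_ideal_set:
  "ideal I (ring_of_type_algebra :: 'a::comm_ring_1 ring) \<longleftrightarrow> ideal_set I"
proof
  assume "ideal I (ring_of_type_algebra :: 'a ring)"
  then interpret ideal I "ring_of_type_algebra :: 'a ring" .
  show "ideal_set I"
    using additive_subgroup.zero_closed[OF additive_subgroup_axioms] additive_subgroup.a_closed[OF additive_subgroup_axioms] I_l_closed
    by (auto simp: ideal_set_def)
next
  assume I: "ideal_set I"
  have inv: "inv\<^bsub>add_monoid ring_of_type_algebra\<^esub> x = - x" for x :: 'a
  proof -
    interpret R: ring "ring_of_type_algebra :: 'a ring" by (rule ring_from_type_algebra)
    show ?thesis
      using R.minus_equality[of "- x" x] by (simp add: a_inv_def)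
  qed
  show "ideal I (ring_of_type_algebra :: 'a ring)"
  proof (rule idealI)
    show "ring (ring_of_type_algebra :: 'a ring)" by (rule ring_from_type_algebra)
    show "subgroup I (add_monoid (ring_of_type_algebra :: 'a ring))"
      using I ideal_set_uminus[OF I]
      by (intro subgroup.intro) (auto simp: ideal_set_def inv[simplified])
  qed (use I in \<open>simp_all add: ideal_set_def, metis mult.commute\<close>)
qed

lemma ideal_set_genideal: "ideal_set (Idl\<^bsub>ring_of_type_algebra\<^esub> (S :: 'a::comm_ring_1 set))"
proof -
  interpret R: ring "ring_of_type_algebra :: 'a ring" by (rule ring_from_type_algebra)
  show ?thesis
    using R.genideal_ideal[of S] by (simp add: ideal_iff_ideal_set)
qed

lemma subset_genideal: "(S :: 'a::comm_ring_1 set) \<subseteq> Idl\<^bsub>ring_of_type_algebra\<^esub> S"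
  by (auto simp: genideal_def)

lemma genideal_least: "ideal_set I \<Longrightarrow> (S :: 'a::comm_ring_1 set) \<subseteq> I \<Longrightarrow> Idl\<^bsub>ring_of_type_algebra\<^esub> S \<subseteq> I"
  by (auto simp: genideal_def ideal_iff_ideal_set)


section \<open>Monomial preorders and initial forms\<close>

text \<open>
  Distinct monomials may have the same weight, hence a preorder. The same notion covers
  vector-valued and scalar weights, which have to be compared with each other.
\<close>

definition monomial_preorder :: "(('n \<Rightarrow>\<^sub>0 nat) \<Rightarrow> ('n \<Rightarrow>\<^sub>0 nat) \<Rightarrow> bool) \<Rightarrow> bool" where
  "monomial_preorder leq \<longleftrightarrow>
     (\<forall>\<alpha> \<beta>. leq \<alpha> \<beta> \<or> leq \<beta> \<alpha>) \<and> (\<forall>\<alpha> \<beta> \<gamma>. leq \<alpha> \<beta> \<longrightarrow> leq \<beta> \<gamma> \<longrightarrow> leq \<alpha> \<gamma>) \<and>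
     (\<forall>\<alpha> \<beta> \<gamma>. leq (\<gamma> + \<alpha>) (\<gamma> + \<beta>) \<longleftrightarrow> leq \<alpha> \<beta>)"

definition init_form ::
  "(('n \<Rightarrow>\<^sub>0 nat) \<Rightarrow> ('n \<Rightarrow>\<^sub>0 nat) \<Rightarrow> bool) \<Rightarrow> ('n, 'k::field) mpoly \<Rightarrow> ('n, 'k) mpoly" where
  "init_form leq p = (\<Sum>\<alpha>\<in>{\<alpha> \<in> keys p. \<forall>\<beta>\<in>keys p. leq \<alpha> \<beta>}. monomial \<alpha> (coef p \<alpha>))"

lemma coef_sum_monomials:
  "finite S \<Longrightarrow> coef (\<Sum>\<alpha>\<in>S. monomial \<alpha> (c \<alpha>)) \<beta> = (if \<beta> \<in> S then c \<beta> else 0)"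
  by (simp add: lookup_sum lookup_single when_def)

lemma coef_init_form:
  "coef (init_form leq p) \<alpha> = (if \<alpha> \<in> keys p \<and> (\<forall>\<beta>\<in>keys p. leq \<alpha> \<beta>) then coef p \<alpha> else 0)"
  unfolding init_form_def by (subst coef_sum_monomials) auto

lemma init_form_0 [simp]: "init_form leq 0 = 0"
  by (simp add: init_form_def)

text \<open>
  The initial form can be read off from any exponent \<open>\<alpha>\<close> that is equivalent to the minimal ones, even
  if \<open>\<alpha>\<close> itself does not occur in \<open>p\<close>.
\<close>

lemma coef_init_form_at:
  assumes "monomial_preorder leq" "\<forall>\<beta>\<in>keys p. leq \<alpha> \<beta>" "\<exists>\<beta>\<in>keys p. leq \<beta> \<alpha>"
  shows "coef (init_form leq p) \<delta> = (if leq \<delta> \<alpha> then coef p \<delta> else 0)"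
  using assms unfolding coef_init_form monomial_preorder_def
  by (auto simp: in_keys_iff)

lemma coef_monomial_mult:
  fixes p :: "('n \<Rightarrow>\<^sub>0 nat) \<Rightarrow>\<^sub>0 'k::field"
  shows "coef (monomial \<beta> c * p) (\<beta> + \<gamma>) = c * coef p \<gamma>"
  by (simp add: lookup_mult lookup_single when_mult)

lemma keys_monomial_mult:
  fixes p :: "('n \<Rightarrow>\<^sub>0 nat) \<Rightarrow>\<^sub>0 'k::field"
  assumes "c \<noteq> 0"
  shows "keys (monomial \<beta> c * p) = (+) \<beta> ` keys p"
proof -
  have "keys (monomial \<beta> c * p) \<subseteq> (+) \<beta> ` keys p"
    using keys_mult[of "monomial \<beta> c" p] assms by auto
  then show ?thesis
    using assms by (auto simp: in_keys_iff coef_monomial_mult)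
qed

lemma coef_monomial_mult_outside:
  fixes p :: "('n \<Rightarrow>\<^sub>0 nat) \<Rightarrow>\<^sub>0 'k::field"
  assumes "\<alpha> \<notin> range ((+) \<beta>)"
  shows "coef (monomial \<beta> c * p) \<alpha> = 0"
  using keys_monomial_mult[of c \<beta> p] assms
  by (cases "c = 0") (auto simp flip: not_in_keys_iff_lookup_eq_zero)

lemma init_form_monomial_mult:
  fixes p :: "('n \<Rightarrow>\<^sub>0 nat) \<Rightarrow>\<^sub>0 'k::field"
  assumes "monomial_preorder leq" "c \<noteq> 0"
  shows "init_form leq (monomial \<beta> c * p) = monomial \<beta> c * init_form leq p"
proof (rule poly_mapping_eqI)
  fix \<alpha>
  show "coef (init_form leq (monomial \<beta> c * p)) \<alpha> = coef (monomial \<beta> c * init_form leq p) \<alpha>"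
  proof (cases "\<alpha> \<in> range ((+) \<beta>)")
    case False
    then show ?thesis
      by (simp add: coef_init_form coef_monomial_mult_outside)
  next
    case True
    then obtain \<gamma> where "\<alpha> = \<beta> + \<gamma>" by auto
    then show ?thesis
      using assms by (auto simp: coef_init_form coef_monomial_mult keys_monomial_mult monomial_preorder_def)
  qed
qed

lemma finite_total_has_least:
  assumes "finite S" "S \<noteq> {}" "\<And>x y. leq x y \<or> leq y x" "\<And>x y z. leq x y \<Longrightarrow> leq y z \<Longrightarrow> leq x z"
  shows "\<exists>x\<in>S. \<forall>y\<in>S. leq x y"
  using assms(1,2)
proof (induction S rule: finite_ne_induct)
  case (singleton x)
  then show ?case using assms(3) by blast
next
  case (insert x F)
  then obtain m where m: "m \<in> F" "\<forall>y\<in>F. leq m y" by blast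
  show ?case
  proof (cases "leq m x")
    case True
    then show ?thesis using m by auto
  next
    case False
    then have "leq x m" using assms(3) by blast
    then have "\<forall>y\<in>insert x F. leq x y" using m assms(3,4) by blast
    then show ?thesis by blast
  qed
qed

section \<open>Total orders on exponents and leading terms\<close>

text \<open>
  Integer polynomials form an ordered ring, so this injective additive map pulls back a
  translation-invariant total order on exponents, used to break ties between equal weights.
\<close>

definition tie :: "('n::finite \<Rightarrow>\<^sub>0 nat) \<Rightarrow> int poly" where
  "tie \<alpha> = (\<Sum>i\<in>UNIV. Polynomial.monom (int (coef \<alpha> i)) (to_nat_on UNIV i))"

lemma tie_add: "tie (\<alpha> + \<beta>) = tie \<alpha> + tie \<beta>"
  by (simp add: tie_def lookup_add Polynomial.add_monom flip: sum.distrib)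

lemma tie_inject: "tie \<alpha> = tie \<beta> \<longleftrightarrow> \<alpha> = \<beta>"
proof
  assume eq: "tie \<alpha> = tie \<beta>"
  have "Polynomial.coeff (tie \<alpha>) (to_nat_on UNIV i) = int (coef \<alpha> i)" for \<alpha> :: "'a \<Rightarrow>\<^sub>0 nat" and i
  proof -
    have "inj (to_nat_on (UNIV :: 'a set))"
      by (rule inj_on_to_nat_on) (simp add: countable_finite)
    then have "Polynomial.coeff (tie \<alpha>) (to_nat_on UNIV i) = (\<Sum>j\<in>UNIV. if j = i then int (coef \<alpha> j) else 0)"
      unfolding tie_def Polynomial.coeff_sum Polynomial.coeff_monom by (intro sum.cong) (auto dest: injD)
    then show ?thesis by simp
  qed
  then have "coef \<alpha> i = coef \<beta> i" for i
    using eq by (metis of_nat_eq_iff)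
  then show "\<alpha> = \<beta>" by (rule poly_mapping_eqI)
qed simp

definition refine ::
  "(('n::finite \<Rightarrow>\<^sub>0 nat) \<Rightarrow> ('n \<Rightarrow>\<^sub>0 nat) \<Rightarrow> bool) \<Rightarrow> ('n \<Rightarrow>\<^sub>0 nat) \<Rightarrow> ('n \<Rightarrow>\<^sub>0 nat) \<Rightarrow> bool" where
  "refine leq \<alpha> \<beta> \<longleftrightarrow> leq \<alpha> \<beta> \<and> (leq \<beta> \<alpha> \<longrightarrow> tie \<alpha> \<le> tie \<beta>)"

lemma refine_le: "refine leq \<alpha> \<beta> \<Longrightarrow> leq \<alpha> \<beta>"
  by (simp add: refine_def)

context
  fixes leq :: "('n::finite \<Rightarrow>\<^sub>0 nat) \<Rightarrow> ('n \<Rightarrow>\<^sub>0 nat) \<Rightarrow> bool"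
  assumes leq: "monomial_preorder leq"
begin

lemma refine_total: "refine leq \<alpha> \<beta> \<or> refine leq \<beta> \<alpha>"
  using leq unfolding refine_def monomial_preorder_def by (meson linear)

lemma refine_refl: "refine leq \<alpha> \<alpha>"
  using refine_total by blast

lemma refine_trans: "refine leq \<alpha> \<beta> \<Longrightarrow> refine leq \<beta> \<gamma> \<Longrightarrow> refine leq \<alpha> \<gamma>"
  using leq unfolding refine_def monomial_preorder_def by (meson order_trans)

lemma refine_antisym: "refine leq \<alpha> \<beta> \<Longrightarrow> refine leq \<beta> \<alpha> \<Longrightarrow> \<alpha> = \<beta>"
  unfolding refine_def by (simp add: order_antisym flip: tie_inject)

lemma refine_add: "refine leq (\<gamma> + \<alpha>) (\<gamma> + \<beta>) \<longleftrightarrow> refine leq \<alpha> \<beta>"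
  using leq unfolding refine_def monomial_preorder_def by (simp add: tie_add)

end

text \<open>
  Leading exponents are least ones, in line with the min convention for initial forms.
\<close>

definition is_lead ::
  "(('n::finite \<Rightarrow>\<^sub>0 nat) \<Rightarrow> ('n \<Rightarrow>\<^sub>0 nat) \<Rightarrow> bool) \<Rightarrow> ('n \<Rightarrow>\<^sub>0 nat) \<Rightarrow> ('n, 'k::field) mpoly \<Rightarrow> bool" where
  "is_lead leq \<alpha> p \<longleftrightarrow> \<alpha> \<in> keys p \<and> (\<forall>\<beta>\<in>keys p. refine leq \<alpha> \<beta>)"

lemma is_lead_exists:
  assumes "monomial_preorder leq" "p \<noteq> 0"
  shows "\<exists>\<alpha>. is_lead leq \<alpha> p"
proof -
  have "keys p \<noteq> {}"
    using assms(2) by (metis lookup_zero poly_mapping_eqI in_keys_iff empty_iff)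
  then have "\<exists>x\<in>keys p. \<forall>y\<in>keys p. refine leq x y"
    by (intro finite_total_has_least[OF _ _ refine_total[OF assms(1)] refine_trans[OF assms(1)]]) auto
  then show ?thesis by (auto simp: is_lead_def)
qed

text \<open>
  One division step. Terms below the cancelled one stay untouched, so a division can be run upwards
  from any chosen exponent without disturbing what lies below.
\<close>

lemma cancel_term:
  fixes p q :: "('n::finite, 'k::field) mpoly" and \<beta> \<gamma> :: "'n \<Rightarrow>\<^sub>0 nat"
  assumes leq: "monomial_preorder leq" and p: "is_lead leq \<gamma> p"
  defines "c \<equiv> coef q (\<beta> + \<gamma>) / coef p \<gamma>"
  defines "q' \<equiv> q - monomial \<beta> c * p"
  shows "coef q' (\<beta> + \<gamma>) = 0"
    and "\<delta> \<in> keys q' \<Longrightarrow> \<delta> \<noteq> \<beta> + \<gamma> \<and> (\<delta> \<in> keys q \<or> refine leq (\<beta> + \<gamma>) \<delta>)"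
    and "\<not> refine leq (\<beta> + \<gamma>) \<delta> \<Longrightarrow> coef q' \<delta> = coef q \<delta>"
proof -
  show 1: "coef q' (\<beta> + \<gamma>) = 0"
    using p by (auto simp: q'_def c_def lookup_minus coef_monomial_mult is_lead_def in_keys_iff)
  have 3: "coef q' \<delta> = coef q \<delta>" if "\<not> refine leq (\<beta> + \<gamma>) \<delta>" for \<delta>
  proof -
    have "coef (monomial \<beta> c * p) \<delta> = 0"
    proof (cases "\<delta> \<in> range ((+) \<beta>)")
      case True
      then show ?thesis
        using that p leq by (auto simp: coef_monomial_mult refine_add is_lead_def in_keys_iff)
    qed (simp add: coef_monomial_mult_outside)
    then show ?thesis by (simp add: q'_def lookup_minus)
  qed
  then show "coef q' \<delta> = coef q \<delta>" if "\<not> refine leq (\<beta> + \<gamma>) \<delta>" using that .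
  show "\<delta> \<noteq> \<beta> + \<gamma> \<and> (\<delta> \<in> keys q \<or> refine leq (\<beta> + \<gamma>) \<delta>)" if "\<delta> \<in> keys q'"
    using that 1 3[of \<delta>] by (metis in_keys_iff)
qed


section \<open>Dickson's lemma\<close>

lemma nat_seq_mono_subseq:
  fixes s :: "nat \<Rightarrow> nat"
  shows "\<exists>r :: nat \<Rightarrow> nat. strict_mono r \<and> mono (\<lambda>n. s (r n))"
proof -
  obtain f where f: "strict_mono f" "monoseq (\<lambda>n. s (f n))"
    using seq_monosub by blast
  show ?thesis
  proof (cases "mono (\<lambda>n. s (f n))")
    case True
    then show ?thesis using f by (intro exI[of _ f]) blast
  next
    case False
    then have dec: "s (f n) \<le> s (f m)" if "m \<le> n" for m n
      using f(2) that unfolding monoseq_def mono_def by blast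
    \<comment> \<open>A non-increasing sequence of naturals is constant from its least value on.\<close>
    obtain N where N: "\<And>n. s (f N) \<le> s (f n)"
      using ex_has_least_nat[of "\<lambda>_. True" 0 "\<lambda>n. s (f n)"] by auto
    have "s (f (n + N)) = s (f N)" for n
      using dec[of N "n + N"] N[of "n + N"] by simp
    moreover have "strict_mono (\<lambda>n. f (n + N))"
      using f(1) by (simp add: strict_mono_def)
    ultimately show ?thesis
      by (intro exI[of _ "\<lambda>n. f (n + N)"]) (auto simp: mono_def)
  qed
qed

lemma nat_tuple_seq_mono_subseq:
  fixes s :: "nat \<Rightarrow> 'i \<Rightarrow> nat"
  assumes "finite S"
  shows "\<exists>r :: nat \<Rightarrow> nat. strict_mono r \<and> (\<forall>i\<in>S. mono (\<lambda>n. s (r n) i))"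
  using assms
proof (induction S)
  case empty
  then show ?case by (intro exI[of _ id]) (simp add: strict_mono_def)
next
  case (insert i S)
  then obtain r :: "nat \<Rightarrow> nat" where r: "strict_mono r" "\<forall>i\<in>S. mono (\<lambda>n. s (r n) i)" by blast
  obtain t :: "nat \<Rightarrow> nat" where t: "strict_mono t" "mono (\<lambda>n. s (r (t n)) i)"
    using nat_seq_mono_subseq[of "\<lambda>n. s (r n) i"] by blast
  have "mono (\<lambda>n. s (r (t n)) j)" if "j \<in> S" for j
    using r(2) that t(1) by (simp add: mono_def strict_mono_less_eq)
  then show ?case
    using r(1) t by (intro exI[of _ "\<lambda>n. r (t n)"]) (auto simp: strict_mono_def)
qed

text \<open>
  The finite set consists of the minimal elements of \<open>E\<close>: infinitely many of them would contain an
  ascending pair, by the preceding lemma.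
\<close>

lemma dickson:
  fixes E :: "('i::finite \<Rightarrow> nat) set"
  shows "\<exists>F\<subseteq>E. finite F \<and> (\<forall>e\<in>E. \<exists>f\<in>F. f \<le> e)"
proof -
  define F where "F = {e \<in> E. \<forall>f\<in>E. f \<le> e \<longrightarrow> f = e}"
  have dom: "\<exists>f\<in>F. f \<le> e" if "e \<in> E" for e
    using that
  proof (induction "\<Sum>i\<in>UNIV. e i" arbitrary: e rule: less_induct)
    case less
    show ?case
    proof (cases "e \<in> F")
      case False
      then obtain f where f: "f \<in> E" "f \<le> e" "f \<noteq> e"
        using less.prems by (auto simp: F_def)
      then obtain i where "f i \<noteq> e i" by blast
      with f(2) have "f i < e i" by (simp add: le_fun_def order_less_le)
      then have "(\<Sum>i\<in>UNIV. f i) < (\<Sum>i\<in>UNIV. e i)"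
        using f(2) by (intro sum_strict_mono_ex1) (auto simp: le_fun_def)
      then show ?thesis using less.hyps f(1,2) by (meson order_trans)
    qed auto
  qed
  have "finite F"
  proof (rule ccontr)
    assume "infinite F"
    then obtain s :: "nat \<Rightarrow> 'i \<Rightarrow> nat" where s: "inj s" "range s \<subseteq> F"
      using infinite_countable_subset by blast
    obtain r :: "nat \<Rightarrow> nat" where r: "strict_mono r" "\<forall>i\<in>(UNIV :: 'i set). mono (\<lambda>n. s (r n) i)"
      using nat_tuple_seq_mono_subseq[of UNIV s] by auto
    then have "s (r 0) i \<le> s (r 1) i" for i by (simp add: mono_def)
    then have "s (r 0) \<le> s (r 1)" by (simp add: le_fun_def)
    then have "s (r 0) = s (r 1)" using s(2) unfolding F_def by blast
    then have "r 0 = r 1" using s(1) by (simp add: inj_eq)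
    then show False using r(1) by (metis strict_mono_eq zero_neq_one)
  qed
  then show ?thesis using dom by (intro exI[of _ F]) (auto simp: F_def)
qed


section \<open>Degree-bounded standard bases\<close>

definition total_deg :: "('n::finite \<Rightarrow>\<^sub>0 nat) \<Rightarrow> nat" where
  "total_deg \<alpha> = (\<Sum>i\<in>UNIV. coef \<alpha> i)"

lemma deg_add: "total_deg (\<alpha> + \<beta>) = total_deg \<alpha> + total_deg \<beta>"
  by (simp add: total_deg_def lookup_add sum.distrib)

lemma finite_deg_le: "finite {\<alpha> :: 'n::finite \<Rightarrow>\<^sub>0 nat. total_deg \<alpha> \<le> d}"
proof (rule finite_imageD)
  have "coef \<alpha> i \<le> d" if "total_deg \<alpha> \<le> d" for \<alpha> :: "'n \<Rightarrow>\<^sub>0 nat" and i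
    using that member_le_sum[of i UNIV "coef \<alpha>"] by (simp add: total_deg_def)
  then have "coef ` {\<alpha> :: 'n \<Rightarrow>\<^sub>0 nat. total_deg \<alpha> \<le> d} \<subseteq> UNIV \<rightarrow>\<^sub>E {..d}" by auto
  then show "finite (coef ` {\<alpha> :: 'n \<Rightarrow>\<^sub>0 nat. total_deg \<alpha> \<le> d})"
    by (rule finite_subset) (intro finite_PiE, auto)
qed (auto simp: inj_on_def intro: poly_mapping_eqI)

definition deg_bound :: "('n::finite, 'k::field) mpoly \<Rightarrow> nat \<Rightarrow> bool" where
  "deg_bound p d \<longleftrightarrow> (\<forall>\<alpha>\<in>keys p. total_deg \<alpha> \<le> d)"

lemma deg_bound_exists: "\<exists>d. deg_bound p d"
  unfolding deg_bound_def
  by (rule exI[of _ "Max (total_deg ` keys p)"]) auto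

lemma deg_bound_diff: "deg_bound p d \<Longrightarrow> deg_bound q d \<Longrightarrow> deg_bound (p - q) d"
  using keys_diff[of p q] by (auto simp: deg_bound_def in_keys_iff lookup_minus)

lemma deg_bound_monomial_mult:
  assumes "deg_bound p e" "total_deg \<beta> + e \<le> d"
  shows "deg_bound (monomial \<beta> c * p) d"
  using assms by (cases "c = 0") (fastforce simp: deg_bound_def keys_monomial_mult deg_add)+

text \<open>
  If \<open>B\<close> is a standard basis of an ideal, these are the leading exponents of all its nonzero elements of
  degree at most \<open>d\<close>.
\<close>

definition standard_exponents ::
  "(('n::finite \<Rightarrow>\<^sub>0 nat) \<Rightarrow> ('n \<Rightarrow>\<^sub>0 nat) \<Rightarrow> bool) \<Rightarrow> (('n, 'k::field) mpoly \<times> nat) set \<Rightarrow> nat \<Rightarrow>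
   ('n \<Rightarrow>\<^sub>0 nat) set" where
  "standard_exponents leq B d =
     {\<beta> + \<gamma> | \<beta> \<gamma>. \<exists>(p, e)\<in>B. is_lead leq \<gamma> p \<and> total_deg \<beta> + e \<le> d}"

text \<open>
  A Groebner basis of the homogenisation of \<open>I\<close>, without mention of the extra variable: a pair
  \<open>(p, e)\<close> stands for \<open>p\<close> homogenised to degree \<open>e\<close>.
\<close>

definition standard_basis ::
  "(('n::finite \<Rightarrow>\<^sub>0 nat) \<Rightarrow> ('n \<Rightarrow>\<^sub>0 nat) \<Rightarrow> bool) \<Rightarrow> ('n, 'k::field) mpoly set \<Rightarrow>
   (('n, 'k) mpoly \<times> nat) set \<Rightarrow> bool" where
  "standard_basis leq I B \<longleftrightarrow>
     (\<forall>(p, e)\<in>B. p \<in> I \<and> deg_bound p e) \<and>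
     (\<forall>d. \<forall>q\<in>I. \<forall>\<alpha>. deg_bound q d \<longrightarrow> is_lead leq \<alpha> q \<longrightarrow> \<alpha> \<in> standard_exponents leq B d)"

text \<open>
  Dickson's lemma, applied to the exponents of the leading monomials after homogenisation. That
  domination between them respects the slack in the degree bound is the reason why the multiples
  obtained obey the bound on \<open>q\<close>.
\<close>

lemma standard_basis_exists:
  fixes I :: "('n::finite, 'k::field) mpoly set"
  shows "\<exists>B. finite B \<and> standard_basis leq I B"
proof -
  \<comment> \<open>The coordinate \<open>None\<close> is the exponent of the homogenising variable.\<close>
  define enc :: "('n \<Rightarrow>\<^sub>0 nat) \<Rightarrow> nat \<Rightarrow> 'n option \<Rightarrow> nat" where
    "enc \<alpha> d = (\<lambda>i. case i of Some i \<Rightarrow> coef \<alpha> i | None \<Rightarrow> d - total_deg \<alpha>)" for \<alpha> d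
  define E where "E = {enc \<alpha> d | \<alpha> d. \<exists>p\<in>I. is_lead leq \<alpha> p \<and> deg_bound p d}"
  obtain F where F: "F \<subseteq> E" "finite F" "\<forall>e\<in>E. \<exists>f\<in>F. f \<le> e"
    using dickson[of E] by blast
  have "\<exists>p \<alpha> d. f = enc \<alpha> d \<and> p \<in> I \<and> is_lead leq \<alpha> p \<and> deg_bound p d" if "f \<in> F" for f
    using that F(1) unfolding E_def by blast
  then obtain P A D where w: "\<And>f. f \<in> F \<Longrightarrow>
      f = enc (A f) (D f) \<and> P f \<in> I \<and> is_lead leq (A f) (P f) \<and> deg_bound (P f) (D f)"
    by metis
  define B where "B = (\<lambda>f. (P f, D f)) ` F"
  have "\<alpha> \<in> standard_exponents leq B d" if q: "q \<in> I" "deg_bound q d" "is_lead leq \<alpha> q" for d q \<alpha>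
  proof -
    have "enc \<alpha> d \<in> E" using q by (auto simp: E_def)
    then obtain f where f: "f \<in> F" "f \<le> enc \<alpha> d" using F(3) by blast
    define \<gamma> where "\<gamma> = A f"
    define \<beta> where "\<beta> = \<alpha> - \<gamma>"
    have leq: "enc \<gamma> (D f) \<le> enc \<alpha> d" using f w[of f] by (simp add: \<gamma>_def)
    have "coef \<gamma> i \<le> coef \<alpha> i" for i
      using le_funD[OF leq, of "Some i"] by (simp add: enc_def)
    then have \<alpha>: "\<alpha> = \<beta> + \<gamma>"
      by (intro poly_mapping_eqI) (simp add: \<beta>_def lookup_add lookup_minus)
    have "total_deg \<gamma> \<le> D f" "total_deg \<alpha> \<le> d"
      using w[OF f(1)] q by (auto simp: \<gamma>_def is_lead_def deg_bound_def)
    moreover have "D f - total_deg \<gamma> \<le> d - total_deg \<alpha>"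
      using le_funD[OF leq, of None] by (simp add: enc_def)
    ultimately have "total_deg \<beta> + D f \<le> d" using \<alpha> by (simp add: deg_add)
    moreover have "(P f, D f) \<in> B" "is_lead leq \<gamma> (P f)"
      using w[OF f(1)] f(1) by (auto simp: B_def \<gamma>_def)
    ultimately show ?thesis using \<alpha> unfolding standard_exponents_def by blast
  qed
  then have "standard_basis leq I B"
    using w by (auto simp: standard_basis_def B_def)
  then show ?thesis using F(2) by (auto simp: B_def)
qed

text \<open>
  If the leading exponents of the basis elements are the same for both preorders, then so are the sets
  \<open>X\<close> of standard exponents below each degree bound. Suppose the \<open>leq'\<close>-leading exponent \<open>\<gamma>\<close> of some
  \<open>q \<in> I\<close> is not in \<open>X\<close>. Division with respect to \<open>leq'\<close> removes from \<open>q\<close> all terms with exponents in \<open>X\<close>;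
  the term at \<open>\<gamma>\<close> is the lowest one and survives. The result is a nonzero element of \<open>I\<close> without
  exponents in \<open>X\<close>, which contradicts the assumption for \<open>leq\<close>.
\<close>

lemma standard_basis_transfer:
  fixes I :: "('n::finite, 'k::field) mpoly set"
  assumes I: "ideal_set I" and leq: "monomial_preorder leq" and leq': "monomial_preorder leq'"
    and B: "standard_basis leq I B"
    and agree: "\<And>p e \<alpha> \<beta>. (p, e) \<in> B \<Longrightarrow> \<alpha> \<in> keys p \<Longrightarrow> \<beta> \<in> keys p \<Longrightarrow> leq' \<alpha> \<beta> \<longleftrightarrow> leq \<alpha> \<beta>"
  shows "standard_basis leq' I B"
proof -
  have lead: "is_lead leq' \<gamma> p \<longleftrightarrow> is_lead leq \<gamma> p" if "(p, e) \<in> B" for p e \<gamma>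
    using agree[OF that] by (auto simp: is_lead_def refine_def)
  have exps: "standard_exponents leq' B d = standard_exponents leq B d" for d
    unfolding standard_exponents_def using lead by fast
  have False
    if "q \<in> I" "deg_bound q d" "is_lead leq' \<gamma> q" "\<gamma> \<notin> standard_exponents leq B d" for q d \<gamma>
    using that
  proof (induction "card {\<delta>. total_deg \<delta> \<le> d \<and> (\<exists>\<alpha>\<in>keys q \<inter> standard_exponents leq B d. refine leq' \<alpha> \<delta>)}"
      arbitrary: q rule: less_induct)
    case less
    let ?X = "standard_exponents leq B d"
    let ?S = "\<lambda>q :: ('n, 'k) mpoly. {\<delta>. total_deg \<delta> \<le> d \<and> (\<exists>\<alpha>\<in>keys q \<inter> ?X. refine leq' \<alpha> \<delta>)}"
    have "q \<noteq> 0" using less.prems(3) by (auto simp: is_lead_def)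
    then obtain \<alpha>0 where "is_lead leq \<alpha>0 q" using is_lead_exists[OF leq] by blast
    then have "\<alpha>0 \<in> keys q \<inter> ?X"
      using B less.prems(1,2) by (auto simp: standard_basis_def is_lead_def)
    then have "\<exists>x\<in>keys q \<inter> ?X. \<forall>y\<in>keys q \<inter> ?X. refine leq' x y"
      by (intro finite_total_has_least[OF _ _ refine_total[OF leq'] refine_trans[OF leq']]) auto
    then obtain \<alpha> where \<alpha>: "\<alpha> \<in> keys q" "\<alpha> \<in> ?X" "\<And>y. y \<in> keys q \<Longrightarrow> y \<in> ?X \<Longrightarrow> refine leq' \<alpha> y"
      by blast
    obtain \<beta> \<gamma>' p e where \<beta>: "\<alpha> = \<beta> + \<gamma>'" "(p, e) \<in> B" "is_lead leq \<gamma>' p" "total_deg \<beta> + e \<le> d"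
      using \<alpha>(2) unfolding standard_exponents_def by blast
    have p: "p \<in> I" "deg_bound p e" using B \<beta>(2) by (auto simp: standard_basis_def)
    have p': "is_lead leq' \<gamma>' p" using \<beta>(2,3) lead by blast
    define q' where "q' = q - monomial \<beta> (coef q (\<beta> + \<gamma>') / coef p \<gamma>') * p"
    note cancel = cancel_term[OF leq' p', where q = q and \<beta> = \<beta>, folded q'_def \<beta>(1)]
    have q'I: "q' \<in> I" unfolding q'_def
      using I p(1) less.prems(1) by (intro ideal_set_diff) (auto simp: ideal_set_def)
    have q'd: "deg_bound q' d" unfolding q'_def
      using less.prems(2) p(2) \<beta>(4) by (intro deg_bound_diff deg_bound_monomial_mult)
    have \<gamma>: "\<gamma> \<in> keys q" "\<And>\<delta>. \<delta> \<in> keys q \<Longrightarrow> refine leq' \<gamma> \<delta>"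
      using less.prems(3) by (auto simp: is_lead_def)
    \<comment> \<open>The cancelled exponent \<open>\<alpha>\<close> lies strictly above \<open>\<gamma>\<close>, so the term at \<open>\<gamma>\<close> survives.\<close>
    have "\<not> refine leq' \<alpha> \<gamma>"
      using refine_antisym[OF leq', of \<alpha> \<gamma>] \<gamma>(2)[OF \<alpha>(1)] \<alpha>(2) less.prems(4) by blast
    then have "\<gamma> \<in> keys q'" using cancel(3) \<gamma>(1) by (simp add: in_keys_iff)
    moreover have "refine leq' \<gamma> \<delta>" if "\<delta> \<in> keys q'" for \<delta>
      using cancel(2)[OF that] \<gamma>(2) \<alpha>(1) refine_trans[OF leq'] by blast
    ultimately have lead': "is_lead leq' \<gamma> q'" by (simp add: is_lead_def)
    have above: "refine leq' \<alpha> \<delta> \<and> \<delta> \<noteq> \<alpha>" if "\<delta> \<in> keys q' \<inter> ?X" for \<delta>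
      using cancel(2)[of \<delta>] that \<alpha>(3) by blast
    have "?S q' \<subseteq> ?S q" using above \<alpha> refine_trans[OF leq'] by blast
    moreover have "\<alpha> \<in> ?S q"
      using \<alpha> refine_refl[OF leq'] less.prems(2) by (auto simp: deg_bound_def)
    moreover have "\<alpha> \<notin> ?S q'"
    proof
      assume "\<alpha> \<in> ?S q'"
      then obtain \<delta> where "\<delta> \<in> keys q' \<inter> ?X" "refine leq' \<delta> \<alpha>" by blast
      then show False using above refine_antisym[OF leq'] by blast
    qed
    ultimately have "card (?S q') < card (?S q)"
      by (intro psubset_card_mono) (use finite_deg_le[of d] in \<open>auto elim: rev_finite_subset\<close>)
    then show False
      using less.hyps[OF _ q'I q'd lead' less.prems(4)] by blast
  qed
  then show ?thesis
    using B unfolding standard_basis_def exps by blast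
qed

text \<open>
  Division by the basis, read on initial forms: cancelling the leading term of \<open>q\<close> changes its initial
  form by a multiple of the initial form of a basis element, until the whole initial form is used up.
\<close>

lemma init_form_in_ideal:
  fixes I J :: "('n::finite, 'k::field) mpoly set"
  assumes I: "ideal_set I" and J: "ideal_set J" and leq: "monomial_preorder leq"
    and B: "standard_basis leq I B" and gens: "\<And>p e. (p, e) \<in> B \<Longrightarrow> init_form leq p \<in> J"
    and q: "q \<in> I"
  shows "init_form leq q \<in> J"
proof -
  obtain d where "deg_bound q d" using deg_bound_exists by blast
  with q show ?thesis
  proof (induction "card {\<delta>. total_deg \<delta> \<le> d \<and> (\<exists>\<alpha>\<in>keys q. refine leq \<alpha> \<delta>)}" arbitrary: q rule: less_induct)
    case less
    let ?S = "\<lambda>q :: ('n, 'k) mpoly. {\<delta>. total_deg \<delta> \<le> d \<and> (\<exists>\<alpha>\<in>keys q. refine leq \<alpha> \<delta>)}"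
    show ?case
    proof (cases "q = 0")
      case True
      then show ?thesis using J by (simp add: ideal_set_def)
    next
      case False
      then obtain \<alpha> where \<alpha>: "is_lead leq \<alpha> q" using is_lead_exists[OF leq] by blast
      then have "\<alpha> \<in> standard_exponents leq B d"
        using B less.prems by (auto simp: standard_basis_def)
      then obtain \<beta> \<gamma> p e where \<beta>: "\<alpha> = \<beta> + \<gamma>" "(p, e) \<in> B" "is_lead leq \<gamma> p" "total_deg \<beta> + e \<le> d"
        unfolding standard_exponents_def by blast
      have p: "p \<in> I" "deg_bound p e" using B \<beta>(2) by (auto simp: standard_basis_def)
      define c where "c = coef q (\<beta> + \<gamma>) / coef p \<gamma>"
      have c: "c \<noteq> 0" using \<alpha> \<beta>(1,3) by (auto simp: c_def is_lead_def in_keys_iff)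
      define q' where "q' = q - monomial \<beta> c * p"
      note cancel = cancel_term[OF leq \<beta>(3), where q = q and \<beta> = \<beta>, folded c_def, folded q'_def \<beta>(1)]
      have q'I: "q' \<in> I" unfolding q'_def
        using I p(1) less.prems(1) by (intro ideal_set_diff) (auto simp: ideal_set_def)
      have q'd: "deg_bound q' d" unfolding q'_def
        using less.prems(2) p(2) \<beta>(4) by (intro deg_bound_diff deg_bound_monomial_mult)
      have above: "refine leq \<alpha> \<delta> \<and> \<delta> \<noteq> \<alpha>" if "\<delta> \<in> keys q'" for \<delta>
        using cancel(2)[OF that] \<alpha> by (auto simp: is_lead_def)
      have "?S q' \<subseteq> ?S q" using above \<alpha> refine_trans[OF leq] unfolding is_lead_def by blast
      moreover have "\<alpha> \<in> ?S q"
        using \<alpha> refine_refl[OF leq] less.prems(2) by (auto simp: deg_bound_def is_lead_def)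
      moreover have "\<alpha> \<notin> ?S q'" using above refine_antisym[OF leq] by blast
      ultimately have "card (?S q') < card (?S q)"
        by (intro psubset_card_mono) (use finite_deg_le[of d] in \<open>auto elim: rev_finite_subset\<close>)
      then have IH: "init_form leq q' \<in> J" using less.hyps q'I q'd by blast
      let ?P = "monomial \<beta> c * p"
      have P: "init_form leq ?P = monomial \<beta> c * init_form leq p"
        using leq c by (rule init_form_monomial_mult)
      have keysP: "keys ?P = (+) \<beta> ` keys p" using c by (rule keys_monomial_mult)
      have le_refl: "leq \<delta> \<delta>" for \<delta> using leq by (auto simp: monomial_preorder_def)
      have coef_P: "coef (init_form leq ?P) \<delta> = (if leq \<delta> \<alpha> then coef ?P \<delta> else 0)" for \<delta>
      proof (rule coef_init_form_at[OF leq])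
        show "\<forall>\<beta>'\<in>keys ?P. leq \<alpha> \<beta>'" "\<exists>\<beta>'\<in>keys ?P. leq \<beta>' \<alpha>"
          using \<beta>(1,3) leq le_refl unfolding keysP
          by (auto simp: is_lead_def monomial_preorder_def dest: refine_le)
      qed
      have coef_q: "coef (init_form leq q) \<delta> = (if leq \<delta> \<alpha> then coef q \<delta> else 0)" for \<delta>
        using \<alpha> le_refl by (intro coef_init_form_at[OF leq]) (auto simp: is_lead_def dest: refine_le)
      have q: "coef q \<delta> = coef ?P \<delta> + coef q' \<delta>" for \<delta> by (simp add: q'_def lookup_minus)
      \<comment> \<open>Either \<open>q'\<close> still has terms of the same weight as \<open>\<alpha>\<close>, which then form its initial form, or
        the initial form of \<open>q\<close> is exhausted by the cancelled multiple.\<close>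
      have "init_form leq q = monomial \<beta> c * init_form leq p \<or>
            init_form leq q = monomial \<beta> c * init_form leq p + init_form leq q'"
      proof (cases "\<exists>\<delta>\<in>keys q'. leq \<delta> \<alpha>")
        case True
        then have "coef (init_form leq q') \<delta> = (if leq \<delta> \<alpha> then coef q' \<delta> else 0)" for \<delta>
          using above by (intro coef_init_form_at[OF leq]) (auto dest: refine_le)
        then have "init_form leq q = monomial \<beta> c * init_form leq p + init_form leq q'"
          by (intro poly_mapping_eqI) (simp add: coef_q coef_P lookup_add q flip: P)
        then show ?thesis by blast
      next
        case False
        then have "coef q' \<delta> = 0" if "leq \<delta> \<alpha>" for \<delta>
          using that by (auto simp: in_keys_iff)
        then have "init_form leq q = monomial \<beta> c * init_form leq p"
          by (intro poly_mapping_eqI) (simp add: coef_q coef_P lookup_add q flip: P)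
        then show ?thesis by blast
      qed
      then show ?thesis using IH gens[OF \<beta>(2)] J by (auto simp: ideal_set_def)
    qed
  qed
qed

text \<open>
  The finite set consists of all exponents of a standard basis. A preorder that agrees with \<open>leq\<close>
  there has the same leading exponents and initial forms on the basis, which is then standard for
  it as well; so both initial ideals are generated by the same polynomials.
\<close>

theorem initial_ideal_finitely_determined:
  fixes I :: "('n::finite, 'k::field) mpoly set"
  assumes I: "ideal_set I" and leq: "monomial_preorder leq"
  obtains P where "finite P" and
    "\<And>leq'. monomial_preorder leq' \<Longrightarrow> (\<And>\<alpha> \<beta>. \<alpha> \<in> P \<Longrightarrow> \<beta> \<in> P \<Longrightarrow> leq' \<alpha> \<beta> \<longleftrightarrow> leq \<alpha> \<beta>) \<Longrightarrow>
       Idl\<^bsub>ring_of_type_algebra\<^esub> (init_form leq' ` I) = Idl\<^bsub>ring_of_type_algebra\<^esub> (init_form leq ` I)"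
proof -
  obtain B where B: "finite B" "standard_basis leq I B"
    using standard_basis_exists by blast
  define P where "P = (\<Union>(p, e)\<in>B. keys p)"
  have gen: "Idl\<^bsub>ring_of_type_algebra\<^esub> (init_form l ` I) =
             Idl\<^bsub>ring_of_type_algebra\<^esub> ((\<lambda>(p, e). init_form l p) ` B)"
    if l: "monomial_preorder l" "standard_basis l I B" for l
  proof (intro equalityI genideal_least ideal_set_genideal)
    let ?J = "Idl\<^bsub>ring_of_type_algebra\<^esub> ((\<lambda>(p, e). init_form l p) ` B)"
    have "init_form l p \<in> ?J" if "(p, e) \<in> B" for p e
      using that by (intro subsetD[OF subset_genideal]) force
    then show "init_form l ` I \<subseteq> ?J"
      using init_form_in_ideal[OF I ideal_set_genideal l] by blast
    have "(\<lambda>(p, e). init_form l p) ` B \<subseteq> init_form l ` I"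
      using l(2) by (auto simp: standard_basis_def)
    then show "(\<lambda>(p, e). init_form l p) ` B \<subseteq> Idl\<^bsub>ring_of_type_algebra\<^esub> (init_form l ` I)"
      using subset_genideal by blast
  qed
  show thesis
  proof (rule that[of P])
    show "finite P" using B(1) by (auto simp: P_def)
    fix leq' :: "('n \<Rightarrow>\<^sub>0 nat) \<Rightarrow> ('n \<Rightarrow>\<^sub>0 nat) \<Rightarrow> bool"
    assume leq': "monomial_preorder leq'"
      and agree: "\<And>\<alpha> \<beta>. \<alpha> \<in> P \<Longrightarrow> \<beta> \<in> P \<Longrightarrow> leq' \<alpha> \<beta> \<longleftrightarrow> leq \<alpha> \<beta>"
    have agreeB: "leq' \<alpha> \<beta> \<longleftrightarrow> leq \<alpha> \<beta>" if "(p, e) \<in> B" "\<alpha> \<in> keys p" "\<beta> \<in> keys p" for p e \<alpha> \<beta>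
      using that by (intro agree) (auto simp: P_def)
    have "standard_basis leq' I B"
      using standard_basis_transfer[OF I leq leq' B(2) agreeB] .
    moreover have "init_form leq' p = init_form leq p" if "(p, e) \<in> B" for p e
      using agreeB[OF that] by (intro poly_mapping_eqI) (auto simp: coef_init_form)
    then have "(\<lambda>(p, e). init_form leq' p) ` B = (\<lambda>(p, e). init_form leq p) ` B"
      by (intro image_cong) auto
    ultimately show "Idl\<^bsub>ring_of_type_algebra\<^esub> (init_form leq' ` I) =
        Idl\<^bsub>ring_of_type_algebra\<^esub> (init_form leq ` I)"
      using gen[OF leq B(2)] gen[OF leq'] by simp
  qed
qed


(* x $ i always denotes a component of a vector *)
unbundle no fps_syntax

section \<open>Ordered rational vectors\<close>

locale value_order =
  fixes preceq :: "rat ^ 'r::finite \<Rightarrow> rat ^ 'r \<Rightarrow> bool" (infix "\<preceq>\<^sub>v" 50)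
  assumes additive_total_order: "additive_total_order preceq"
begin

definition prec :: "rat ^ 'r \<Rightarrow> rat ^ 'r \<Rightarrow> bool" (infix "\<prec>\<^sub>v" 50) where
  "a \<prec>\<^sub>v b \<longleftrightarrow> a \<preceq>\<^sub>v b \<and> a \<noteq> b"

sublocale ord: linorder preceq prec
proof -
  have "(\<lambda>a b. a \<preceq>\<^sub>v b \<and> a \<noteq> b) = prec" by (simp add: prec_def fun_eq_iff)
  then show "class.linorder preceq prec"
    using additive_total_order by (simp add: additive_total_order_def)
qed

lemma add_right_mono: "a \<preceq>\<^sub>v b \<Longrightarrow> a + c \<preceq>\<^sub>v b + c"
  using additive_total_order by (simp add: additive_total_order_def)

lemma add_le_cancel [simp]: "a + c \<preceq>\<^sub>v b + c \<longleftrightarrow> a \<preceq>\<^sub>v b" "c + a \<preceq>\<^sub>v c + b \<longleftrightarrow> a \<preceq>\<^sub>v b"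
proof -
  show 1: "a + c \<preceq>\<^sub>v b + c \<longleftrightarrow> a \<preceq>\<^sub>v b" for a b c
    using add_right_mono[of a b c] add_right_mono[of "a + c" "b + c" "- c"] by auto
  show "c + a \<preceq>\<^sub>v c + b \<longleftrightarrow> a \<preceq>\<^sub>v b"
    using 1[of a c b] by (simp add: add.commute)
qed

lemma add_less_cancel [simp]: "a + c \<prec>\<^sub>v b + c \<longleftrightarrow> a \<prec>\<^sub>v b" "c + a \<prec>\<^sub>v c + b \<longleftrightarrow> a \<prec>\<^sub>v b"
  by (simp_all add: prec_def)

lemma add_mono: "a \<preceq>\<^sub>v b \<Longrightarrow> c \<preceq>\<^sub>v d \<Longrightarrow> a + c \<preceq>\<^sub>v b + d"
  by (meson add_le_cancel ord.order_trans)

lemma add_strict_mono1: "a \<prec>\<^sub>v b \<Longrightarrow> c \<preceq>\<^sub>v d \<Longrightarrow> a + c \<prec>\<^sub>v b + d"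
  by (meson add_le_cancel add_less_cancel ord.less_le_trans)

lemma add_strict_mono2: "a \<preceq>\<^sub>v b \<Longrightarrow> c \<prec>\<^sub>v d \<Longrightarrow> a + c \<prec>\<^sub>v b + d"
  by (meson add_le_cancel add_less_cancel ord.le_less_trans)

lemma diff_positive: "0 \<prec>\<^sub>v b - a \<longleftrightarrow> a \<prec>\<^sub>v b"
  using add_less_cancel(1)[of 0 a "b - a"] by simp

lemma scaleN_mono: "a \<preceq>\<^sub>v b \<Longrightarrow> of_nat n *s a \<preceq>\<^sub>v of_nat n *s b"
  by (induction n) (simp_all add: vec.scale_left_distrib add_mono)

lemma scaleN_positive: "0 \<prec>\<^sub>v x \<Longrightarrow> 0 < n \<Longrightarrow> 0 \<prec>\<^sub>v of_nat n *s x"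
proof (induction n)
  case (Suc n)
  then show ?case
    using add_strict_mono1[of 0 x 0 "of_nat n *s x"]
    by (cases "n = 0") (auto simp: vec.scale_left_distrib prec_def)
qed simp

text \<open>
  The order is only assumed to respect addition; that it respects multiplication by positive
  rationals follows by clearing denominators.
\<close>

lemma scale_positive:
  assumes x: "0 \<prec>\<^sub>v x" and q: "0 < (q :: rat)"
  shows "0 \<prec>\<^sub>v q *s x"
proof (rule ccontr)
  assume "\<not> 0 \<prec>\<^sub>v q *s x"
  then have neg: "0 \<preceq>\<^sub>v - (q *s x)"
    using add_right_mono[of "q *s x" 0 "- (q *s x)"] by (simp add: ord.not_less)
  obtain a b where ab: "0 < b" "q = of_int a / of_int b"
    by (metis quotient_of_div quotient_of_denom_pos surj_pair)
  then have a: "0 < a" using q by (simp add: zero_less_divide_iff)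
  have "of_nat (nat b) *s (q *s x) = of_nat (nat a) *s x"
    using ab a by simp
  moreover have "0 \<prec>\<^sub>v of_nat (nat a) *s x"
    using scaleN_positive[OF x, of "nat a"] a by simp
  moreover have "0 \<preceq>\<^sub>v - (of_nat (nat b) *s (q *s x))"
    using scaleN_mono[OF neg, of "nat b"] by (simp add: vec.scale_minus_right)
  ultimately have "0 \<prec>\<^sub>v 0"
    using add_strict_mono1 by fastforce
  then show False by simp
qed

lemma sum_mono:
  "(\<And>i. i \<in> S \<Longrightarrow> f i \<preceq>\<^sub>v g i) \<Longrightarrow> sum f S \<preceq>\<^sub>v sum g S"
  by (induction S rule: infinite_finite_induct) (auto intro: add_mono)

end

lemma dot_add: "dot l (x + y) = dot l x + dot l y"
  by (simp add: dot_def algebra_simps sum.distrib)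

lemma dot_scale: "dot l (c *s x) = c * dot l x"
  by (simp add: dot_def sum_distrib_left algebra_simps)

lemma dot_scale_left: "dot (c *s l) x = c * dot l x"
  by (simp add: dot_def sum_distrib_left algebra_simps)

lemma dot_diff: "dot l (x - y) = dot l x - dot l y"
  by (simp add: dot_def algebra_simps sum_subtractf)

lemma dot_sum: "dot l (sum f S) = (\<Sum>i\<in>S. dot l (f i))"
  by (induction S rule: infinite_finite_induct) (simp_all add: dot_add, simp_all add: dot_def)

lemma finite_separation:
  fixes A B :: "rat set"
  assumes "finite A" "finite B" "\<And>a b. a \<in> A \<Longrightarrow> b \<in> B \<Longrightarrow> a < b"
  shows "\<exists>s. (\<forall>a\<in>A. a < s) \<and> (\<forall>b\<in>B. s < b)"
proof (cases "A = {}")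
  case True
  have "Min B - 1 < b" if "b \<in> B" for b
    using Min_le[OF assms(2) that] by simp
  then show ?thesis using True by blast
next
  case A: False
  show ?thesis
  proof (cases "B = {}")
    case True
    then show ?thesis using gt_ex[of "Max A"] A assms(1) by auto
  next
    case False
    then have "Max A < Min B" using A assms by simp
    then obtain s where "Max A < s" "s < Min B" using dense by blast
    then show ?thesis using A False assms(1,2) by auto
  qed
qed

context value_order
begin

text \<open>
  Fourier-Motzkin elimination of the coordinate \<open>j\<close>. Scaled so that the \<open>j\<close>-th coordinate becomes \<open>1\<close>, \<open>0\<close> or
  \<open>- 1\<close>, the vectors are of three kinds; a vector of the first kind plus one of the third has \<open>j\<close>-th
  coordinate \<open>0\<close> and is again positive. A functional for all these sums and for the vectors of the
  second kind leaves an open interval for its own \<open>j\<close>-th coordinate.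
\<close>

lemma positive_functional_on_coordinates:
  fixes P :: "(rat ^ 'r) set"
  assumes "finite S" "finite P" "\<And>x. x \<in> P \<Longrightarrow> 0 \<prec>\<^sub>v x" "\<And>x j. x \<in> P \<Longrightarrow> j \<notin> S \<Longrightarrow> x $ j = 0"
  shows "\<exists>l. \<forall>x\<in>P. 0 < dot l x"
  using assms
proof (induction S arbitrary: P)
  case empty
  have "x = 0" if "x \<in> P" for x using empty.prems(3) that by (simp add: vec_eq_iff)
  then have "P = {}" using empty.prems(2) by (metis ex_in_conv ord.less_irrefl)
  then show ?case by simp
next
  case (insert j S)
  define nrm where "nrm x = (1 / \<bar>x $ j\<bar>) *s x" for x :: "rat ^ 'r"
  define Z where "Z = {x \<in> P. x $ j = 0}"
  define U where "U = {x \<in> P. x $ j > 0}"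
  define D where "D = {x \<in> P. x $ j < 0}"
  have PZUD: "P = Z \<union> U \<union> D" by (auto simp: Z_def U_def D_def)
  have fin: "finite Z" "finite U" "finite D" using insert(4) by (simp_all add: Z_def U_def D_def)
  define Q where "Q = Z \<union> (\<lambda>(x, y). nrm x + nrm y) ` (U \<times> D)"
  have "\<exists>l. \<forall>x\<in>Q. 0 < dot l x"
  proof (rule insert.IH)
    show "finite Q" using fin by (simp add: Q_def)
    show "0 \<prec>\<^sub>v x" if "x \<in> Q" for x
    proof (cases "x \<in> Z")
      case True
      then show ?thesis using insert(5) by (simp add: Z_def)
    next
      case False
      then obtain y z where yz: "y \<in> U" "z \<in> D" "x = nrm y + nrm z"
        using \<open>x \<in> Q\<close> by (auto simp: Q_def)
      then have "0 \<prec>\<^sub>v nrm y" "0 \<prec>\<^sub>v nrm z"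
        unfolding nrm_def using insert(5) yz by (intro scale_positive; simp add: U_def D_def)+
      then show ?thesis
        using add_strict_mono1[of 0 "nrm y" 0 "nrm z"] yz(3) by (simp add: ord.less_imp_le)
    qed
    show "x $ i = 0" if "x \<in> Q" "i \<notin> S" for x :: "rat ^ 'r" and i
      using that insert(6) by (cases "i = j") (auto simp: Q_def Z_def U_def D_def nrm_def field_simps)
  qed
  then obtain l where l: "\<And>x. x \<in> Q \<Longrightarrow> 0 < dot l x" by blast
  have "\<exists>s. (\<forall>a\<in>(\<lambda>x. - dot l (nrm x)) ` U. a < s) \<and> (\<forall>b\<in>(\<lambda>y. dot l (nrm y)) ` D. s < b)"
  proof (rule finite_separation)
    fix a b assume "a \<in> (\<lambda>x. - dot l (nrm x)) ` U" "b \<in> (\<lambda>y. dot l (nrm y)) ` D"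
    then obtain x y where xy: "x \<in> U" "y \<in> D" "a = - dot l (nrm x)" "b = dot l (nrm y)" by blast
    then have "0 < dot l (nrm x + nrm y)" by (intro l) (auto simp: Q_def)
    then show "a < b" using xy by (simp add: dot_add)
  qed (use fin in simp_all)
  then obtain s where s: "\<And>x. x \<in> U \<Longrightarrow> - dot l (nrm x) < s" "\<And>y. y \<in> D \<Longrightarrow> s < dot l (nrm y)"
    by auto
  \<comment> \<open>The \<open>j\<close>-th coordinate of \<open>l\<close> is shifted by the separating number \<open>s\<close>.\<close>
  define l' where "l' = (\<chi> i. l $ i + (if i = j then s else 0))"
  have l': "dot l' x = dot l x + s * x $ j" for x
    unfolding dot_def l'_def
    by (simp add: distrib_right sum.distrib if_distrib[of "\<lambda>c. c * _"] cong: if_cong)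
  have "0 < dot l' x" if "x \<in> P" for x :: "rat ^ 'r"
  proof (cases "x $ j = 0")
    case True
    then show ?thesis using l[of x] that by (simp add: l' Q_def Z_def)
  next
    case False
    have nrm: "(1 / \<bar>x $ j\<bar>) * dot l' x = dot l (nrm x) + s * (x $ j / \<bar>x $ j\<bar>)"
      by (simp add: l' nrm_def dot_scale add_divide_distrib)
    have "x \<in> U \<and> s * (x $ j / \<bar>x $ j\<bar>) = s \<or> x \<in> D \<and> s * (x $ j / \<bar>x $ j\<bar>) = - s"
      using that False by (auto simp: U_def D_def abs_if)
    then have "0 < (1 / \<bar>x $ j\<bar>) * dot l' x"
      unfolding nrm using s(1)[of x] s(2)[of x] by auto
    then show ?thesis using False by (simp add: zero_less_divide_iff)
  qed
  then show ?case by blast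
qed

lemma positive_functional:
  fixes P :: "(rat ^ 'r) set"
  assumes "finite P" "\<And>x. x \<in> P \<Longrightarrow> 0 \<prec>\<^sub>v x"
  shows "\<exists>l. \<forall>x\<in>P. 0 < dot l x"
  using positive_functional_on_coordinates[of UNIV P] assms by simp

end


section \<open>Vector weights of monomials\<close>

definition mon_value :: "('n::finite \<Rightarrow> rat ^ 'r) \<Rightarrow> ('n \<Rightarrow>\<^sub>0 nat) \<Rightarrow> rat ^ 'r" where
  "mon_value w \<alpha> = (\<Sum>i\<in>UNIV. of_nat (coef \<alpha> i) *s w i)"

lemma mon_value_add: "mon_value w (\<alpha> + \<beta>) = mon_value w \<alpha> + mon_value w \<beta>"
  by (simp add: mon_value_def lookup_add vec.scale_left_distrib sum.distrib)

lemma mon_value_0 [simp]: "mon_value w 0 = 0"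
  by (simp add: mon_value_def)

lemma mon_value_variable: "mon_value w (monomial i 1) = w i"
proof -
  have "mon_value w (monomial i 1) = (\<Sum>j\<in>UNIV. if j = i then w j else 0)"
    unfolding mon_value_def by (rule sum.cong) (auto simp: lookup_single when_def)
  then show ?thesis by simp
qed

lemma exponent_vector_add: "exponent_vector (\<alpha> + \<beta>) = exponent_vector \<alpha> + exponent_vector \<beta>"
  by (simp add: exponent_vector_def lookup_add vec_eq_iff)

lemma monomial_preorder_dot:
  "monomial_preorder (\<lambda>\<alpha> \<beta>. dot u (exponent_vector \<alpha>) \<le> dot u (exponent_vector \<beta>))"
  by (auto simp: monomial_preorder_def exponent_vector_add dot_add)

lemma initial_form_eq_init_form:
  "initial_form u p = init_form (\<lambda>\<alpha> \<beta>. dot u (exponent_vector \<alpha>) \<le> dot u (exponent_vector \<beta>)) p"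
  by (simp add: initial_form_def init_form_def)

context value_order
begin

abbreviation weight_le :: "('n::finite \<Rightarrow> rat ^ 'r) \<Rightarrow> ('n \<Rightarrow>\<^sub>0 nat) \<Rightarrow> ('n \<Rightarrow>\<^sub>0 nat) \<Rightarrow> bool" where
  "weight_le w \<alpha> \<beta> \<equiv> mon_value w \<alpha> \<preceq>\<^sub>v mon_value w \<beta>"

lemma monomial_preorder_weight: "monomial_preorder (weight_le w)"
  unfolding monomial_preorder_def using ord.linear ord.order_trans by (auto simp: mon_value_add)

text \<open>
  The weight is \<open>u i = l (w i)\<close> for a functional \<open>l\<close> that is positive on the finitely many positive
  differences of values that matter for the initial ideal. Ties are preserved automatically, since
  \<open>l\<close> is applied to the values themselves.
\<close>

lemma scalar_weight_exists:
  fixes I :: "('n::finite, 'k::field) mpoly set" and w :: "'n \<Rightarrow> rat ^ 'r"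
  assumes I: "ideal_set I"
  shows "\<exists>u. initial_ideal u I = Idl\<^bsub>ring_of_type_algebra\<^esub> (init_form (weight_le w) ` I)"
proof (rule initial_ideal_finitely_determined[OF I monomial_preorder_weight[of w]])
  fix P :: "('n \<Rightarrow>\<^sub>0 nat) set"
  assume P: "finite P" and
    det: "\<And>le'. monomial_preorder le' \<Longrightarrow>
       (\<And>\<alpha> \<beta>. \<alpha> \<in> P \<Longrightarrow> \<beta> \<in> P \<Longrightarrow> le' \<alpha> \<beta> \<longleftrightarrow> weight_le w \<alpha> \<beta>) \<Longrightarrow>
       Idl\<^bsub>ring_of_type_algebra\<^esub> (init_form le' ` I) = Idl\<^bsub>ring_of_type_algebra\<^esub> (init_form (weight_le w) ` I)"
  define V where "V = {x \<in> (\<lambda>(\<alpha>, \<beta>). mon_value w \<beta> - mon_value w \<alpha>) ` (P \<times> P). 0 \<prec>\<^sub>v x}"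
  have "finite V" "\<And>x. x \<in> V \<Longrightarrow> 0 \<prec>\<^sub>v x" using P by (simp_all add: V_def)
  then have "\<exists>l. \<forall>x\<in>V. 0 < dot l x" by (rule positive_functional)
  then obtain l where l: "\<forall>x\<in>V. 0 < dot l x" by (rule exE)
  define u where "u = (\<chi> i. dot l (w i))"
  have u: "dot u (exponent_vector \<alpha>) = dot l (mon_value w \<alpha>)" for \<alpha>
  proof -
    have "dot l (mon_value w \<alpha>) = (\<Sum>i\<in>UNIV. of_nat (coef \<alpha> i) * dot l (w i))"
      by (simp add: mon_value_def dot_sum dot_scale)
    then show ?thesis
      unfolding dot_def[of u] by (simp add: u_def exponent_vector_def mult.commute)
  qed
  have strict: "dot l (mon_value w \<alpha>) < dot l (mon_value w \<beta>)"
    if "\<alpha> \<in> P" "\<beta> \<in> P" "mon_value w \<alpha> \<prec>\<^sub>v mon_value w \<beta>" for \<alpha> \<beta>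
  proof -
    have "mon_value w \<beta> - mon_value w \<alpha> \<in> V"
      using that by (auto simp: V_def diff_positive)
    then have "0 < dot l (mon_value w \<beta> - mon_value w \<alpha>)" using l by blast
    then show ?thesis by (simp add: dot_diff)
  qed
  have "dot u (exponent_vector \<alpha>) \<le> dot u (exponent_vector \<beta>) \<longleftrightarrow> weight_le w \<alpha> \<beta>"
    if "\<alpha> \<in> P" "\<beta> \<in> P" for \<alpha> \<beta>
    using strict[OF that] strict[OF that(2,1)] unfolding u
    by (metis linorder_not_less ord.not_less ord.le_less order_le_less)
  then have "Idl\<^bsub>ring_of_type_algebra\<^esub> (initial_form u ` I) =
      Idl\<^bsub>ring_of_type_algebra\<^esub> (init_form (weight_le w) ` I)"
    using det[OF monomial_preorder_dot] by (simp add: initial_form_eq_init_form[abs_def])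
  then show ?thesis unfolding initial_ideal_def by blast
qed

end


section \<open>The open ray of a weight\<close>

text \<open>
  For \<open>u = 0\<close> this is \<open>{0}\<close>, which is an open cone as well.
\<close>

definition ray :: "rat ^ 'n::finite \<Rightarrow> (rat ^ 'n) set" where
  "ray u = {t *s u | t. 0 < t}"

lemma self_in_ray: "u \<in> ray u"
  unfolding ray_def by (auto intro!: exI[of _ 1])

lemma initial_ideal_ray:
  assumes "w \<in> ray u"
  shows "initial_ideal w I = initial_ideal u I"
proof -
  obtain t where t: "w = t *s u" "0 < t" using assms by (auto simp: ray_def)
  have "initial_form w p = initial_form u p" for p :: "('a, 'b) mpoly"
    using t(2) by (simp add: initial_form_def t(1) dot_scale_left)
  then show ?thesis by (simp add: initial_ideal_def)
qed

lemma dot_axis: "dot (axis i c) w = c * w $ i"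
  by (simp add: dot_def axis_def if_distrib[of "\<lambda>c. c * _"] cong: if_cong)

lemma dot_diff_left: "dot (l - m) x = dot l x - dot m x"
  by (simp add: dot_def algebra_simps sum_subtractf)

lemma polyhedral_cone_halfline:
  fixes u :: "rat ^ 'n::finite"
  shows "polyhedral_cone {t *s u | t. 0 \<le> t}"
proof (cases "u = 0")
  case True
  define L :: "(rat ^ 'n) set" where "L = range (\<lambda>i. axis i 1) \<union> range (\<lambda>i. axis i (- 1))"
  have "w = 0" if "\<forall>l\<in>L. 0 \<le> dot l w" for w
  proof -
    have "axis i 1 \<in> L" "axis i (- 1) \<in> L" for i by (auto simp: L_def)
    then have "0 \<le> dot (axis i 1) w" "0 \<le> dot (axis i (- 1)) w" for i
      using that by blast+
    then show ?thesis by (simp add: dot_axis vec_eq_iff order_antisym)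
  qed
  moreover have "dot l 0 = 0" for l :: "rat ^ 'n" by (simp add: dot_def)
  ultimately have "{t *s u | t. 0 \<le> t} = {w. \<forall>l\<in>L. 0 \<le> dot l w}"
    using True by auto
  then show ?thesis unfolding polyhedral_cone_def by (intro exI[of _ L]) (simp add: L_def)
next
  case False
  then obtain j where j: "u $ j \<noteq> 0" by (auto simp: vec_eq_iff)
  \<comment> \<open>The forms \<open>h i\<close> are the minors of the matrix with rows \<open>u\<close> and \<open>w\<close> that involve column \<open>j\<close>; as \<open>u $ j \<noteq> 0\<close>,
    they all vanish iff \<open>w\<close> is a multiple of \<open>u\<close>.\<close>
  define h where "h i = axis i (u $ j) - axis j (u $ i)" for i
  define L :: "(rat ^ 'n) set" where "L = {axis j (u $ j)} \<union> range h \<union> range (\<lambda>i. - h i)"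
  have h: "dot (h i) w = u $ j * w $ i - u $ i * w $ j" "dot (- h i) w = u $ i * w $ j - u $ j * w $ i" for i w
    using dot_diff_left[of 0 "h i" w] by (simp_all add: h_def dot_diff_left dot_axis)
  have "{t *s u | t. 0 \<le> t} = {w. \<forall>l\<in>L. 0 \<le> dot l w}"
  proof (intro equalityI subsetI)
    fix w assume "w \<in> {t *s u | t. 0 \<le> t}"
    then obtain t where t: "w = t *s u" "0 \<le> t" by blast
    then have "0 \<le> t * (u $ j * u $ j)" by simp
    then show "w \<in> {w. \<forall>l\<in>L. 0 \<le> dot l w}"
      by (auto simp: L_def h dot_axis t(1) mult_ac)
  next
    fix w assume "w \<in> {w. \<forall>l\<in>L. 0 \<le> dot l w}"
    then have L: "0 \<le> dot l w" if "l \<in> L" for l using that by blast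
    have w: "0 \<le> u $ j * w $ j"
      using L[of "axis j (u $ j)"] by (simp add: L_def dot_axis)
    have w': "u $ j * w $ i = u $ i * w $ j" for i
      using L[of "h i"] L[of "- h i"] unfolding h by (simp add: L_def)
    define t where "t = w $ j / u $ j"
    have "w $ i = t * u $ i" for i
      using w'[of i] j by (simp add: t_def nonzero_eq_divide_eq mult.commute)
    then have "w = t *s u" by (simp add: vec_eq_iff)
    moreover have "0 \<le> t"
      using w by (simp add: t_def zero_le_divide_iff zero_le_mult_iff conj_commute disj_commute)
    ultimately show "w \<in> {t *s u | t. 0 \<le> t}" by blast
  qed
  then show ?thesis unfolding polyhedral_cone_def by (intro exI[of _ L]) (simp add: L_def)
qed

lemma cone_rel_interior_halfline:
  fixes u :: "rat ^ 'n::finite"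
  shows "cone_rel_interior {t *s u | t. 0 \<le> t} = ray u"
proof (cases "u = 0")
  case True
  then have "{t *s u | t. 0 \<le> t} = {0}" "ray u = {0}" by (auto simp: ray_def intro: exI[of _ 1])
  then show ?thesis
    by (auto simp: cone_rel_interior_def intro!: exI[of _ 1])
next
  case False
  let ?\<sigma> = "{t *s u | t. 0 \<le> t}"
  obtain j where j: "u $ j \<noteq> 0" using False by (auto simp: vec_eq_iff)
  have inj: "s = t" if "s *s u = t *s u" for s t using that False by simp
  have "?\<sigma> \<subseteq> vec.span {u}" by (auto intro: vec.span_scale vec.span_base)
  then have "vec.span ?\<sigma> \<subseteq> vec.span {u}" by (simp add: vec.span_minimal vec.subspace_span)
  then have span: "\<exists>s. w = s *s u" if "w \<in> vec.span ?\<sigma>" for w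
    using that by (auto simp: vec.span_singleton)
  show ?thesis
  proof (intro equalityI subsetI)
    fix x assume x: "x \<in> cone_rel_interior ?\<sigma>"
    then obtain t where t: "x = t *s u" "0 \<le> t" by (auto simp: cone_rel_interior_def)
    have "t \<noteq> 0"
    proof
      assume "t = 0"
      then have "x = 0" using t by simp
      then obtain e where e: "e > 0" "\<And>w. w \<in> vec.span ?\<sigma> \<Longrightarrow> (\<forall>i. \<bar>w $ i\<bar> < e) \<Longrightarrow> w \<in> ?\<sigma>"
        using x by (auto simp: cone_rel_interior_def)
      \<comment> \<open>If the origin were in the relative interior, a small negative multiple of \<open>u\<close> would lie in the
        half-line; \<open>m\<close> strictly bounds the entries of \<open>u\<close>.\<close>
      define m where "m = 1 + (\<Sum>i\<in>UNIV. \<bar>u $ i\<bar>)"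
      have m: "\<bar>u $ i\<bar> < m" for i
        using member_le_sum[of i UNIV "\<lambda>i. \<bar>u $ i\<bar>"] by (simp add: m_def)
      then have "0 < m" by (metis abs_ge_zero order_le_less_trans)
      have "u \<in> ?\<sigma>" by (auto intro: exI[of _ 1])
      then have "(- (e / m)) *s u \<in> vec.span ?\<sigma>" by (intro vec.span_scale vec.span_base)
      moreover have "\<bar>((- (e / m)) *s u) $ i\<bar> < e" for i
        using m[of i] \<open>0 < m\<close> e(1) by (simp add: abs_mult field_simps)
      ultimately have "(- (e / m)) *s u \<in> ?\<sigma>" by (intro e(2)) auto
      then obtain s where s: "(- (e / m)) *s u = s *s u" "0 \<le> s" by blast
      then have "- (e / m) = s" using inj by blast
      moreover have "0 < e / m" using e(1) \<open>0 < m\<close> by simp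
      ultimately show False using s(2) by linarith
    qed
    then show "x \<in> ray u" using t by (auto simp: ray_def)
  next
    fix x assume "x \<in> ray u"
    then obtain t where t: "x = t *s u" "0 < t" by (auto simp: ray_def)
    \<comment> \<open>Within \<open>t * \<bar>u $ j\<bar>\<close> of \<open>t *s u\<close> in coordinate \<open>j\<close>, a multiple of \<open>u\<close> has a positive factor.\<close>
    have "w \<in> ?\<sigma>" if w: "w \<in> vec.span ?\<sigma>" "\<forall>i. \<bar>w $ i - x $ i\<bar> < t * \<bar>u $ j\<bar>" for w
    proof -
      obtain s where s: "w = s *s u" using span w(1) by blast
      have "\<bar>(s - t) * u $ j\<bar> < t * \<bar>u $ j\<bar>"
        using w(2) by (simp add: s t(1) left_diff_distrib)
      then have "\<bar>s - t\<bar> < t" using j by (simp add: abs_mult)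
      then show ?thesis using s by (intro CollectI exI[of _ s]) auto
    qed
    moreover have "0 < t * \<bar>u $ j\<bar>" using t(2) j by simp
    moreover have "x \<in> ?\<sigma>" using t by (auto intro: less_imp_le)
    ultimately show "x \<in> cone_rel_interior ?\<sigma>" unfolding cone_rel_interior_def by blast
  qed
qed

lemma cone_initial_ideal_ray: "cone_initial_ideal (ray u) I = initial_ideal u I"
  unfolding cone_initial_ideal_def
proof (rule the_equality)
  show "\<forall>w\<in>ray u. initial_ideal w I = initial_ideal u I"
    by (intro ballI initial_ideal_ray)
  show "J = initial_ideal u I" if "\<forall>w\<in>ray u. initial_ideal w I = J" for J
    using bspec[OF that self_in_ray] by (rule sym)
qed

text \<open>
  Positive multiples of \<open>u\<close> compare monomials in the same way, so the initial ideal is constant on the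
  ray.
\<close>

lemma prime_cone_ray:
  assumes "primeideal (initial_ideal u I) ring_of_type_algebra"
    and "\<And>\<alpha>. monomial \<alpha> 1 \<notin> initial_ideal u I"
  shows "prime_cone I (ray u)"
proof -
  have "ray u \<subseteq> tropical_variety I"
    using assms(2) by (auto simp: tropical_variety_def initial_ideal_ray)
  moreover have "initial_ideal w I = initial_ideal w' I" if "w \<in> ray u" "w' \<in> ray u" for w w'
    using that by (simp only: initial_ideal_ray)
  moreover have "ray u \<noteq> {}" using self_in_ray by blast
  moreover have "\<exists>\<sigma>. polyhedral_cone \<sigma> \<and> ray u = cone_rel_interior \<sigma>"
    using polyhedral_cone_halfline[of u] cone_rel_interior_halfline[of u, symmetric] by blast
  ultimately have "open_cone I (ray u)"
    unfolding open_cone_def by blast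
  then show ?thesis
    using assms(1) by (simp add: prime_cone_def cone_initial_ideal_ray)
qed


section \<open>Evaluation of polynomials\<close>

abbreviation mon_eval :: "('n::finite \<Rightarrow> 'a::comm_ring_1) \<Rightarrow> ('n \<Rightarrow>\<^sub>0 nat) \<Rightarrow> 'a" where
  "mon_eval b \<alpha> \<equiv> \<Prod>i\<in>UNIV. b i ^ coef \<alpha> i"

lemma mon_eval_add: "mon_eval b (\<alpha> + \<beta>) = mon_eval b \<alpha> * mon_eval b \<beta>"
  by (simp add: lookup_add power_add prod.distrib)

lemma algebra_map_simps:
  assumes "algebra_map \<iota>"
  shows "\<iota> 0 = 0" "\<iota> 1 = 1" "\<iota> (c + d) = \<iota> c + \<iota> d" "\<iota> (c * d) = \<iota> c * \<iota> d" "\<iota> (- c) = - \<iota> c"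
proof -
  have add: "\<iota> (c + d) = \<iota> c + \<iota> d" for c d using assms by (simp add: algebra_map_def)
  show zero: "\<iota> 0 = 0" using add[of 0 0] by simp
  show "\<iota> (- c) = - \<iota> c" using add[of c "- c"] zero by (simp add: minus_unique)
qed (use assms in \<open>simp_all add: algebra_map_def\<close>)

lemma algebra_map_nonzero:
  assumes "algebra_map \<iota>" "c \<noteq> 0"
  shows "\<iota> c \<noteq> 0"
proof
  assume "\<iota> c = 0"
  then have "\<iota> (c * inverse c) = 0" using algebra_map_simps(4)[OF assms(1)] by simp
  then show False using assms(2) algebra_map_simps(2)[OF assms(1)] by simp
qed

lemma poly_eq_sum_monomials: "p = (\<Sum>\<alpha>\<in>keys p. monomial \<alpha> (coef p \<alpha>))"
  by (intro poly_mapping_eqI) (simp add: coef_sum_monomials in_keys_iff)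

context
  fixes \<iota> :: "'k::field \<Rightarrow> 'a::comm_ring_1" and b :: "'n::finite \<Rightarrow> 'a"
  assumes \<iota>: "algebra_map \<iota>"
begin

lemma poly_eval_superset:
  assumes "finite S" "keys p \<subseteq> S"
  shows "poly_eval \<iota> b p = (\<Sum>\<alpha>\<in>S. \<iota> (coef p \<alpha>) * mon_eval b \<alpha>)"
  unfolding poly_eval_def using assms
  by (intro sum.mono_neutral_left) (auto simp: in_keys_iff algebra_map_simps(1)[OF \<iota>])

lemma poly_eval_add: "poly_eval \<iota> b (p + q) = poly_eval \<iota> b p + poly_eval \<iota> b q"
  using poly_eval_superset[of "keys p \<union> keys q"] keys_add[of p q]
  by (simp add: lookup_add algebra_map_simps(3)[OF \<iota>] distrib_right sum.distrib)

lemma poly_eval_0 [simp]: "poly_eval \<iota> b 0 = 0"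
  by (simp add: poly_eval_def)

lemma poly_eval_sum: "poly_eval \<iota> b (sum f S) = (\<Sum>i\<in>S. poly_eval \<iota> b (f i))"
  by (induction S rule: infinite_finite_induct) (simp_all add: poly_eval_add)

lemma poly_eval_monomial: "poly_eval \<iota> b (monomial \<alpha> c) = \<iota> c * mon_eval b \<alpha>"
  by (simp add: poly_eval_def algebra_map_simps(1)[OF \<iota>])

lemma poly_eval_uminus: "poly_eval \<iota> b (- p) = - poly_eval \<iota> b p"
  by (metis add.right_inverse minus_unique poly_eval_0 poly_eval_add)

lemma poly_eval_diff: "poly_eval \<iota> b (p - q) = poly_eval \<iota> b p - poly_eval \<iota> b q"
  using poly_eval_add[of p "- q"] by (simp add: poly_eval_uminus)

lemma poly_eval_1: "poly_eval \<iota> b 1 = 1"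
  using poly_eval_monomial[of 0 1] by (simp add: algebra_map_simps(2)[OF \<iota>])

lemma poly_eval_mult: "poly_eval \<iota> b (p * q) = poly_eval \<iota> b p * poly_eval \<iota> b q"
proof -
  have "p * q = (\<Sum>\<alpha>\<in>keys p. \<Sum>\<beta>\<in>keys q. monomial \<alpha> (coef p \<alpha>) * monomial \<beta> (coef q \<beta>))"
    by (subst poly_eq_sum_monomials[of p], subst poly_eq_sum_monomials[of q]) (rule sum_product)
  then have "poly_eval \<iota> b (p * q) =
      (\<Sum>\<alpha>\<in>keys p. \<Sum>\<beta>\<in>keys q. (\<iota> (coef p \<alpha>) * mon_eval b \<alpha>) * (\<iota> (coef q \<beta>) * mon_eval b \<beta>))"
    by (simp only: poly_eval_sum mult_single poly_eval_monomial mon_eval_add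
        algebra_map_simps(4)[OF \<iota>] mult_ac)
  then show ?thesis
    by (simp add: poly_eval_def sum_product)
qed

lemma ideal_set_relation_ideal: "ideal_set (relation_ideal \<iota> b)"
  by (simp add: ideal_set_def relation_ideal_def poly_eval_add poly_eval_mult)

end


lemma poly_eval_variable:
  assumes "algebra_map \<iota>"
  shows "poly_eval \<iota> b (monomial (monomial i 1) 1) = b i"
proof -
  have "mon_eval b (monomial i 1) = (\<Prod>j\<in>UNIV. if j = i then b j else 1)"
    by (rule prod.cong) (auto simp: lookup_single when_def)
  then show ?thesis by (simp add: poly_eval_monomial[OF assms] algebra_map_simps[OF assms])
qed

section \<open>The filtration of a valuation\<close>

locale valued_algebra = value_order preceq
  for preceq :: "rat ^ 'r::finite \<Rightarrow> rat ^ 'r \<Rightarrow> bool" (infix "\<preceq>\<^sub>v" 50) +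
  fixes \<iota> :: "'k::field \<Rightarrow> 'a::idom" and v :: "'a \<Rightarrow> rat ^ 'r"
  assumes alg: "algebra_map \<iota>" and val: "is_valuation preceq \<iota> v"
begin

abbreviation ge :: "rat ^ 'r \<Rightarrow> 'a set" where "ge \<equiv> F_ge preceq v"
abbreviation gt :: "rat ^ 'r \<Rightarrow> 'a set" where "gt \<equiv> F_gt preceq v"
abbreviation coset :: "rat ^ 'r \<Rightarrow> 'a \<Rightarrow> 'a set" where "coset \<equiv> gr_coset preceq v"
abbreviation GR :: "(rat ^ 'r \<Rightarrow> 'a set) ring" where "GR \<equiv> gr_ring preceq v"

lemma ge_iff: "f \<in> ge a \<longleftrightarrow> f = 0 \<or> a \<preceq>\<^sub>v v f"
  by (auto simp: F_ge_def)

lemma gt_iff: "f \<in> gt a \<longleftrightarrow> f = 0 \<or> a \<prec>\<^sub>v v f"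
  by (auto simp: F_gt_def prec_def)

lemma v_mult: "f \<noteq> 0 \<Longrightarrow> g \<noteq> 0 \<Longrightarrow> v (f * g) = v f + v g"
  using val by (simp add: is_valuation_def)

lemma v_1 [simp]: "v 1 = 0"
  using v_mult[of 1 1] by simp

lemma v_const: "c \<noteq> 0 \<Longrightarrow> v (\<iota> c) = 0"
  using val algebra_map_simps(2)[OF alg] v_1 unfolding is_valuation_def by (metis mult.right_neutral one_neq_zero)

lemma v_uminus [simp]: "v (- f) = v f"
proof (cases "f = 0")
  case False
  have "v (\<iota> (- 1) * f) = v f" using val False by (simp add: is_valuation_def)
  then show ?thesis by (simp add: algebra_map_simps[OF alg])
qed simp

lemma v_power: "f \<noteq> 0 \<Longrightarrow> v (f ^ n) = of_nat n *s v f"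
  by (induction n) (simp_all add: v_mult vec.scale_left_distrib)

lemma v_prod: "(\<And>i. i \<in> S \<Longrightarrow> f i \<noteq> 0) \<Longrightarrow> v (prod f S) = (\<Sum>i\<in>S. v (f i))"
  by (induction S rule: infinite_finite_induct) (simp_all add: v_mult)

lemma v_mon_eval: "(\<And>i. b i \<noteq> 0) \<Longrightarrow> v (mon_eval b \<alpha>) = mon_value (\<lambda>i. v (b i)) \<alpha>"
  by (simp add: v_prod v_power mon_value_def)

lemma v_add: "f \<noteq> 0 \<Longrightarrow> g \<noteq> 0 \<Longrightarrow> f + g \<noteq> 0 \<Longrightarrow> v f \<preceq>\<^sub>v v (f + g) \<or> v g \<preceq>\<^sub>v v (f + g)"
  using val by (simp add: is_valuation_def)

lemma zero_in_ge [simp]: "0 \<in> ge a" and zero_in_gt [simp]: "0 \<in> gt a"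
  by (simp_all add: ge_iff gt_iff)

lemma gt_imp_ge: "f \<in> gt a \<Longrightarrow> f \<in> ge a"
  by (auto simp: ge_iff gt_iff ord.less_imp_le)

lemma ge_add: "f \<in> ge a \<Longrightarrow> g \<in> ge a \<Longrightarrow> f + g \<in> ge a"
  unfolding ge_iff by (metis add.left_neutral add.right_neutral ord.order_trans v_add)

lemma gt_add: "f \<in> gt a \<Longrightarrow> g \<in> gt a \<Longrightarrow> f + g \<in> gt a"
  unfolding gt_iff by (metis add.left_neutral add.right_neutral ord.less_le_trans v_add)

lemma ge_uminus: "f \<in> ge a \<Longrightarrow> - f \<in> ge a"
  by (auto simp: ge_iff)

lemma gt_uminus: "f \<in> gt a \<Longrightarrow> - f \<in> gt a"
  by (auto simp: gt_iff)

lemma gt_diff: "f \<in> gt a \<Longrightarrow> g \<in> gt a \<Longrightarrow> f - g \<in> gt a"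
  using gt_add[of f a "- g"] gt_uminus by simp

lemma gt_diff_commute: "f - g \<in> gt a \<longleftrightarrow> g - f \<in> gt a"
  using gt_uminus[of "f - g" a] gt_uminus[of "g - f" a] by auto

lemma gt_cancel: "f - g \<in> gt a \<Longrightarrow> f \<in> gt a \<longleftrightarrow> g \<in> gt a"
  using gt_add[of "f - g" a g] gt_diff[of f a "f - g"] by auto

lemma ge_sum: "(\<And>i. i \<in> S \<Longrightarrow> f i \<in> ge a) \<Longrightarrow> sum f S \<in> ge a"
  by (induction S rule: infinite_finite_induct) (auto intro: ge_add)

lemma gt_sum: "(\<And>i. i \<in> S \<Longrightarrow> f i \<in> gt a) \<Longrightarrow> sum f S \<in> gt a"
  by (induction S rule: infinite_finite_induct) (auto intro: gt_add)

lemma ge_mult: "f \<in> ge a \<Longrightarrow> g \<in> ge b \<Longrightarrow> f * g \<in> ge (a + b)"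
  by (cases "f = 0 \<or> g = 0") (auto simp: ge_iff v_mult intro: add_mono)

lemma gt_mult_ge: "f \<in> gt a \<Longrightarrow> g \<in> ge b \<Longrightarrow> f * g \<in> gt (a + b)"
  by (cases "f = 0 \<or> g = 0") (auto simp: ge_iff gt_iff v_mult intro: add_strict_mono1)

lemma ge_mult_gt: "f \<in> ge a \<Longrightarrow> g \<in> gt b \<Longrightarrow> f * g \<in> gt (a + b)"
  by (cases "f = 0 \<or> g = 0") (auto simp: ge_iff gt_iff v_mult intro: add_strict_mono2)

text \<open>
  The graded ring has no zero divisors among homogeneous elements.
\<close>

lemma mult_notin_gt:
  assumes "f \<in> ge a" "f \<notin> gt a" "g \<in> ge b" "g \<notin> gt b"
  shows "f * g \<notin> gt (a + b)"
proof -
  have "f \<noteq> 0" "g \<noteq> 0" "v f = a" "v g = b"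
    using assms by (auto simp: ge_iff gt_iff prec_def)
  then show ?thesis by (simp add: gt_iff v_mult)
qed

lemma mem_coset: "g \<in> coset a f \<longleftrightarrow> g - f \<in> gt a"
proof -
  have "g \<in> coset a f \<longleftrightarrow> (\<exists>h\<in>gt a. g = h + f)"
    by (auto simp: gr_coset_def a_r_coset_def')
  then show ?thesis by (metis add_diff_cancel diff_add_cancel)
qed

lemma coset_eq: "coset a f = coset a g \<longleftrightarrow> f - g \<in> gt a"
proof
  assume "coset a f = coset a g"
  moreover have "f \<in> coset a f" by (simp add: mem_coset)
  ultimately show "f - g \<in> gt a" by (simp flip: mem_coset)
next
  assume fg: "f - g \<in> gt a"
  have "x - f \<in> gt a \<longleftrightarrow> x - g \<in> gt a" for x
    using fg gt_cancel[of "x - g" "x - f" a] by simp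
  then show "coset a f = coset a g" by (auto simp: mem_coset)
qed

lemma coset_0: "coset a 0 = gt a"
  by (auto simp: mem_coset)

lemma coset_eq_gt: "coset a f = gt a \<longleftrightarrow> f \<in> gt a"
  using coset_eq[of a f 0] by (simp add: coset_0)

lemma coset_add: "coset a f <+>\<^bsub>ring_of_type_algebra\<^esub> coset a g = coset a (f + g)"
proof (intro equalityI subsetI)
  fix x assume "x \<in> coset a f <+>\<^bsub>ring_of_type_algebra\<^esub> coset a g"
  then obtain y z where "x = y + z" "y - f \<in> gt a" "z - g \<in> gt a"
    by (auto simp: set_add_def' mem_coset)
  then show "x \<in> coset a (f + g)"
    using gt_add[of "y - f" a "z - g"] by (simp add: mem_coset algebra_simps)
next
  fix x assume "x \<in> coset a (f + g)"
  then have "f \<in> coset a f" "x - f \<in> coset a g"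
    by (auto simp: mem_coset algebra_simps)
  then show "x \<in> coset a f <+>\<^bsub>ring_of_type_algebra\<^esub> coset a g"
    unfolding set_add_def' UN_iff by - (rule bexI[of _ f], rule bexI[of _ "x - f"], simp_all)
qed


section \<open>The associated graded ring as a quotient\<close>

text \<open>
  Formal sums \<open>\<Sum> h a t^a\<close> with \<open>h a\<close> of value at least \<open>a\<close>, a subring of the group algebra of \<open>\<rat>^r\<close> over
  \<open>A\<close> (a Rees algebra). The graded ring is its image under taking cosets, from which it inherits the
  ring axioms; checking them directly on cosets is thereby avoided.
\<close>

definition filtered :: "((rat ^ 'r) \<Rightarrow>\<^sub>0 'a) set" where
  "filtered = {h. \<forall>a. coef h a \<in> ge a}"

definition filtered_ring :: "((rat ^ 'r) \<Rightarrow>\<^sub>0 'a) ring" where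
  "filtered_ring = ring_of_type_algebra\<lparr>carrier := filtered\<rparr>"

definition gr_of :: "((rat ^ 'r) \<Rightarrow>\<^sub>0 'a) \<Rightarrow> rat ^ 'r \<Rightarrow> 'a set" where
  "gr_of h a = coset a (coef h a)"

lemma coef_mult:
  fixes f g :: "'g::ab_group_add \<Rightarrow>\<^sub>0 'b::comm_ring_1"
  shows "coef (f * g) c = (\<Sum>a\<in>keys f. coef f a * coef g (c - a))"
proof -
  have "(\<Sum>q. coef g q when c = a + q) = coef g (c - a)" for a
  proof -
    have "(\<Sum>q. coef g q when c = a + q) = (\<Sum>q. coef g q when q = c - a)"
      by (intro Sum_any.cong when_cong) (auto simp: algebra_simps)
    then show ?thesis by simp
  qed
  then have "coef (f * g) c = (\<Sum>a. coef f a * coef g (c - a))"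
    by (simp add: lookup_mult)
  also have "\<dots> = (\<Sum>a\<in>keys f. coef f a * coef g (c - a))"
    by (rule Sum_any.expand_superset) (auto simp: in_keys_iff)
  finally show ?thesis .
qed

lemma filtered_mult: "g \<in> filtered \<Longrightarrow> h \<in> filtered \<Longrightarrow> g * h \<in> filtered"
  unfolding filtered_def mem_Collect_eq
proof (rule allI)
  fix c assume gh: "\<forall>a. coef g a \<in> ge a" "\<forall>a. coef h a \<in> ge a"
  have "coef g a * coef h (c - a) \<in> ge c" for a
    using ge_mult[of "coef g a" a "coef h (c - a)" "c - a"] gh by simp
  then show "coef (g * h) c \<in> ge c" unfolding coef_mult by (intro ge_sum)
qed

lemma filtered_single: "f \<in> ge a \<Longrightarrow> monomial a f \<in> filtered"
  by (auto simp: filtered_def lookup_single when_def)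

lemma cring_filtered: "cring filtered_ring"
proof -
  interpret R: cring "ring_of_type_algebra :: ((rat ^ 'r) \<Rightarrow>\<^sub>0 'a) ring"
    by (rule cring_from_type_algebra)
  have "\<ominus>\<^bsub>ring_of_type_algebra\<^esub> h = - h" for h :: "(rat ^ 'r) \<Rightarrow>\<^sub>0 'a"
    using R.minus_equality[of "- h" h] by simp
  moreover have "1 \<in> filtered"
    using filtered_single[of 1 0] by (simp add: ge_iff)
  ultimately have "subring filtered ring_of_type_algebra"
    using filtered_mult
    by (intro R.subringI) (simp_all, simp_all add: filtered_def lookup_add ge_add ge_uminus)
  then show ?thesis
    unfolding filtered_ring_def
    by (intro R.subcring_iff[THEN iffD1] subcring.intro) (auto simp: subcring_axioms_def mult.commute)
qed

lemma gr_supp_gr_of: "gr_supp preceq v (gr_of h) = {a. coef h a \<notin> gt a}"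
  by (simp add: gr_supp_def gr_of_def coset_eq_gt)

lemma gr_supp_subset_keys: "gr_supp preceq v (gr_of h) \<subseteq> keys h"
  unfolding gr_supp_gr_of by (auto simp: in_keys_iff)

lemma gr_of_eq_iff: "gr_of g = gr_of h \<longleftrightarrow> (\<forall>a. coef g a - coef h a \<in> gt a)"
  by (simp add: gr_of_def fun_eq_iff coset_eq)

lemma gr_of_closed: "h \<in> filtered \<Longrightarrow> gr_of h \<in> carrier GR"
  using finite_subset[OF gr_supp_subset_keys[of h]]
  by (auto simp: gr_ring_def gr_of_def filtered_def)

lemma gr_of_surj: "gr_of ` filtered = carrier GR"
proof (intro equalityI subsetI)
  fix h assume h: "h \<in> carrier GR"
  then have "\<forall>a. \<exists>f\<in>ge a. h a = coset a f" and fin: "finite (gr_supp preceq v h)"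
    by (auto simp: gr_ring_def)
  then obtain f where f: "\<And>a. f a \<in> ge a" "\<And>a. h a = coset a (f a)" by metis
  define g where "g = (\<Sum>a\<in>gr_supp preceq v h. monomial a (f a))"
  have g: "coef g a = (if a \<in> gr_supp preceq v h then f a else 0)" for a
    unfolding g_def using fin by (rule coef_sum_monomials)
  have "g \<in> filtered" using f(1) by (simp add: filtered_def g)
  moreover have "gr_of g = h"
    by (rule ext) (simp add: gr_of_def g f(2) coset_0 gr_supp_def)
  ultimately show "h \<in> gr_of ` filtered" by blast
qed (use gr_of_closed in auto)

lemma gr_of_add: "gr_of (g + h) = gr_of g \<oplus>\<^bsub>GR\<^esub> gr_of h"
  by (simp add: gr_ring_def gr_of_def fun_eq_iff lookup_add coset_add)

lemma gr_of_0: "gr_of 0 = \<zero>\<^bsub>GR\<^esub>"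
  by (simp add: gr_ring_def gr_of_def fun_eq_iff coset_0)

lemma gr_of_1: "gr_of 1 = \<one>\<^bsub>GR\<^esub>"
  by (simp add: gr_ring_def gr_of_def fun_eq_iff coset_0 lookup_one when_def)

text \<open>
  Changing a representative changes a product of components by an element of higher value, and
  components outside the supports of the classes contribute only elements of higher value. Hence
  all choices of representatives in the definition of the product give the same coset.
\<close>

lemma gr_of_mult:
  assumes g: "g \<in> filtered" and h: "h \<in> filtered"
  shows "gr_of (g * h) = gr_of g \<otimes>\<^bsub>GR\<^esub> gr_of h"
proof (rule ext)
  fix c
  define T where "T = {a \<in> gr_supp preceq v (gr_of g). c - a \<in> gr_supp preceq v (gr_of h)}"
  have T: "T \<subseteq> keys g" using gr_supp_subset_keys[of g] by (auto simp: T_def)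
  have eq: "coset c (\<Sum>a\<in>T. \<phi> a * \<psi> (c - a)) = gr_of (g * h) c"
    if reps: "\<forall>a. \<phi> a \<in> gr_of g a" "\<forall>a. \<psi> a \<in> gr_of h a" for \<phi> \<psi>
  proof -
    have gh: "coef g a \<in> ge a" "coef h a \<in> ge a" for a
      using g h by (auto simp: filtered_def)
    have \<phi>: "\<phi> a - coef g a \<in> gt a" and \<psi>: "\<psi> a - coef h a \<in> gt a" for a
      using reps by (auto simp: gr_of_def mem_coset)
    have \<psi>ge: "\<psi> a \<in> ge a" for a
      using ge_add[OF gt_imp_ge[OF \<psi>] gh(2), of a] by simp
    have "\<phi> a * \<psi> (c - a) - coef g a * coef h (c - a) \<in> gt c" for a
      using gt_add[OF gt_mult_ge[OF \<phi> \<psi>ge, of a "c - a"] ge_mult_gt[OF gh(1) \<psi>, of a "c - a"]]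
      by (simp add: algebra_simps)
    then have 1: "(\<Sum>a\<in>T. \<phi> a * \<psi> (c - a) - coef g a * coef h (c - a)) \<in> gt c"
      by (rule gt_sum)
    have 2: "(\<Sum>a\<in>keys g - T. coef g a * coef h (c - a)) \<in> gt c"
    proof (rule gt_sum)
      fix a assume "a \<in> keys g - T"
      then have "coef g a \<in> gt a \<or> coef h (c - a) \<in> gt (c - a)"
        by (auto simp: T_def gr_supp_gr_of)
      then show "coef g a * coef h (c - a) \<in> gt c"
        using gt_mult_ge[OF _ gh(2), of "coef g a" a "c - a"] ge_mult_gt[OF gh(1), of "coef h (c - a)" "c - a" a]
        by auto
    qed
    have "coef (g * h) c = (\<Sum>a\<in>T. coef g a * coef h (c - a)) + (\<Sum>a\<in>keys g - T. coef g a * coef h (c - a))"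
      unfolding coef_mult using sum.subset_diff[OF T] by (simp add: add.commute)
    then show ?thesis
      using gt_diff[OF 1 2] unfolding gr_of_def coset_eq by (simp add: sum_subtractf algebra_simps)
  qed
  have "\<forall>a. coef g a \<in> gr_of g a" "\<forall>a. coef h a \<in> gr_of h a"
    by (simp_all add: gr_of_def mem_coset)
  then have "{coset c (\<Sum>a\<in>T. \<phi> a * \<psi> (c - a)) | \<phi> \<psi>.
       (\<forall>a. \<phi> a \<in> gr_of g a) \<and> (\<forall>a. \<psi> a \<in> gr_of h a)} = {gr_of (g * h) c}"
    using eq by blast
  then have "\<Union>{coset c (\<Sum>a\<in>T. \<phi> a * \<psi> (c - a)) | \<phi> \<psi>.
       (\<forall>a. \<phi> a \<in> gr_of g a) \<and> (\<forall>a. \<psi> a \<in> gr_of h a)} = gr_of (g * h) c"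
    by simp
  then show "gr_of (g * h) c = (gr_of g \<otimes>\<^bsub>GR\<^esub> gr_of h) c"
    by (simp add: gr_ring_def T_def)
qed

lemma gr_of_hom: "gr_of \<in> ring_hom filtered_ring GR"
  by (rule ring_hom_memI)
    (simp_all add: filtered_ring_def gr_of_closed gr_of_mult gr_of_add gr_of_1)

text \<open>
  The ring laws hold in a surjective homomorphic image of a commutative ring.
\<close>

lemma cring_GR: "cring GR"
proof -
  interpret F: cring filtered_ring by (rule cring_filtered)
  have carrier: "carrier filtered_ring = filtered" "\<zero>\<^bsub>filtered_ring\<^esub> = 0"
    by (simp_all add: filtered_ring_def)
  have "ring (GR\<lparr>carrier := gr_of ` carrier filtered_ring, zero := gr_of \<zero>\<^bsub>filtered_ring\<^esub>\<rparr>)"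
    by (rule F.ring_hom_imp_img_ring[OF gr_of_hom])
  then have "ring GR" by (simp add: carrier gr_of_surj gr_of_0)
  moreover have "x \<otimes>\<^bsub>GR\<^esub> y = y \<otimes>\<^bsub>GR\<^esub> x" if "x \<in> carrier GR" "y \<in> carrier GR" for x y
    using that unfolding gr_of_surj[symmetric] by (auto simp flip: gr_of_mult simp: mult.commute)
  ultimately show ?thesis
    by (intro cring.intro comm_monoid.intro ring.axioms) (auto simp: comm_monoid_axioms_def ring_def)
qed

lemma gr_of_single: "gr_of (monomial a f) = gr_homog preceq v a f"
  by (auto simp: gr_of_def gr_homog_def fun_eq_iff lookup_single when_def coset_0)

end


section \<open>Selecting terms of a polynomial\<close>

definition select :: "('b \<Rightarrow> bool) \<Rightarrow> ('b \<Rightarrow>\<^sub>0 'c::comm_monoid_add) \<Rightarrow> ('b \<Rightarrow>\<^sub>0 'c)" where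
  "select Q p = (\<Sum>\<alpha>\<in>{\<alpha> \<in> keys p. Q \<alpha>}. monomial \<alpha> (coef p \<alpha>))"

lemma coef_select: "coef (select Q p) \<alpha> = (if Q \<alpha> then coef p \<alpha> else 0)"
proof -
  have "coef (select Q p) \<alpha> = (\<Sum>\<beta>\<in>{\<beta> \<in> keys p. Q \<beta>}. if \<beta> = \<alpha> then coef p \<beta> else 0)"
    by (simp add: select_def lookup_sum lookup_single when_def)
  also have "\<dots> = (if Q \<alpha> then coef p \<alpha> else 0)"
    by (auto simp: in_keys_iff)
  finally show ?thesis .
qed

lemma keys_select: "keys (select Q p) = {\<alpha> \<in> keys p. Q \<alpha>}"
  by (auto simp: in_keys_iff coef_select split: if_splits)

lemma keys_diff_select: "keys (p - select Q p) = {\<alpha> \<in> keys p. \<not> Q \<alpha>}"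
  for p :: "'b \<Rightarrow>\<^sub>0 'c::ab_group_add"
  by (auto simp: in_keys_iff coef_select lookup_minus split: if_splits)

lemma sum_select:
  assumes "finite A" "\<And>\<alpha>. \<alpha> \<in> keys p \<Longrightarrow> w \<alpha> \<in> A"
  shows "(\<Sum>a\<in>A. select (\<lambda>\<alpha>. w \<alpha> = a) p) = p"
proof (rule poly_mapping_eqI)
  fix \<alpha>
  have "(\<Sum>a\<in>A. coef (select (\<lambda>\<alpha>. w \<alpha> = a) p) \<alpha>) = (if w \<alpha> \<in> A then coef p \<alpha> else 0)"
    using assms(1) by (simp add: coef_select)
  then show "coef (\<Sum>a\<in>A. select (\<lambda>\<alpha>. w \<alpha> = a) p) \<alpha> = coef p \<alpha>"
    using assms(2)[of \<alpha>] by (auto simp: lookup_sum in_keys_iff)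
qed


section \<open>Powers and products of monomials\<close>

lemma single_power: "monomial x (y :: 'b::comm_ring_1) ^ n = monomial (\<Sum>_<n. x) (y ^ n)"
  by (induction n) (simp_all add: mult_single add.commute)

lemma prod_single: "(\<Prod>i\<in>S. monomial (x i) (y i :: 'b::comm_ring_1)) = monomial (\<Sum>i\<in>S. x i) (\<Prod>i\<in>S. y i)"
  by (induction S rule: infinite_finite_induct) (simp_all add: mult_single)

lemma sum_lessThan_scale: "(\<Sum>_<n. x) = of_nat n *s (x :: rat ^ 'r)"
  by (induction n) (simp_all add: vec.scale_left_distrib add.commute del: sum_constant)

lemma mon_eval_single:
  "mon_eval (\<lambda>i. monomial (w i :: rat ^ 'r) (b i :: 'b::comm_ring_1)) \<alpha> = monomial (mon_value w \<alpha>) (mon_eval b \<alpha>)"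
  by (simp add: single_power prod_single mon_value_def sum_lessThan_scale del: sum_constant)

lemma mon_eval_variables:
  "mon_eval (\<lambda>i. monomial (monomial i 1) 1) \<alpha> = (monomial \<alpha> 1 :: ('n::finite, 'k::field) mpoly)"
proof -
  have "(\<Sum>_<m. monomial i 1) = (monomial i m :: 'n \<Rightarrow>\<^sub>0 nat)" for i m
    by (induction m) (simp_all flip: single_add)
  moreover have "(\<Sum>i\<in>UNIV. monomial i (coef \<alpha> i)) = \<alpha>"
    by (intro poly_mapping_eqI) (simp add: coef_sum_monomials)
  ultimately show ?thesis by (simp add: single_power prod_single)
qed


section \<open>The graded ring of an adapted presentation\<close>

locale presented_valued_algebra = valued_algebra preceq \<iota> v
  for preceq :: "rat ^ 'r::finite \<Rightarrow> rat ^ 'r \<Rightarrow> bool" (infix "\<preceq>\<^sub>v" 50)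
    and \<iota> :: "'k::field \<Rightarrow> 'a::idom" and v :: "'a \<Rightarrow> rat ^ 'r" +
  fixes b :: "'n::finite \<Rightarrow> 'a"
  assumes b_nonzero: "b i \<noteq> 0"
begin

text \<open>
  The value of the monomial \<open>b^\<alpha>\<close>, as a linear function of its exponent.
\<close>

definition mval :: "('n \<Rightarrow>\<^sub>0 nat) \<Rightarrow> rat ^ 'r" where
  "mval = mon_value (\<lambda>i. v (b i))"

lemma mon_eval_nonzero: "mon_eval b \<alpha> \<noteq> 0"
  using b_nonzero by simp

lemma v_mon_eval_b: "v (mon_eval b \<alpha>) = mval \<alpha>"
  using b_nonzero by (simp add: v_mon_eval mval_def)

lemma v_term: "c \<noteq> 0 \<Longrightarrow> v (\<iota> c * mon_eval b \<alpha>) = mval \<alpha>"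
  using algebra_map_nonzero[OF alg] mon_eval_nonzero by (simp add: v_mult v_const v_mon_eval_b)

abbreviation ev :: "('n, 'k) mpoly \<Rightarrow> 'a" where "ev \<equiv> poly_eval \<iota> b"

lemma ev_in_ge: "(\<And>\<alpha>. \<alpha> \<in> keys p \<Longrightarrow> a \<preceq>\<^sub>v mval \<alpha>) \<Longrightarrow> ev p \<in> ge a"
  unfolding poly_eval_def by (rule ge_sum) (simp add: ge_iff v_term in_keys_iff)

lemma ev_in_gt: "(\<And>\<alpha>. \<alpha> \<in> keys p \<Longrightarrow> a \<prec>\<^sub>v mval \<alpha>) \<Longrightarrow> ev p \<in> gt a"
  unfolding poly_eval_def by (rule gt_sum) (simp add: gt_iff v_term in_keys_iff)

text \<open>
  Evaluation at \<open>x i = t^(v (b i)) * b i\<close> in the group algebra: the coefficient at \<open>t^a\<close> is the value at \<open>b\<close>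
  of the part of \<open>p\<close> of weight \<open>a\<close>. As an evaluation map it is multiplicative, and so is the
  induced map to the graded ring.
\<close>

definition spread :: "('n, 'k) mpoly \<Rightarrow> (rat ^ 'r) \<Rightarrow>\<^sub>0 'a" where
  "spread = poly_eval (\<lambda>c. monomial 0 (\<iota> c)) (\<lambda>i. monomial (v (b i)) (b i))"

lemma spread_alg: "algebra_map (\<lambda>c. monomial (0 :: rat ^ 'r) (\<iota> c))"
  by (simp add: algebra_map_def algebra_map_simps[OF alg] single_add mult_single)

lemmas spread_add = poly_eval_add[OF spread_alg, where b = "\<lambda>i. monomial (v (b i)) (b i)", folded spread_def]
  and spread_mult = poly_eval_mult[OF spread_alg, where b = "\<lambda>i. monomial (v (b i)) (b i)", folded spread_def]
  and spread_1 = poly_eval_1[OF spread_alg, where b = "\<lambda>i. monomial (v (b i)) (b i)", folded spread_def]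
  and spread_sum = poly_eval_sum[OF spread_alg, where b = "\<lambda>i. monomial (v (b i)) (b i)", folded spread_def]

lemma coef_spread: "coef (spread p) a = ev (select (\<lambda>\<alpha>. mval \<alpha> = a) p)"
proof -
  have "coef (spread p) a = (\<Sum>\<alpha>\<in>keys p. if mval \<alpha> = a then \<iota> (coef p \<alpha>) * mon_eval b \<alpha> else 0)"
    unfolding spread_def poly_eval_def mon_eval_single mval_def
    by (simp add: mult_single lookup_sum lookup_single when_def)
  also have "\<dots> = (\<Sum>\<alpha>\<in>{\<alpha> \<in> keys p. mval \<alpha> = a}. \<iota> (coef p \<alpha>) * mon_eval b \<alpha>)"
    by (rule sum.inter_filter[symmetric]) simp
  also have "\<dots> = ev (select (\<lambda>\<alpha>. mval \<alpha> = a) p)"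
    unfolding poly_eval_def keys_select by (rule sum.cong) (simp_all add: coef_select)
  finally show ?thesis .
qed

lemma spread_homogeneous:
  assumes "\<And>\<alpha>. \<alpha> \<in> keys p \<Longrightarrow> mval \<alpha> = a"
  shows "spread p = monomial a (ev p)"
proof (rule poly_mapping_eqI)
  fix c
  have "select (\<lambda>\<alpha>. mval \<alpha> = c) p = (if c = a then p else 0)"
    using assms by (intro poly_mapping_eqI) (auto simp: coef_select in_keys_iff)
  then show "coef (spread p) c = coef (monomial a (ev p)) c"
    by (simp add: coef_spread lookup_single poly_eval_0[OF alg] when_def)
qed

lemma spread_filtered: "spread p \<in> filtered"
  unfolding filtered_def coef_spread mem_Collect_eq
  by (intro allI ev_in_ge) (simp add: keys_select)

definition gr_poly :: "('n, 'k) mpoly \<Rightarrow> rat ^ 'r \<Rightarrow> 'a set" where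
  "gr_poly p = gr_of (spread p)"

lemma gr_poly_hom: "gr_poly \<in> ring_hom ring_of_type_algebra GR"
  by (rule ring_hom_memI)
    (simp_all add: gr_poly_def gr_of_closed spread_filtered spread_mult spread_add spread_1
      gr_of_mult gr_of_add gr_of_1)

lemma ring_hom_cring_gr_poly: "ring_hom_cring ring_of_type_algebra GR gr_poly"
  using cring_from_type_algebra cring_GR gr_poly_hom
  by (simp add: ring_hom_cring_def ring_hom_cring_axioms_def)

lemma ring_hom_ring_gr_poly: "ring_hom_ring ring_of_type_algebra GR gr_poly"
  using ring_from_type_algebra cring.axioms(1)[OF cring_GR] gr_poly_hom by (rule ring_hom_ringI2)

lemma gr_poly_homogeneous:
  "(\<And>\<alpha>. \<alpha> \<in> keys p \<Longrightarrow> mval \<alpha> = a) \<Longrightarrow> gr_poly p = gr_homog preceq v a (ev p)"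
  by (simp add: gr_poly_def spread_homogeneous gr_of_single)

lemma gr_poly_const: "gr_poly (monomial 0 c) = gr_const preceq \<iota> v c"
  unfolding gr_const_def
  by (subst gr_poly_homogeneous[of _ 0]) (auto simp: mval_def poly_eval_monomial[OF alg] split: if_splits)

lemma gr_poly_variable: "gr_poly (monomial (monomial i 1) 1) = gr_class preceq v (b i)"
proof -
  have "ev (monomial (monomial i 1) 1) = b i" "mval (monomial i 1) = v (b i)"
    unfolding mval_def by (rule poly_eval_variable[OF alg], rule mon_value_variable)
  then show ?thesis
    unfolding gr_class_def by (subst gr_poly_homogeneous[of _ "v (b i)"]) auto
qed

text \<open>
  Sums and products in the graded ring are formed with the operators for ring records; both sides
  are homomorphisms that agree on constants and variables.
\<close>

lemma gr_eval_eq: "gr_eval preceq \<iota> v b p = gr_poly p"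
proof -
  interpret G: ring_hom_cring ring_of_type_algebra GR gr_poly by (rule ring_hom_cring_gr_poly)
  interpret S: cring GR by (rule cring_GR)
  have closed [simp]: "gr_poly q \<in> carrier GR" for q using G.hom_closed[of q] by simp
  have pow: "gr_poly (q ^ m) = gr_poly q [^]\<^bsub>GR\<^esub> m" for q m
  proof (induction m)
    case 0
    then show ?case using G.hom_one by simp
  next
    case (Suc m)
    then show ?case
      using G.hom_mult[of "q ^ m" q] by (simp add: mult.commute)
  qed
  have prod: "gr_poly (prod f S) = (\<Otimes>\<^bsub>GR\<^esub>i\<in>S. gr_poly (f i))" if "finite S" for f and S :: "'n set"
    using that
  proof (induction S)
    case empty
    then show ?case using G.hom_one by simp
  next
    case (insert i S)
    then show ?case using G.hom_mult[of "f i" "prod f S"] by simp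
  qed
  have sum: "gr_poly (sum f S) = (\<Oplus>\<^bsub>GR\<^esub>i\<in>S. gr_poly (f i))" if "finite S" for f and S :: "('n \<Rightarrow>\<^sub>0 nat) set"
    using that
  proof (induction S)
    case empty
    then show ?case using G.hom_zero by simp
  next
    case (insert i S)
    then show ?case using G.hom_add[of "f i" "sum f S"] by simp
  qed
  have mono: "gr_poly (monomial \<alpha> c) = gr_const preceq \<iota> v c \<otimes>\<^bsub>GR\<^esub>
      (\<Otimes>\<^bsub>GR\<^esub>i\<in>UNIV. gr_class preceq v (b i) [^]\<^bsub>GR\<^esub> coef \<alpha> i)" for \<alpha> c
  proof -
    have "monomial \<alpha> c = monomial 0 c * mon_eval (\<lambda>i. monomial (monomial i 1) 1) \<alpha>"
      unfolding mon_eval_variables by (simp add: mult_single)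
    then show ?thesis
      using G.hom_mult[of "monomial 0 c" "mon_eval (\<lambda>i. monomial (monomial i 1) 1) \<alpha>"]
      by (simp add: prod pow gr_poly_const gr_poly_variable del: One_nat_def)
  qed
  have "gr_poly p = gr_poly (\<Sum>\<alpha>\<in>keys p. monomial \<alpha> (coef p \<alpha>))"
    by (simp flip: poly_eq_sum_monomials)
  then show ?thesis by (simp add: sum mono gr_eval_def)
qed

definition gr_kernel :: "('n, 'k) mpoly set" where
  "gr_kernel = {p. \<forall>a. coef (spread p) a \<in> gt a}"

lemma gr_kernel_eq: "gr_kernel = a_kernel ring_of_type_algebra GR gr_poly"
  unfolding a_kernel_def' gr_kernel_def gr_poly_def gr_of_0[symmetric] gr_of_eq_iff by simp

lemma ideal_set_gr_kernel: "ideal_set gr_kernel"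
proof -
  have "ideal gr_kernel ring_of_type_algebra"
    unfolding gr_kernel_eq by (rule ring_hom_ring.kernel_is_ideal[OF ring_hom_ring_gr_poly])
  then show ?thesis by (simp add: ideal_iff_ideal_set)
qed

lemma monomial_notin_gr_kernel: "monomial \<alpha> 1 \<notin> gr_kernel"
proof -
  have "spread (monomial \<alpha> 1) = monomial (mval \<alpha>) (mon_eval b \<alpha>)"
    by (subst spread_homogeneous[of _ "mval \<alpha>"])
      (auto simp: poly_eval_monomial[OF alg] algebra_map_simps[OF alg])
  then have "coef (spread (monomial \<alpha> 1)) (mval \<alpha>) \<notin> gt (mval \<alpha>)"
    using mon_eval_nonzero[of \<alpha>] by (simp add: gt_iff v_mon_eval_b)
  then show ?thesis by (auto simp: gr_kernel_def)
qed

text \<open>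
  Leading components multiply: let \<open>a\<close> and \<open>d\<close> be the least degrees in which the classes of \<open>p\<close> and \<open>q\<close> do
  not vanish. In degree \<open>a + d\<close> all other contributions to the product have a factor in a degree
  below \<open>a\<close> or \<open>d\<close>, and vanish.
\<close>

lemma gr_kernel_prime:
  assumes "p \<notin> gr_kernel" "q \<notin> gr_kernel"
  shows "p * q \<notin> gr_kernel"
proof -
  have ge: "coef (spread r) a \<in> ge a" for r a
    using spread_filtered by (auto simp: filtered_def)
  have least: "\<exists>a. coef (spread r) a \<notin> gt a \<and> (\<forall>c. c \<prec>\<^sub>v a \<longrightarrow> coef (spread r) c \<in> gt c)"
    if "r \<notin> gr_kernel" for r
  proof -
    define S where "S = {a. coef (spread r) a \<notin> gt a}"
    have "S \<subseteq> keys (spread r)" by (auto simp: S_def in_keys_iff)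
    then have "finite S" by (rule finite_subset) simp
    moreover have "S \<noteq> {}" using that by (auto simp: S_def gr_kernel_def)
    ultimately have "\<exists>a\<in>S. \<forall>c\<in>S. a \<preceq>\<^sub>v c"
      by (rule finite_total_has_least) (auto intro: ord.order_trans)
    then obtain a where "a \<in> S" "\<And>c. c \<in> S \<Longrightarrow> a \<preceq>\<^sub>v c" by blast
    then have "coef (spread r) a \<notin> gt a" "\<And>c. c \<prec>\<^sub>v a \<Longrightarrow> coef (spread r) c \<in> gt c"
      unfolding S_def using ord.not_less by blast+
    then show ?thesis by blast
  qed
  obtain a where a: "coef (spread p) a \<notin> gt a" "\<And>c. c \<prec>\<^sub>v a \<Longrightarrow> coef (spread p) c \<in> gt c"
    using least[OF assms(1)] by blast
  obtain d where d: "coef (spread q) d \<notin> gt d" "\<And>c. c \<prec>\<^sub>v d \<Longrightarrow> coef (spread q) c \<in> gt c"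
    using least[OF assms(2)] by blast
  have a_key: "a \<in> keys (spread p)" using a(1) by (auto simp: in_keys_iff)
  have "coef (spread p) c * coef (spread q) (a + d - c) \<in> gt (a + d)" if "c \<noteq> a" for c
  proof (cases "c \<prec>\<^sub>v a")
    case True
    have "coef (spread p) c * coef (spread q) (a + d - c) \<in> gt (c + (a + d - c))"
      using a(2)[OF True] ge by (rule gt_mult_ge)
    then show ?thesis by simp
  next
    case False
    then have "a \<prec>\<^sub>v c" using that by (simp add: prec_def) 
    then have "a + d - c \<prec>\<^sub>v d"
      using add_less_cancel(1)[of "a + d - c" c d] by (simp add: add.commute)
    have "coef (spread p) c * coef (spread q) (a + d - c) \<in> gt (c + (a + d - c))"
      using ge d(2)[OF \<open>a + d - c \<prec>\<^sub>v d\<close>] by (rule ge_mult_gt)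
    then show ?thesis by simp
  qed
  then have "(\<Sum>c\<in>keys (spread p) - {a}. coef (spread p) c * coef (spread q) (a + d - c)) \<in> gt (a + d)"
    by (intro gt_sum) auto
  moreover have "coef (spread (p * q)) (a + d) - coef (spread p) a * coef (spread q) d =
      (\<Sum>c\<in>keys (spread p) - {a}. coef (spread p) c * coef (spread q) (a + d - c))"
    unfolding spread_mult coef_mult using a_key by (simp add: sum.remove)
  moreover have "coef (spread p) a * coef (spread q) d \<notin> gt (a + d)"
    using mult_notin_gt[OF ge a(1) ge d(1)] .
  ultimately have "coef (spread (p * q)) (a + d) \<notin> gt (a + d)"
    using gt_cancel by metis
  then show ?thesis by (auto simp: gr_kernel_def)
qed

lemma primeideal_gr_kernel: "primeideal gr_kernel ring_of_type_algebra"
proof (rule primeidealI)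
  show "carrier ring_of_type_algebra \<noteq> gr_kernel"
    using monomial_notin_gr_kernel[of 0] by auto
qed (use gr_kernel_prime ideal_set_gr_kernel in \<open>auto simp: ideal_iff_ideal_set\<close>)

text \<open>
  Equivalently, \<open>v\<close> is the quasi-valuation induced by the weights \<open>v (b i)\<close>. This is the common
  ground of the three classes of valuations treated below.
\<close>

definition adapted :: bool where
  "adapted \<longleftrightarrow> (\<forall>f. f \<noteq> 0 \<longrightarrow> (\<exists>p. ev p = f \<and> (\<forall>\<alpha>\<in>keys p. v f \<preceq>\<^sub>v mval \<alpha>)))"

lemma adapted_lift:
  assumes adapted "f \<in> ge a"
  shows "\<exists>p. ev p = f \<and> (\<forall>\<alpha>\<in>keys p. a \<preceq>\<^sub>v mval \<alpha>)"
proof (cases "f = 0")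
  case True
  then show ?thesis by (intro exI[of _ 0]) (simp add: poly_eval_0[OF alg])
next
  case False
  then obtain p where "ev p = f" "\<forall>\<alpha>\<in>keys p. v f \<preceq>\<^sub>v mval \<alpha>"
    using assms(1) unfolding adapted_def by blast
  then show ?thesis using assms(2) False ord.order_trans by (auto simp: ge_iff)
qed

lemma adapted_lift_gt:
  assumes adapted "f \<in> gt a"
  shows "\<exists>p. ev p = f \<and> (\<forall>\<alpha>\<in>keys p. a \<prec>\<^sub>v mval \<alpha>)"
proof (cases "f = 0")
  case True
  then show ?thesis by (intro exI[of _ 0]) (simp add: poly_eval_0[OF alg])
next
  case False
  then obtain p where "ev p = f" "\<forall>\<alpha>\<in>keys p. v f \<preceq>\<^sub>v mval \<alpha>"
    using assms(1) unfolding adapted_def by blast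
  then show ?thesis using assms(2) False ord.less_le_trans by (auto simp: gt_iff)
qed

text \<open>
  The class of \<open>f\<close> in degree \<open>a\<close> is the image of the part of weight \<open>a\<close> of an adapted lift of \<open>f\<close>, as the
  other terms of the lift have higher value.
\<close>

lemma gr_poly_surj:
  assumes adapted
  shows "range gr_poly = carrier GR"
proof (intro equalityI subsetI)
  fix h assume "h \<in> carrier GR"
  then obtain g where g: "g \<in> filtered" "gr_of g = h" unfolding gr_of_surj[symmetric] by blast
  have "\<exists>p. ev p = coef g a \<and> (\<forall>\<alpha>\<in>keys p. a \<preceq>\<^sub>v mval \<alpha>)" for a
    using adapted_lift[OF assms] g(1) by (simp add: filtered_def)
  then obtain q where q: "\<And>a. ev (q a) = coef g a" "\<And>a \<alpha>. \<alpha> \<in> keys (q a) \<Longrightarrow> a \<preceq>\<^sub>v mval \<alpha>"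
    by metis
  define r where "r a = select (\<lambda>\<alpha>. mval \<alpha> = a) (q a)" for a
  define p where "p = (\<Sum>a\<in>keys g. r a)"
  have spread_r: "spread (r a) = monomial a (ev (r a))" for a
    by (rule spread_homogeneous) (auto simp: r_def keys_select)
  have r: "ev (r a) - coef g a \<in> gt a" for a
  proof -
    have "ev (q a - r a) \<in> gt a"
      by (rule ev_in_gt) (use q(2) in \<open>auto simp: r_def keys_diff_select prec_def\<close>)
    then show ?thesis using gt_diff_commute by (simp add: poly_eval_diff[OF alg] q(1))
  qed
  have "coef (spread p) a = (if a \<in> keys g then ev (r a) else 0)" for a
    unfolding p_def spread_sum spread_r by (rule coef_sum_monomials) simp
  then have "gr_poly p = gr_of g"
    unfolding gr_poly_def gr_of_eq_iff using r by (auto simp: in_keys_iff)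
  then show "h \<in> range gr_poly" unfolding g(2) by (intro range_eqI) (rule sym)
qed (auto simp: gr_poly_def gr_of_closed spread_filtered)

lemma init_form_homogeneous_diff:
  assumes r: "r \<noteq> 0" "\<And>\<alpha>. \<alpha> \<in> keys r \<Longrightarrow> mval \<alpha> = a" and q: "\<And>\<alpha>. \<alpha> \<in> keys q \<Longrightarrow> a \<prec>\<^sub>v mval \<alpha>"
  shows "init_form (\<lambda>\<alpha> \<beta>. mval \<alpha> \<preceq>\<^sub>v mval \<beta>) (r - q) = r"
proof -
  have disj: "coef q \<alpha> = 0" if "\<alpha> \<in> keys r" for \<alpha>
    using r(2)[OF that] q[of \<alpha>] by (auto simp: in_keys_iff prec_def)
  obtain \<beta> where "\<beta> \<in> keys r" using r(1) by (metis keys_eq_empty ex_in_conv poly_mapping_eqI lookup_zero in_keys_iff)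
  then have \<beta>: "\<beta> \<in> keys (r - q)" "mval \<beta> = a" using r(2) disj by (auto simp: in_keys_iff lookup_minus)
  have keys: "\<alpha> \<in> keys r \<or> \<alpha> \<in> keys q" if "\<alpha> \<in> keys (r - q)" for \<alpha>
    using that by (auto simp: in_keys_iff lookup_minus)
  show ?thesis
  proof (rule poly_mapping_eqI)
    fix \<alpha>
    have "coef (init_form (\<lambda>\<alpha> \<beta>. mval \<alpha> \<preceq>\<^sub>v mval \<beta>) (r - q)) \<alpha> =
        (if mval \<alpha> \<preceq>\<^sub>v mval \<beta> then coef (r - q) \<alpha> else 0)"
    proof (rule coef_init_form_at)
      show "monomial_preorder (\<lambda>\<alpha> \<beta>. mval \<alpha> \<preceq>\<^sub>v mval \<beta>)"
        using monomial_preorder_weight by (simp add: mval_def)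
      show "\<forall>\<gamma>\<in>keys (r - q). mval \<beta> \<preceq>\<^sub>v mval \<gamma>"
        using keys r(2) q \<beta>(2) by (metis ord.less_imp_le ord.order_refl)
    qed (use \<beta> in auto)
    moreover have "\<not> mval \<alpha> \<preceq>\<^sub>v a" if "coef q \<alpha> \<noteq> 0"
      using q[of \<alpha>] that by (simp add: in_keys_iff ord.not_le)
    ultimately show "coef (init_form (\<lambda>\<alpha> \<beta>. mval \<alpha> \<preceq>\<^sub>v mval \<beta>) (r - q)) \<alpha> = coef r \<alpha>"
      using \<beta>(2) r(2)[of \<alpha>] disj[of \<alpha>] ord.order_refl[of a]
      by (cases "\<alpha> \<in> keys r") (auto simp: lookup_minus in_keys_iff)
  qed
qed

text \<open>
  For \<open>p \<in> I\<close> the initial form and the sum of the remaining terms evaluate at \<open>b\<close> to opposite elements;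
  these vanish or have value beyond the weight of the initial form, which is therefore in the kernel.
  Conversely, a homogeneous element \<open>r \<noteq> 0\<close> of the kernel is the initial form of \<open>r - q\<close> for an adapted lift \<open>q\<close> of \<open>r(b)\<close>.
\<close>

lemma initial_ideal_eq_gr_kernel:
  assumes adapted
  shows "Idl\<^bsub>ring_of_type_algebra\<^esub> (init_form (\<lambda>\<alpha> \<beta>. mval \<alpha> \<preceq>\<^sub>v mval \<beta>) ` relation_ideal \<iota> b) = gr_kernel"
    (is "Idl\<^bsub>_\<^esub> (?in ` ?I) = _")
proof (intro equalityI genideal_least ideal_set_gr_kernel)
  show "?in ` ?I \<subseteq> gr_kernel"
  proof clarify
    fix p assume p: "p \<in> ?I"
    show "?in p \<in> gr_kernel"
    proof (cases "keys p = {}")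
      case True
      then have "?in p = 0" by (simp add: init_form_def)
      then show ?thesis using ideal_set_gr_kernel by (simp add: ideal_set_def)
    next
      case False
      have "\<exists>\<alpha>\<in>keys p. \<forall>\<beta>\<in>keys p. mval \<alpha> \<preceq>\<^sub>v mval \<beta>"
        using False by (intro finite_total_has_least) (auto intro: ord.order_trans)
      then obtain \<alpha> where \<alpha>: "\<alpha> \<in> keys p" "\<And>\<beta>. \<beta> \<in> keys p \<Longrightarrow> mval \<alpha> \<preceq>\<^sub>v mval \<beta>" by blast
      define a where "a = mval \<alpha>"
      have inp: "?in p = select (\<lambda>\<beta>. mval \<beta> = a) p"
      proof (rule poly_mapping_eqI)
        fix \<beta>
        have "(\<forall>\<gamma>\<in>keys p. mval \<beta> \<preceq>\<^sub>v mval \<gamma>) \<longleftrightarrow> mval \<beta> = a" if "\<beta> \<in> keys p"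
          using \<alpha> that unfolding a_def by (metis ord.order_antisym)
        then show "coef (?in p) \<beta> = coef (select (\<lambda>\<beta>. mval \<beta> = a) p) \<beta>"
          by (auto simp: coef_init_form coef_select in_keys_iff)
      qed
      have "ev (p - ?in p) \<in> gt a"
        unfolding inp by (rule ev_in_gt) (use \<alpha>(2) in \<open>auto simp: keys_diff_select prec_def a_def\<close>)
      then have "ev (?in p) \<in> gt a"
        using p gt_uminus by (fastforce simp: poly_eval_diff[OF alg] relation_ideal_def)
      moreover have "spread (?in p) = monomial a (ev (?in p))"
        by (rule spread_homogeneous) (simp add: inp keys_select)
      ultimately show ?thesis by (auto simp: gr_kernel_def lookup_single when_def)
    qed
  qed
next
  let ?J = "Idl\<^bsub>ring_of_type_algebra\<^esub> (?in ` ?I)"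
  show "gr_kernel \<subseteq> ?J"
  proof
    fix p assume p: "p \<in> gr_kernel"
    have "select (\<lambda>\<alpha>. mval \<alpha> = a) p \<in> ?J" for a
    proof (cases "select (\<lambda>\<alpha>. mval \<alpha> = a) p = 0")
      case True
      then show ?thesis using ideal_set_genideal[of "?in ` ?I"] by (simp add: ideal_set_def)
    next
      case False
      define r where "r = select (\<lambda>\<alpha>. mval \<alpha> = a) p"
      have "ev r \<in> gt a" using p by (auto simp: gr_kernel_def coef_spread r_def)
      then obtain q where q: "ev q = ev r" "\<forall>\<alpha>\<in>keys q. a \<prec>\<^sub>v mval \<alpha>"
        using adapted_lift_gt[OF assms] by blast
      have "?in (r - q) = r"
        by (rule init_form_homogeneous_diff) (use False q(2) in \<open>auto simp: r_def keys_select\<close>)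
      moreover have "r - q \<in> ?I" using q(1) by (simp add: relation_ideal_def poly_eval_diff[OF alg])
      ultimately have "r \<in> ?in ` ?I" by (metis imageI)
      then show ?thesis unfolding r_def by (rule subsetD[OF subset_genideal])
    qed
    then have "(\<Sum>a\<in>mval ` keys p. select (\<lambda>\<alpha>. mval \<alpha> = a) p) \<in> ?J"
      by (intro ideal_set_sum ideal_set_genideal)
    then show "p \<in> ?J" using sum_select[of "mval ` keys p" p mval] by simp
  qed
qed

theorem adapted_prime_cone:
  assumes adapted
  shows "\<exists>C. prime_cone (relation_ideal \<iota> b) C \<and>
     algebra_isomorphic (ring_of_type_algebra Quot cone_initial_ideal C (relation_ideal \<iota> b))
       (quotient_const (cone_initial_ideal C (relation_ideal \<iota> b))) GR (gr_const preceq \<iota> v)"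
proof -
  obtain u where "initial_ideal u (relation_ideal \<iota> b) =
      Idl\<^bsub>ring_of_type_algebra\<^esub> (init_form (weight_le (\<lambda>i. v (b i))) ` relation_ideal \<iota> b)"
    using scalar_weight_exists[OF ideal_set_relation_ideal[OF alg]] by blast
  then have u: "initial_ideal u (relation_ideal \<iota> b) = gr_kernel"
    using initial_ideal_eq_gr_kernel[OF assms] by (simp add: mval_def)
  have "prime_cone (relation_ideal \<iota> b) (ray u)"
    using primeideal_gr_kernel monomial_notin_gr_kernel by (intro prime_cone_ray) (simp_all add: u)
  moreover have cone: "cone_initial_ideal (ray u) (relation_ideal \<iota> b) = gr_kernel"
    by (simp add: cone_initial_ideal_ray u)
  moreover have "algebra_isomorphic (ring_of_type_algebra Quot gr_kernel) (quotient_const gr_kernel)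
      GR (gr_const preceq \<iota> v)"
  proof -
    interpret H: ring_hom_ring ring_of_type_algebra GR gr_poly by (rule ring_hom_ring_gr_poly)
    have iso: "(\<lambda>Y. the_elem (gr_poly ` Y)) \<in> ring_iso (ring_of_type_algebra Quot gr_kernel) GR"
      unfolding gr_kernel_eq using gr_poly_surj[OF assms] by (intro H.FactRing_iso_set) simp
    have "the_elem (gr_poly ` quotient_const gr_kernel c) = gr_const preceq \<iota> v c" for c
      unfolding quotient_const_def gr_kernel_eq using H.the_elem_simp[of "monomial 0 c"] by (simp add: gr_poly_const)
    then show ?thesis unfolding algebra_isomorphic_def using iso by (intro bexI[OF _ iso] allI)
  qed
  ultimately show ?thesis by (intro exI[of _ "ray u"]) (simp add: cone)
qed

end


section \<open>Weight valuations are adapted\<close>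

lemma (in value_order) mon_value_mono:
  assumes "\<And>i. w i \<preceq>\<^sub>v w' i"
  shows "mon_value w \<alpha> \<preceq>\<^sub>v mon_value w' \<alpha>"
  unfolding mon_value_def using assms by (intro sum_mono scaleN_mono)

lemma matrix_weight_eq: "M *v exponent_vector \<alpha> = mon_value (\<lambda>i. column i M) \<alpha>"
  by (simp add: vec_eq_iff matrix_vector_mult_def mon_value_def column_def exponent_vector_def
      sum_component mult.commute)

lemma (in value_order) is_least_poly_weight:
  assumes "p \<noteq> 0"
  shows "is_least preceq ((\<lambda>\<alpha>. M *v exponent_vector \<alpha>) ` keys p) (poly_weight preceq M p)"
proof -
  let ?S = "(\<lambda>\<alpha>. M *v exponent_vector \<alpha>) ` keys p"
  have "keys p \<noteq> {}" using assms by (metis lookup_zero poly_mapping_eqI in_keys_iff empty_iff)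
  then have "\<exists>a\<in>?S. \<forall>c\<in>?S. a \<preceq>\<^sub>v c"
    by (intro finite_total_has_least) (auto intro: ord.order_trans)
  then obtain a where a: "is_least preceq ?S a" by (auto simp: is_least_def)
  then have "poly_weight preceq M p = a"
    unfolding poly_weight_def by (rule the_equality) (use a in \<open>auto simp: is_least_def intro: ord.order_antisym\<close>)
  then show ?thesis using a by simp
qed

lemma (in value_order) is_greatest_weight_map:
  assumes "is_weight_valuation preceq \<iota> b M" "f \<noteq> 0"
  shows "is_greatest preceq (lift_weights preceq \<iota> b M f) (weight_map preceq \<iota> b M f)"
proof -
  obtain a where a: "is_greatest preceq (lift_weights preceq \<iota> b M f) a"
    using assms by (auto simp: is_weight_valuation_def)
  then have "weight_map preceq \<iota> b M f = a"
    unfolding weight_map_def by (rule the_equality) (use a in \<open>auto simp: is_greatest_def intro: ord.order_antisym\<close>)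
  then show ?thesis using a by simp
qed

text \<open>
  The variable \<open>x i\<close> is a lift of \<open>b i\<close> of weight \<open>column i M\<close>, hence \<open>column i M\<close> is at most \<open>v (b i)\<close>.
  Therefore a lift that is optimal for the weights \<open>M\<close> is also one for the weights \<open>v (b i)\<close>.
\<close>

lemma (in presented_valued_algebra) weight_valuation_adapted:
  assumes M: "is_weight_valuation preceq \<iota> b M" and v: "v = weight_map preceq \<iota> b M"
  shows adapted
proof -
  have weight: "M *v exponent_vector \<alpha> \<preceq>\<^sub>v mval \<alpha>" for \<alpha>
  proof -
    have "column i M \<preceq>\<^sub>v v (b i)" for i
    proof -
      define x where "x = (monomial (monomial i 1) 1 :: ('n, 'k) mpoly)"
      have keys: "keys x = {monomial i 1}" by (simp add: x_def)
      then have "x \<noteq> 0" by auto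
      then have "poly_weight preceq M x = M *v exponent_vector (monomial i 1)"
        using is_least_poly_weight[of x M] unfolding keys by (auto simp: is_least_def)
      then have "poly_weight preceq M x = column i M"
        by (simp only: matrix_weight_eq mon_value_variable)
      moreover have "poly_eval \<iota> b x = b i" unfolding x_def by (rule poly_eval_variable[OF alg])
      ultimately have "column i M \<in> lift_weights preceq \<iota> b M (b i)"
        unfolding lift_weights_def by (metis (mono_tags, lifting) CollectI)
      then show ?thesis using is_greatest_weight_map[OF M b_nonzero, folded v] by (simp add: is_greatest_def)
    qed
    then show ?thesis unfolding matrix_weight_eq mval_def by (rule mon_value_mono)
  qed
  show adapted
    unfolding adapted_def
  proof (intro allI impI)
    fix f :: 'a assume f: "f \<noteq> 0"
    then have "v f \<in> lift_weights preceq \<iota> b M f"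
      using is_greatest_weight_map[OF M f, folded v] by (simp add: is_greatest_def)
    then obtain p where p: "poly_weight preceq M p = v f" "ev p = f"
      unfolding lift_weights_def by auto
    then have "p \<noteq> 0" using f poly_eval_0[OF alg] by metis
    then have "v f \<preceq>\<^sub>v M *v exponent_vector \<alpha>" if "\<alpha> \<in> keys p" for \<alpha>
      using is_least_poly_weight[of p M] that by (auto simp: is_least_def p(1))
    then show "\<exists>p. ev p = f \<and> (\<forall>\<alpha>\<in>keys p. v f \<preceq>\<^sub>v mval \<alpha>)"
      using p(2) weight ord.order_trans by blast
  qed
qed


section \<open>Subductive valuations are adapted\<close>

context presented_valued_algebra
begin

lemma coset_of_gr_class: "gr_class preceq v f (v f) = coset (v f) f"
  by (simp add: gr_class_def gr_homog_def)

text \<open>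
  Comparing the two graded classes in degree \<open>v f\<close> shows that one round of subduction raises the value.
\<close>

lemma subduction_poly_remainder:
  assumes "subduction_poly preceq \<iota> v b f p"
  shows "\<And>\<alpha>. \<alpha> \<in> keys p \<Longrightarrow> mval \<alpha> = v f" and "f - ev p \<in> gt (v f)"
proof -
  show mval: "\<And>\<alpha>. \<alpha> \<in> keys p \<Longrightarrow> mval \<alpha> = v f"
    using assms by (simp add: subduction_poly_def v_mon_eval_b)
  have "gr_class preceq v f = gr_homog preceq v (v f) (ev p)"
    using assms gr_poly_homogeneous[OF mval] by (simp add: subduction_poly_def gr_eval_eq)
  from fun_cong[OF this, of "v f"] show "f - ev p \<in> gt (v f)"
    by (simp add: coset_of_gr_class gr_homog_def coset_eq)
qed

lemma lift_add:
  assumes "\<And>\<alpha>. \<alpha> \<in> keys p \<Longrightarrow> a \<preceq>\<^sub>v mval \<alpha>" "\<And>\<alpha>. \<alpha> \<in> keys q \<Longrightarrow> a \<preceq>\<^sub>v mval \<alpha>"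
  shows "\<forall>\<alpha>\<in>keys (p + q). a \<preceq>\<^sub>v mval \<alpha>"
  using assms keys_add[of p q] by blast

lemma subduction_terminates_lift:
  assumes "subduction_terminates preceq \<iota> v b f"
  shows "\<exists>p. ev p = f \<and> (\<forall>\<alpha>\<in>keys p. v f \<preceq>\<^sub>v mval \<alpha>)"
  using assms
proof (induction rule: subduction_terminates.induct)
  case (stop f p)
  then show ?case using subduction_poly_remainder(1) by (metis ord.order_refl)
next
  case (continue f p)
  note p = subduction_poly_remainder[OF continue.hyps(2)]
  obtain q where q: "ev q = f - ev p" "\<forall>\<alpha>\<in>keys q. v (f - ev p) \<preceq>\<^sub>v mval \<alpha>"
    using continue.IH by blast
  have "v f \<preceq>\<^sub>v v (f - ev p)"
    using p(2) continue.hyps(3) by (auto simp: gt_iff ord.less_imp_le)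
  then have "\<forall>\<alpha>\<in>keys (p + q). v f \<preceq>\<^sub>v mval \<alpha>"
    using p(1) q(2) by (intro lift_add) (auto intro: ord.order_trans)
  moreover have "ev (p + q) = f" by (simp add: poly_eval_add[OF alg] q(1))
  ultimately show ?case by blast
qed

lemma subductive_adapted: "subductive preceq \<iota> v b \<Longrightarrow> adapted"
  unfolding adapted_def subductive_def using subduction_terminates_lift by blast


section \<open>Homogeneous valuations of positively graded algebras are adapted\<close>

lemma khovanskii_gr_poly_surj:
  assumes "khovanskii_basis preceq \<iota> v b"
  shows "carrier GR \<subseteq> range gr_poly"
proof
  interpret G: ring_hom_ring ring_of_type_algebra GR gr_poly by (rule ring_hom_ring_gr_poly)
  fix h assume "h \<in> carrier GR"
  then have "h \<in> generate_ring GR (range (gr_const preceq \<iota> v) \<union> range (\<lambda>i. gr_class preceq v (b i)))"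
    using assms by (simp add: khovanskii_basis_def generates_algebra_def)
  then show "h \<in> range gr_poly"
  proof (induction rule: generate_ring.induct)
    case one
    then show ?case using G.hom_one by (metis rangeI)
  next
    case (incl h)
    then consider c where "h = gr_const preceq \<iota> v c" | i where "h = gr_class preceq v (b i)"
      by blast
    then show ?case
    proof cases
      case (1 c)
      then show ?thesis by (simp only: gr_poly_const[symmetric] rangeI)
    next
      case (2 i)
      then show ?thesis by (simp only: gr_poly_variable[symmetric] rangeI)
    qed
  next
    case (a_inv h)
    then obtain p where "h = gr_poly p" by blast
    then show ?case using G.hom_a_inv[of p] by (metis UNIV_I rangeI type_ring_simps(1))
  next
    case (eng_add h1 h2)
    then obtain p q where "h1 = gr_poly p" "h2 = gr_poly q" by blast
    then show ?case using G.hom_add[of p q] by (metis UNIV_I rangeI type_ring_simps(1))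
  next
    case (eng_mult h1 h2)
    then obtain p q where "h1 = gr_poly p" "h2 = gr_poly q" by blast
    then show ?case using G.hom_mult[of p q] by (metis UNIV_I rangeI type_ring_simps(1))
  qed
qed

text \<open>
  Step (i) of the subduction algorithm: over a Khovanskii basis, the polynomial that represents the
  class of \<open>f\<close> can be replaced by its part of weight \<open>v f\<close>.
\<close>

lemma khovanskii_leading_poly:
  assumes "khovanskii_basis preceq \<iota> v b"
  shows "\<exists>p. (\<forall>\<alpha>\<in>keys p. mval \<alpha> = v f) \<and> f - ev p \<in> gt (v f)"
proof -
  have "f \<in> ge (v f)" by (simp add: ge_iff)
  then have "gr_of (monomial (v f) f) \<in> carrier GR" by (intro gr_of_closed filtered_single)
  then obtain q where "gr_of (monomial (v f) f) = gr_poly q"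
    using khovanskii_gr_poly_surj[OF assms] by blast
  then have "coef (monomial (v f) f) (v f) - coef (spread q) (v f) \<in> gt (v f)"
    unfolding gr_poly_def gr_of_eq_iff by (rule spec)
  then show ?thesis
    by (intro exI[of _ "select (\<lambda>\<alpha>. mval \<alpha> = v f) q"]) (simp add: coef_spread keys_select)
qed

end

lemma vector_space_alg_scale:
  assumes "algebra_map (\<iota> :: 'k::field \<Rightarrow> 'a::comm_ring_1)"
  shows "vector_space (alg_scale \<iota>)"
  by unfold_locales (simp_all add: algebra_map_simps[OF assms] algebra_simps)

lemma generates_algebra_poly_eval:
  assumes alg: "algebra_map \<iota>" and gen: "generates_algebra ring_of_type_algebra \<iota> (range b)"
  shows "\<exists>p. poly_eval \<iota> b p = f"
proof -
  have "f \<in> generate_ring ring_of_type_algebra (range \<iota> \<union> range b)"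
    using gen by (simp add: generates_algebra_def)
  then show ?thesis
  proof (induction rule: generate_ring.induct)
    case one
    then show ?case using poly_eval_1[OF alg] by auto
  next
    case (incl h)
    have "poly_eval \<iota> b (monomial 0 c) = \<iota> c" for c by (simp add: poly_eval_monomial[OF alg])
    then show ?case using incl poly_eval_variable[OF alg] by (metis UnE image_iff)
  next
    case (a_inv h)
    interpret R: ring "ring_of_type_algebra :: 'b ring" by (rule ring_from_type_algebra)
    have "\<ominus>\<^bsub>ring_of_type_algebra\<^esub> h = - h"
      using R.minus_equality[of "- h" h] by simp
    then show ?case using a_inv.IH poly_eval_uminus[OF alg] by metis
  next
    case (eng_add h1 h2)
    then show ?case using poly_eval_add[OF alg] by (metis type_ring_simps(5))
  next
    case (eng_mult h1 h2)
    then show ?case using poly_eval_mult[OF alg] by (metis type_ring_simps(2))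
  qed
qed

text \<open>
  Elements with distinct values are linearly independent, because in a linear relation the term of
  least value would equal a sum of terms of higher value.
\<close>

lemma (in valued_algebra) finite_values_of_finite_dim:
  assumes T: "finite T" and U: "U \<subseteq> module.span (alg_scale \<iota>) T"
  shows "finite (v ` (U - {0}))"
proof -
  interpret V: vector_space "alg_scale \<iota>" by (rule vector_space_alg_scale[OF alg])
  define A where "A = v ` (U - {0})"
  have "\<exists>f. f \<in> U \<and> f \<noteq> 0 \<and> v f = a" if "a \<in> A" for a
    using that by (auto simp: A_def)
  then obtain r where r: "\<And>a. a \<in> A \<Longrightarrow> r a \<in> U" "\<And>a. a \<in> A \<Longrightarrow> r a \<noteq> 0" "\<And>a. a \<in> A \<Longrightarrow> v (r a) = a"
    by metis
  have "V.independent (r ` A)"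
  proof
    assume "V.dependent (r ` A)"
    then obtain S c where S: "finite S" "S \<subseteq> r ` A" "(\<Sum>f\<in>S. \<iota> (c f) * f) = 0" "\<exists>f\<in>S. c f \<noteq> 0"
      unfolding V.dependent_explicit by blast
    define N where "N = {f \<in> S. c f \<noteq> 0}"
    have "\<exists>f\<in>N. \<forall>g\<in>N. v f \<preceq>\<^sub>v v g"
      by (rule finite_total_has_least) (use S(1,4) in \<open>auto simp: N_def intro: ord.order_trans\<close>)
    then obtain f where f: "f \<in> N" "\<And>g. g \<in> N \<Longrightarrow> v f \<preceq>\<^sub>v v g" by blast
    have "\<iota> (c g) * g \<in> gt (v f)" if "g \<in> N - {f}" for g
    proof -
      have "g \<in> r ` A" "f \<in> r ` A" using that f(1) S(2) by (auto simp: N_def)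
      then obtain a a' where "a \<in> A" "a' \<in> A" "g = r a" "f = r a'" by blast
      then have "v g \<noteq> v f" using that r(3)[of a] r(3)[of a'] by auto
      then have "v f \<prec>\<^sub>v v g" using f(2)[of g] that by (simp add: prec_def)
      moreover have "c g \<noteq> 0" "g \<noteq> 0" using that S(2) r(2) by (auto simp: N_def)
      ultimately show ?thesis
        using algebra_map_nonzero[OF alg] by (simp add: gt_iff v_mult v_const)
    qed
    then have rest: "(\<Sum>g\<in>N - {f}. \<iota> (c g) * g) \<in> gt (v f)" by (rule gt_sum)
    have "(\<Sum>g\<in>S. \<iota> (c g) * g) = (\<Sum>g\<in>N. \<iota> (c g) * g)"
      by (rule sum.mono_neutral_right) (use S(1) in \<open>auto simp: N_def algebra_map_simps[OF alg]\<close>)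
    also have "\<dots> = \<iota> (c f) * f + (\<Sum>g\<in>N - {f}. \<iota> (c g) * g)"
      using f(1) S(1) by (intro sum.remove) (auto simp: N_def)
    finally have "\<iota> (c f) * f = - (\<Sum>g\<in>N - {f}. \<iota> (c g) * g)" using S(3) by (simp add: eq_neg_iff_add_eq_0)
    then have "\<iota> (c f) * f \<in> gt (v f)" using gt_uminus[OF rest] by simp
    moreover have "c f \<noteq> 0" "f \<noteq> 0" using f(1) S(2) r(2) by (auto simp: N_def)
    ultimately show False
      using algebra_map_nonzero[OF alg] by (simp add: gt_iff v_mult v_const)
  qed
  then have "finite (r ` A)"
    using V.independent_span_bound[OF T] r(1) U by blast
  moreover have "inj_on r A" using r(3) by (metis inj_onI)
  ultimately show ?thesis using finite_imageD unfolding A_def by blast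
qed

locale graded_presentation =
  fixes \<iota> :: "'k::field \<Rightarrow> 'a::comm_ring_1" and b :: "'n::finite \<Rightarrow> 'a" and G :: "nat \<Rightarrow> 'a set"
    and dg :: "'n \<Rightarrow> nat"
  assumes alg: "algebra_map \<iota>" and gen: "generates_algebra ring_of_type_algebra \<iota> (range b)"
    and grading: "positive_grading \<iota> G" and b_homogeneous: "b i \<in> G (dg i)"
begin

definition mdeg :: "('n \<Rightarrow>\<^sub>0 nat) \<Rightarrow> nat" where
  "mdeg \<alpha> = (\<Sum>i\<in>UNIV. coef \<alpha> i * dg i)"

lemma subspace_G: "module.subspace (alg_scale \<iota>) (G d)"
  using grading by (simp add: positive_grading_def)

lemma
  shows G_zero: "0 \<in> G d" and G_scale: "f \<in> G d \<Longrightarrow> \<iota> c * f \<in> G d" and G_diff: "f \<in> G d \<Longrightarrow> g \<in> G d \<Longrightarrow> f - g \<in> G d"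
    and G_sum: "(\<And>i. i \<in> S \<Longrightarrow> h i \<in> G d) \<Longrightarrow> sum h S \<in> G d"
proof -
  interpret V: vector_space "alg_scale \<iota>" by (rule vector_space_alg_scale[OF alg])
  show "0 \<in> G d" "f \<in> G d \<Longrightarrow> \<iota> c * f \<in> G d"
    "f \<in> G d \<Longrightarrow> g \<in> G d \<Longrightarrow> f - g \<in> G d" "(\<And>i. i \<in> S \<Longrightarrow> h i \<in> G d) \<Longrightarrow> sum h S \<in> G d"
    using subspace_G V.subspace_0 V.subspace_scale V.subspace_diff V.subspace_sum
    by blast+
qed

lemma G_mult: "f \<in> G d \<Longrightarrow> g \<in> G e \<Longrightarrow> f * g \<in> G (d + e)"
  using grading by (simp add: positive_grading_def)

lemma G_one: "1 \<in> G 0"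
  using grading by (simp add: positive_grading_def)

lemma G_power: "f \<in> G d \<Longrightarrow> f ^ n \<in> G (n * d)"
  by (induction n) (auto simp: G_one intro: G_mult)

lemma G_prod: "(\<And>i. i \<in> S \<Longrightarrow> f i \<in> G (e i)) \<Longrightarrow> prod f S \<in> G (sum e S)"
  by (induction S rule: infinite_finite_induct) (auto simp: G_one intro: G_mult)

lemma mon_eval_homogeneous: "mon_eval b \<alpha> \<in> G (mdeg \<alpha>)"
  unfolding mdeg_def using b_homogeneous by (intro G_prod G_power)

lemma poly_eval_homogeneous:
  assumes "\<And>\<alpha>. \<alpha> \<in> keys p \<Longrightarrow> mdeg \<alpha> = d"
  shows "poly_eval \<iota> b p \<in> G d"
  unfolding poly_eval_def using mon_eval_homogeneous assms by (intro G_sum G_scale) metis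

lemma component_eq: "is_decomposition G f g \<Longrightarrow> component G f = g"
  unfolding component_def using grading by (intro the1_equality) (auto simp: positive_grading_def)

lemma is_decomposition_component: "is_decomposition G f (component G f)"
  using grading component_eq by (metis positive_grading_def)

lemma is_decompositionI:
  assumes "\<And>d. g d \<in> G d" "finite D" "\<And>d. d \<notin> D \<Longrightarrow> g d = 0" "f = (\<Sum>d\<in>D. g d)"
  shows "is_decomposition G f g"
proof -
  have sub: "{d. g d \<noteq> 0} \<subseteq> D" using assms(3) by blast
  then have "finite {d. g d \<noteq> 0}" using assms(2) finite_subset by blast
  moreover have "(\<Sum>d\<in>D. g d) = (\<Sum>d\<in>{d. g d \<noteq> 0}. g d)"
    using sub assms(2) by (intro sum.mono_neutral_right) auto
  ultimately show ?thesis using assms(1,4) by (simp add: is_decomposition_def)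
qed

text \<open>
  Evaluation maps the part of degree \<open>e\<close> of a polynomial into the graded piece of degree \<open>e\<close>, so it
  commutes with taking components.
\<close>

lemma component_diff_poly_eval:
  assumes f: "f \<in> G d"
  shows "component G (f - poly_eval \<iota> b p) d = f - poly_eval \<iota> b (select (\<lambda>\<alpha>. mdeg \<alpha> = d) p)"
proof -
  define g where "g e = (if e = d then f else 0) - poly_eval \<iota> b (select (\<lambda>\<alpha>. mdeg \<alpha> = e) p)" for e
  define D where "D = insert d (mdeg ` keys p)"
  have "is_decomposition G (f - poly_eval \<iota> b p) g"
  proof (rule is_decompositionI)
    show "finite D" by (simp add: D_def)
    show "g e \<in> G e" for e
      unfolding g_def using f by (intro G_diff poly_eval_homogeneous) (auto simp: G_zero keys_select)
    show "g e = 0" if "e \<notin> D" for e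
    proof -
      have "select (\<lambda>\<alpha>. mdeg \<alpha> = e) p = 0"
        using that by (intro poly_mapping_eqI) (auto simp: coef_select D_def in_keys_iff)
      then show ?thesis using that by (simp add: g_def D_def poly_eval_0[OF alg])
    qed
    have "(\<Sum>e\<in>D. g e) = f - (\<Sum>e\<in>D. poly_eval \<iota> b (select (\<lambda>\<alpha>. mdeg \<alpha> = e) p))"
      using \<open>finite D\<close> by (simp add: g_def sum_subtractf D_def)
    also have "(\<Sum>e\<in>D. poly_eval \<iota> b (select (\<lambda>\<alpha>. mdeg \<alpha> = e) p)) = poly_eval \<iota> b p"
      using sum_select[OF \<open>finite D\<close>, of p mdeg] by (simp add: D_def flip: poly_eval_sum[OF alg])
    finally show "f - poly_eval \<iota> b p = (\<Sum>e\<in>D. g e)" by simp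
  qed
  then show ?thesis using component_eq by (simp add: g_def)
qed

lemma component_0: "component G 0 d = 0"
  by (subst component_eq[of 0 "\<lambda>_. 0"]) (auto simp: is_decomposition_def G_zero)

lemma homogeneous_lift:
  assumes "f \<in> G d"
  shows "\<exists>p. poly_eval \<iota> b p = f \<and> (\<forall>\<alpha>\<in>keys p. mdeg \<alpha> = d)"
proof -
  obtain p where p: "poly_eval \<iota> b p = f" using generates_algebra_poly_eval[OF alg gen] by blast
  have "poly_eval \<iota> b (select (\<lambda>\<alpha>. mdeg \<alpha> = d) p) = f"
    using component_diff_poly_eval[OF assms, of p] by (simp add: p component_0)
  then show ?thesis by (intro exI[of _ "select (\<lambda>\<alpha>. mdeg \<alpha> = d) p"]) (simp add: keys_select)
qed

text \<open>
  Generators of degree \<open>0\<close> may occur to any power in a monomial of degree \<open>d\<close>, but their product lies in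
  \<open>G 0\<close>, which is finite-dimensional; the remaining factor is one of finitely many monomials, since
  the other generators have positive degree.
\<close>

lemma G_finite_dimensional: "\<exists>T. finite T \<and> G d \<subseteq> module.span (alg_scale \<iota>) T"
proof -
  interpret V: vector_space "alg_scale \<iota>" by (rule vector_space_alg_scale[OF alg])
  obtain S where S: "finite S" "G 0 \<subseteq> V.span S"
    using grading by (auto simp: positive_grading_def)
  define T where "T = (\<lambda>(s, \<beta>). s * mon_eval b \<beta>) ` (S \<times> {\<beta>. total_deg \<beta> \<le> d})"
  have "mon_eval b \<alpha> \<in> V.span T" if "mdeg \<alpha> = d" for \<alpha>
  proof -
    define \<gamma> where "\<gamma> = select (\<lambda>i. dg i = 0) \<alpha>"
    define \<beta> where "\<beta> = select (\<lambda>i. dg i \<noteq> 0) \<alpha>"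
    have "\<alpha> = \<gamma> + \<beta>"
      by (intro poly_mapping_eqI) (simp add: \<gamma>_def \<beta>_def lookup_add coef_select)
    then have split: "mon_eval b \<alpha> = mon_eval b \<gamma> * mon_eval b \<beta>" by (simp only: mon_eval_add)
    have "mdeg \<gamma> = 0" by (simp add: mdeg_def \<gamma>_def coef_select)
    then have "mon_eval b \<gamma> \<in> V.span S" using S(2) mon_eval_homogeneous[of \<gamma>] by auto
    have "total_deg \<beta> \<le> mdeg \<alpha>"
      unfolding total_deg_def mdeg_def by (rule Groups_Big.sum_mono) (simp add: \<beta>_def coef_select)
    then have sT: "s * mon_eval b \<beta> \<in> T" if "s \<in> S" for s
      using that \<open>mdeg \<alpha> = d\<close> by (auto simp: T_def)
    have "mon_eval b \<gamma> * mon_eval b \<beta> \<in> V.span T"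
      using \<open>mon_eval b \<gamma> \<in> V.span S\<close>
    proof (induction rule: V.span_induct_alt)
      case base
      then show ?case by (simp add: V.span_zero)
    next
      case (step c x y)
      have "\<iota> c * (x * mon_eval b \<beta>) + y * mon_eval b \<beta> \<in> V.span T"
        using step.IH V.span_scale[OF V.span_base[OF sT[OF step.hyps(1)]], of c] by (rule V.span_add[rotated])
      then show ?case by (simp add: algebra_simps)
    qed
    then show ?thesis using split by simp
  qed
  then have "poly_eval \<iota> b p \<in> V.span T" if "\<forall>\<alpha>\<in>keys p. mdeg \<alpha> = d" for p
    unfolding poly_eval_def using that by (intro V.span_sum V.span_scale) blast
  then have "G d \<subseteq> V.span T" using homogeneous_lift by blast
  moreover have "finite T" using S(1) by (simp add: T_def finite_deg_le)
  ultimately show ?thesis by blast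
qed

end

text \<open>
  For \<open>f \<in> G d\<close> the polynomial \<open>r\<close> of a subduction step may be replaced by its part of degree \<open>d\<close>: the new
  remainder is the component of degree \<open>d\<close> of the old one, and a valuation that respects the grading
  does not decrease on passing to components. Remainders thus stay in \<open>G d\<close>, where the value can
  rise only finitely often. Lifts of the homogeneous components of a general \<open>f\<close> add up to one of \<open>f\<close>.
\<close>

lemma (in presented_valued_algebra) homogeneous_valuation_adapted:
  assumes gen: "generates_algebra ring_of_type_algebra \<iota> (range b)"
    and grading: "positive_grading \<iota> G" and b_homog: "\<forall>i. \<exists>d. b i \<in> G d"
    and khov: "khovanskii_basis preceq \<iota> v b" and hom: "homogeneous_valuation preceq G v"
  shows adapted
proof -
  obtain dg where dg: "\<And>i. b i \<in> G (dg i)" using b_homog by metis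
  interpret graded_presentation \<iota> b G dg
    using alg gen grading dg by unfold_locales
  have step: "\<exists>p. (\<forall>\<alpha>\<in>keys p. mval \<alpha> = v f) \<and> ev p \<in> G d \<and> f - ev p \<in> gt (v f)"
    if f: "f \<in> G d" for f d
  proof -
    obtain r where r: "\<forall>\<alpha>\<in>keys r. mval \<alpha> = v f" "f - ev r \<in> gt (v f)"
      using khovanskii_leading_poly[OF khov] by blast
    define p where "p = select (\<lambda>\<alpha>. mdeg \<alpha> = d) r"
    have comp: "component G (f - ev r) d = f - ev p"
      unfolding p_def by (rule component_diff_poly_eval[OF f])
    have "f - ev p \<in> gt (v f)"
    proof (cases "f - ev p = 0")
      case False
      then have "f - ev r \<noteq> 0" using comp component_0 by metis
      then have "is_least preceq (v ` {component G (f - ev r) d | d. component G (f - ev r) d \<noteq> 0}) (v (f - ev r))"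
        using hom by (simp add: homogeneous_valuation_def)
      then have "v (f - ev r) \<preceq>\<^sub>v v (f - ev p)"
        using False comp unfolding is_least_def by (metis (mono_tags, lifting) CollectI imageI)
      moreover have "v f \<prec>\<^sub>v v (f - ev r)" using r(2) \<open>f - ev r \<noteq> 0\<close> by (simp only: gt_iff simp_thms)
      ultimately have "v f \<prec>\<^sub>v v (f - ev p)" by (rule ord.less_le_trans[rotated])
      then show ?thesis by (simp only: gt_iff simp_thms)
    qed simp
    moreover have "ev p \<in> G d" by (rule poly_eval_homogeneous) (simp add: p_def keys_select)
    moreover have "\<forall>\<alpha>\<in>keys p. mval \<alpha> = v f" using r(1) by (simp add: p_def keys_select)
    ultimately show ?thesis by blast
  qed
  have lift: "\<exists>p. ev p = f \<and> (\<forall>\<alpha>\<in>keys p. v f \<preceq>\<^sub>v mval \<alpha>)" if "f \<in> G d" "f \<noteq> 0" for f d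
  proof -
    define A where "A = v ` (G d - {0})"
    have A: "finite A"
      unfolding A_def using G_finite_dimensional finite_values_of_finite_dim by metis
    from that show ?thesis
    proof (induction "card {a \<in> A. v f \<prec>\<^sub>v a}" arbitrary: f rule: less_induct)
      case less
      obtain p where p: "\<forall>\<alpha>\<in>keys p. mval \<alpha> = v f" "ev p \<in> G d" "f - ev p \<in> gt (v f)"
        using step[OF less.prems(1)] by blast
      show ?case
      proof (cases "f - ev p = 0")
        case True
        then show ?thesis using p(1) by (intro exI[of _ p]) auto
      next
        case False
        define g where "g = f - ev p"
        have g: "g \<in> G d" "g \<noteq> 0" "v f \<prec>\<^sub>v v g"
          using less.prems(1) p(2,3) False by (auto simp: g_def gt_iff intro: G_diff)
        have "v g \<in> A" using g(1,2) by (simp add: A_def)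
        have "{a \<in> A. v g \<prec>\<^sub>v a} \<subset> {a \<in> A. v f \<prec>\<^sub>v a}"
          using g(3) \<open>v g \<in> A\<close> ord.less_trans by blast
        then have "card {a \<in> A. v g \<prec>\<^sub>v a} < card {a \<in> A. v f \<prec>\<^sub>v a}"
          using A by (intro psubset_card_mono) auto
        then obtain q where q: "ev q = g" "\<forall>\<alpha>\<in>keys q. v g \<preceq>\<^sub>v mval \<alpha>"
          using less.hyps g(1,2) by blast
        have "\<forall>\<alpha>\<in>keys (p + q). v f \<preceq>\<^sub>v mval \<alpha>"
          using p(1) q(2) g(3) by (intro lift_add) (auto intro: ord.order_trans[OF ord.less_imp_le])
        moreover have "ev (p + q) = f" by (simp add: poly_eval_add[OF alg] q(1) g_def)
        ultimately show ?thesis by blast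
      qed
    qed
  qed
  show ?thesis
    unfolding adapted_def
  proof (intro allI impI)
    fix f :: 'a assume f: "f \<noteq> 0"
    define D where "D = {d. component G f d \<noteq> 0}"
    have dec: "\<And>d. component G f d \<in> G d" "finite D" "f = (\<Sum>d\<in>D. component G f d)"
      using is_decomposition_component[of f] by (simp_all add: is_decomposition_def D_def)
    have "\<exists>p. ev p = component G f d \<and> (\<forall>\<alpha>\<in>keys p. v f \<preceq>\<^sub>v mval \<alpha>)" if "d \<in> D" for d
    proof -
      have "is_least preceq (v ` {component G f d | d. component G f d \<noteq> 0}) (v f)"
        using hom f by (simp add: homogeneous_valuation_def)
      then have "v f \<preceq>\<^sub>v v (component G f d)" using that by (auto simp: is_least_def D_def)
      moreover have "component G f d \<noteq> 0" using that by (simp add: D_def)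
      ultimately show ?thesis using lift[OF dec(1)[of d]] ord.order_trans by blast
    qed
    then obtain P where P: "\<And>d. d \<in> D \<Longrightarrow> ev (P d) = component G f d"
        "\<And>d \<alpha>. d \<in> D \<Longrightarrow> \<alpha> \<in> keys (P d) \<Longrightarrow> v f \<preceq>\<^sub>v mval \<alpha>" by metis
    have "ev (\<Sum>d\<in>D. P d) = f"
      using P(1) dec(3) by (simp add: poly_eval_sum[OF alg])
    moreover have "v f \<preceq>\<^sub>v mval \<alpha>" if "\<alpha> \<in> keys (\<Sum>d\<in>D. P d)" for \<alpha>
    proof -
      have "(\<Sum>d\<in>D. coef (P d) \<alpha>) \<noteq> 0" using that by (simp add: in_keys_iff lookup_sum)
      then obtain d where "d \<in> D" "coef (P d) \<alpha> \<noteq> 0" by (rule sum.not_neutral_contains_not_neutral)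
      then show ?thesis using P(2) by (simp add: in_keys_iff)
    qed
    ultimately show "\<exists>p. ev p = f \<and> (\<forall>\<alpha>\<in>keys p. v f \<preceq>\<^sub>v mval \<alpha>)" by blast
  qed
qed


section \<open>Existence of prime cones\<close>

theorem theorem6:
  fixes preceq :: "rat ^ 'r::finite \<Rightarrow> rat ^ 'r \<Rightarrow> bool"
    and \<iota> :: "'k::field \<Rightarrow> 'a::idom"
    and b :: "'n::finite \<Rightarrow> 'a"
  assumes "additive_total_order preceq"
    and "algebra_map \<iota>"
    and "\<And>i. b i \<noteq> 0"
    and "generates_algebra ring_of_type_algebra \<iota> (range b)"
  shows
    "(\<forall>M. is_weight_valuation preceq \<iota> b M \<longrightarrow>
        (\<exists>C. prime_cone (relation_ideal \<iota> b) C \<and>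
             algebra_isomorphic
               (ring_of_type_algebra Quot cone_initial_ideal C (relation_ideal \<iota> b))
               (quotient_const (cone_initial_ideal C (relation_ideal \<iota> b)))
               (gr_ring preceq (weight_map preceq \<iota> b M)) (gr_const preceq \<iota> (weight_map preceq \<iota> b M)))) \<and>
     (\<forall>v. subductive preceq \<iota> v b \<longrightarrow>
        (\<exists>C. prime_cone (relation_ideal \<iota> b) C \<and>
             algebra_isomorphic
               (ring_of_type_algebra Quot cone_initial_ideal C (relation_ideal \<iota> b))
               (quotient_const (cone_initial_ideal C (relation_ideal \<iota> b)))
               (gr_ring preceq v) (gr_const preceq \<iota> v))) \<and>
     (\<forall>G v. positive_grading \<iota> G \<longrightarrow> (\<forall>i. \<exists>d. b i \<in> G d) \<longrightarrow>
        khovanskii_basis preceq \<iota> v b \<longrightarrow> homogeneous_valuation preceq G v \<longrightarrow>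
        (\<exists>C. prime_cone (relation_ideal \<iota> b) C \<and>
             algebra_isomorphic
               (ring_of_type_algebra Quot cone_initial_ideal C (relation_ideal \<iota> b))
               (quotient_const (cone_initial_ideal C (relation_ideal \<iota> b)))
               (gr_ring preceq v) (gr_const preceq \<iota> v)))"
proof (intro conjI allI impI)
  fix M :: "rat ^ 'n ^ 'r" assume M: "is_weight_valuation preceq \<iota> b M"
  let ?v = "weight_map preceq \<iota> b M"
  have loc: "presented_valued_algebra preceq \<iota> ?v b"
    using assms(1-3) M by unfold_locales (auto simp: is_weight_valuation_def)
  show "\<exists>C. prime_cone (relation_ideal \<iota> b) C \<and>
      algebra_isomorphic (ring_of_type_algebra Quot cone_initial_ideal C (relation_ideal \<iota> b))
        (quotient_const (cone_initial_ideal C (relation_ideal \<iota> b)))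
        (gr_ring preceq ?v) (gr_const preceq \<iota> ?v)"
    using presented_valued_algebra.adapted_prime_cone[OF loc
        presented_valued_algebra.weight_valuation_adapted[OF loc M refl]] .
next
  fix v assume v: "subductive preceq \<iota> v b"
  then have loc: "presented_valued_algebra preceq \<iota> v b"
    using assms(1-3) by unfold_locales (auto simp: subductive_def khovanskii_basis_def)
  show "\<exists>C. prime_cone (relation_ideal \<iota> b) C \<and>
      algebra_isomorphic (ring_of_type_algebra Quot cone_initial_ideal C (relation_ideal \<iota> b))
        (quotient_const (cone_initial_ideal C (relation_ideal \<iota> b)))
        (gr_ring preceq v) (gr_const preceq \<iota> v)"
    using presented_valued_algebra.adapted_prime_cone[OF loc
        presented_valued_algebra.subductive_adapted[OF loc v]] .
next
  fix G v
  assume G: "positive_grading \<iota> G" "\<forall>i. \<exists>d. b i \<in> G d"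
    and v: "khovanskii_basis preceq \<iota> v b" "homogeneous_valuation preceq G v"
  have loc: "presented_valued_algebra preceq \<iota> v b"
    using assms(1-3) v(1) by unfold_locales (auto simp: khovanskii_basis_def)
  show "\<exists>C. prime_cone (relation_ideal \<iota> b) C \<and>
      algebra_isomorphic (ring_of_type_algebra Quot cone_initial_ideal C (relation_ideal \<iota> b))
        (quotient_const (cone_initial_ideal C (relation_ideal \<iota> b)))
        (gr_ring preceq v) (gr_const preceq \<iota> v)"
    using presented_valued_algebra.adapted_prime_cone[OF loc
        presented_valued_algebra.homogeneous_valuation_adapted[OF loc assms(4) G v]] .
qed

end
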